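(* Orbit full groups are contractible: if $G$ is a Polish group acting in a Borel manner on a standard probability space $(X,\mu)$, then the orbit full group $[\mathcal R_G]$, equipped with the topology of convergence in measure, is a contractible topological space.
   Context: A standard probability space is a standard Borel space equipped with a non-atomic Borel probability measure. $\mathrm{Aut}(X,\mu)$ is the group of measure-preserving Borel bijections of $(X,\mu)$, identified when equal almost everywhere. A Borel action means that the action map $G\times X\to X$ is Borel. The orbit full group is $[\mathcal R_G]=\{T\in\mathrm{Aut}(X,\mu): T(x)\in G\cdot x \text{ for all (equivalently, almost all) } x\in X\}$. For a Polish space $Y$, $\mathrm L^0(X,\mu,Y)$ is the space of ($\mu$-)measurable maps $X\to Y$ up to equality a.e., with the topology of convergence in measure, induced by $\tilde d(f,g)=\int_X d(f(x),g(x))\,d\mu(x)$ for any compatible bounded metric $d$ on $Y$. Define $\Phi:\mathrm L^0(X,\mu,G)\to \mathrm L^0(X,\mu,X)$ by $\Phi(f)(x)=f(x)\cdot x$ and put $\widetilde{[\mathcal R_G]}:=\Phi^{-1}(\mathrm{Aut}(X,\mu))$. Then $\Phi(\widetilde{[\mathcal R_G]})=[\mathcal R_G]$, and the topology of convergence in measure on $[\mathcal R_G]$ is the quotient topology induced by $\Phi:\widetilde{[\mathcal R_G]}\to[\mathcal R_G]$, where $\widetilde{[\mathcal R_G]}$ has the subspace topology from $\mathrm L^0(X,\mu,G)$; it makes $[\mathcal R_G]$ a Polish group. *)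

theory Defs
  imports "HOL-Probability.Probability"
begin

section \<open>Standard probability spaces and Borel actions\<close>

definition standard_borel :: "'x measure \<Rightarrow> bool" where
  "standard_borel M \<longleftrightarrow>
     (\<exists>T. completely_metrizable_space T \<and> second_countable T \<and> topspace T = space M \<and>
          sets M = sigma_sets (topspace T) {U. openin T U})"

definition nonatomic :: "'x measure \<Rightarrow> bool" where
  "nonatomic M \<longleftrightarrow>
     (\<forall>A\<in>sets M. emeasure M A > 0 \<longrightarrow>
        (\<exists>B\<in>sets M. B \<subseteq> A \<and> 0 < emeasure M B \<and> emeasure M B < emeasure M A))"

definition standard_probability_space :: "'x measure \<Rightarrow> bool" where
  "standard_probability_space M \<longleftrightarrow> standard_borel M \<and> prob_space M \<and> nonatomic M"

text \<open>
  A Polish group is a type in the classes \<open>polish_space\<close> and \<open>topological_group_add\<close>. The class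
  \<open>topological_group_add\<close> extends \<open>group_add\<close>, which is not assumed to be commutative, so \<open>+\<close> is
  an arbitrary group operation written additively.
\<close>

definition borel_action ::
    "'x measure \<Rightarrow> ('g::{polish_space,topological_group_add} \<Rightarrow> 'x \<Rightarrow> 'x) \<Rightarrow> bool" where
  "borel_action M act \<longleftrightarrow>
     (\<forall>x\<in>space M. act 0 x = x) \<and>
     (\<forall>g h. \<forall>x\<in>space M. act (g + h) x = act g (act h x)) \<and>
     (\<lambda>(g, x). act g x) \<in> measurable (borel \<Otimes>\<^sub>M M) M"


section \<open>Measurable maps up to equality almost everywhere\<close>

definition ae_class :: "'x measure \<Rightarrow> 'y measure \<Rightarrow> ('x \<Rightarrow> 'y) \<Rightarrow> ('x \<Rightarrow> 'y) set" where
  "ae_class M N f = {g \<in> measurable M N. AE x in M. g x = f x}"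

definition L0 :: "'x measure \<Rightarrow> 'y measure \<Rightarrow> ('x \<Rightarrow> 'y) set set" where
  "L0 M N = ae_class M N ` measurable M N"

text \<open>
  The metric on \<open>L0 M borel\<close> integrates the bounded compatible metric \<open>min 1 (dist a b)\<close>;
  the choice of representatives does not matter, see \<open>L0_dist_eq\<close> below.
\<close>

definition L0_dist ::
    "'x measure \<Rightarrow> ('x \<Rightarrow> 'y::polish_space) set \<Rightarrow> ('x \<Rightarrow> 'y) set \<Rightarrow> real" where
  "L0_dist M C D = (LINT x|M. min 1 (dist ((SOME f. f \<in> C) x) ((SOME g. g \<in> D) x)))"

definition L0_topology :: "'x measure \<Rightarrow> ('x \<Rightarrow> 'y::polish_space) set topology" where
  "L0_topology M = Metric_space.mtopology (L0 M borel) (L0_dist M)"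

lemma ae_class_eq_iff:
  assumes "f \<in> measurable M N" "g \<in> measurable M N"
  shows "ae_class M N f = ae_class M N g \<longleftrightarrow> (AE x in M. f x = g x)"
proof
  assume "ae_class M N f = ae_class M N g"
  moreover have "f \<in> ae_class M N f" using assms by (simp add: ae_class_def)
  ultimately show "AE x in M. f x = g x" by (simp add: ae_class_def)
next
  assume fg: "AE x in M. f x = g x"
  have "(AE x in M. h x = f x) \<longleftrightarrow> (AE x in M. h x = g x)" for h
  proof
    show "AE x in M. h x = g x" if "AE x in M. h x = f x" using that fg by eventually_elim simp
    show "AE x in M. h x = f x" if "AE x in M. h x = g x" using that fg by eventually_elim simp
  qed
  then show "ae_class M N f = ae_class M N g" by (simp add: ae_class_def)
qed

lemma L0_dist_eq:
  fixes f g :: "'x \<Rightarrow> 'y::polish_space"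
  assumes "f \<in> borel_measurable M" "g \<in> borel_measurable M"
  shows "L0_dist M (ae_class M borel f) (ae_class M borel g) = (LINT x|M. min 1 (dist (f x) (g x)))"
proof -
  define f' where "f' = (SOME h. h \<in> ae_class M borel f)"
  define g' where "g' = (SOME h. h \<in> ae_class M borel g)"
  have "f' \<in> ae_class M borel f" unfolding f'_def
    by (rule someI[of _ f]) (simp add: ae_class_def assms)
  then have [measurable]: "f' \<in> borel_measurable M" and f': "AE x in M. f' x = f x"
    by (auto simp: ae_class_def)
  have "g' \<in> ae_class M borel g" unfolding g'_def
    by (rule someI[of _ g]) (simp add: ae_class_def assms)
  then have [measurable]: "g' \<in> borel_measurable M" and g': "AE x in M. g' x = g x"
    by (auto simp: ae_class_def)
  note [measurable] = assms
  have "(LINT x|M. min 1 (dist (f' x) (g' x))) = (LINT x|M. min 1 (dist (f x) (g x)))"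
  proof (rule integral_cong_AE)
    show "AE x in M. min 1 (dist (f' x) (g' x)) = min 1 (dist (f x) (g x))"
      using f' g' by eventually_elim simp
  qed measurable
  then show ?thesis by (simp add: L0_dist_def f'_def g'_def)
qed

lemma Metric_space_L0:
  assumes "prob_space M"
  shows "Metric_space (L0 M (borel :: 'y::polish_space measure)) (L0_dist M)"
proof -
  interpret prob_space M by fact
  have int: "integrable M (\<lambda>x. min 1 (dist (f x) (g x)))"
    if [measurable]: "f \<in> borel_measurable M" "g \<in> borel_measurable M" for f g :: "_ \<Rightarrow> 'y"
    by (rule integrable_const_bound[where B=1]) auto
  show ?thesis
  proof
    fix C D :: "('a \<Rightarrow> 'y) set"
    show "0 \<le> L0_dist M C D" by (auto simp: L0_dist_def)
    show "L0_dist M C D = L0_dist M D C" by (simp add: L0_dist_def dist_commute)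
  next
    fix C D :: "('a \<Rightarrow> 'y) set" assume "C \<in> L0 M borel" "D \<in> L0 M borel"
    then obtain f g where f[measurable]: "f \<in> borel_measurable M" and g[measurable]: "g \<in> borel_measurable M"
      and CD: "C = ae_class M borel f" "D = ae_class M borel g" by (auto simp: L0_def)
    have "L0_dist M C D = 0 \<longleftrightarrow> (AE x in M. min 1 (dist (f x) (g x)) = 0)"
      unfolding CD L0_dist_eq[OF f g]
      by (rule integral_nonneg_eq_0_iff_AE) (auto simp: int)
    also have "\<dots> \<longleftrightarrow> (AE x in M. f x = g x)"
      by (rule AE_cong) (auto simp: min_def)
    finally show "L0_dist M C D = 0 \<longleftrightarrow> C = D"
      unfolding CD ae_class_eq_iff[OF f g] .
  next
    fix C D E :: "('a \<Rightarrow> 'y) set" assume "C \<in> L0 M borel" "D \<in> L0 M borel" "E \<in> L0 M borel"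
    then obtain f g h where f: "f \<in> borel_measurable M" and g: "g \<in> borel_measurable M"
      and h: "h \<in> borel_measurable M"
      and CD: "C = ae_class M borel f" "D = ae_class M borel g" "E = ae_class M borel h"
      by (auto simp: L0_def)
    have "(LINT x|M. min 1 (dist (f x) (h x)))
        \<le> (LINT x|M. min 1 (dist (f x) (g x)) + min 1 (dist (g x) (h x)))"
    proof (rule integral_mono)
      show "min 1 (dist (f x) (h x)) \<le> min 1 (dist (f x) (g x)) + min 1 (dist (g x) (h x))" for x
        using dist_triangle[of "f x" "h x" "g x"] zero_le_dist[of "f x" "g x"]
          zero_le_dist[of "g x" "h x"] unfolding min_def by (smt (verit))
    qed (intro int f g h Bochner_Integration.integrable_add)+
    also have "\<dots> = (LINT x|M. min 1 (dist (f x) (g x))) + (LINT x|M. min 1 (dist (g x) (h x)))"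
      by (intro Bochner_Integration.integral_add int f g h)
    finally show "L0_dist M C E \<le> L0_dist M C D + L0_dist M D E"
      unfolding CD by (simp add: L0_dist_eq f g h)
  qed
qed


section \<open>The orbit full group\<close>

text \<open>On a standard Borel space the inverse of a Borel bijection is automatically Borel.\<close>

definition mp_bijections :: "'x measure \<Rightarrow> ('x \<Rightarrow> 'x) set" where
  "mp_bijections M = {T \<in> measurable M M. bij_betw T (space M) (space M) \<and> distr M M T = M}"

definition Aut :: "'x measure \<Rightarrow> ('x \<Rightarrow> 'x) set set" where
  "Aut M = ae_class M M ` mp_bijections M"

definition orbit_full_group :: "'x measure \<Rightarrow> ('g \<Rightarrow> 'x \<Rightarrow> 'x) \<Rightarrow> ('x \<Rightarrow> 'x) set set" where
  "orbit_full_group M act =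
     ae_class M M ` {T \<in> mp_bijections M. AE x in M. T x \<in> range (\<lambda>g. act g x)}"

text \<open>For \<open>C\<close> in \<open>L0 M borel\<close>, this is the class of \<open>\<lambda>x. act (f x) x\<close>, for any \<open>f\<close> in \<open>C\<close>.\<close>

definition orbit_map :: "'x measure \<Rightarrow> ('g \<Rightarrow> 'x \<Rightarrow> 'x) \<Rightarrow> ('x \<Rightarrow> 'g) set \<Rightarrow> ('x \<Rightarrow> 'x) set" where
  "orbit_map M act C = {h \<in> measurable M M. \<exists>f\<in>C. AE x in M. h x = act (f x) x}"

definition full_group_lift ::
    "'x measure \<Rightarrow> ('g::polish_space \<Rightarrow> 'x \<Rightarrow> 'x) \<Rightarrow> ('x \<Rightarrow> 'g) set set" where
  "full_group_lift M act = {C \<in> L0 M borel. orbit_map M act C \<in> Aut M}"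

text \<open>The finest topology on \<open>S\<close> making \<open>p\<close> continuous; the quotient topology if \<open>p\<close> is onto \<open>S\<close>.\<close>

definition quotient_topology :: "'a topology \<Rightarrow> ('a \<Rightarrow> 'b) \<Rightarrow> 'b set \<Rightarrow> 'b topology" where
  "quotient_topology X p S = topology (\<lambda>U. U \<subseteq> S \<and> openin X {x \<in> topspace X. p x \<in> U})"

lemma openin_quotient_topology:
  "openin (quotient_topology X p S) U \<longleftrightarrow> U \<subseteq> S \<and> openin X {x \<in> topspace X. p x \<in> U}"
proof -
  have "{x \<in> topspace X. p x \<in> U \<inter> V} = {x \<in> topspace X. p x \<in> U} \<inter> {x \<in> topspace X. p x \<in> V}"
    for U V by auto
  moreover have "{x \<in> topspace X. p x \<in> \<Union>K} = (\<Union>U\<in>K. {x \<in> topspace X. p x \<in> U})" for K by auto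
  ultimately have "istopology (\<lambda>U. U \<subseteq> S \<and> openin X {x \<in> topspace X. p x \<in> U})"
    unfolding istopology_def by (metis (no_types, lifting) Sup_le_iff imageE le_infI1 openin_Int openin_Union)
  then show ?thesis by (simp add: quotient_topology_def topology_inverse')
qed

lemma topspace_quotient_topology:
  assumes "p ` topspace X \<subseteq> S"
  shows "topspace (quotient_topology X p S) = S"
proof -
  have "{x \<in> topspace X. p x \<in> S} = topspace X" using assms by auto
  then have "openin (quotient_topology X p S) S" by (simp add: openin_quotient_topology)
  then show ?thesis
    by (metis openin_quotient_topology openin_subset openin_topspace subset_antisym)
qed

definition full_group_topology ::
    "'x measure \<Rightarrow> ('g::polish_space \<Rightarrow> 'x \<Rightarrow> 'x) \<Rightarrow> ('x \<Rightarrow> 'x) set topology" where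
  "full_group_topology M act =
     quotient_topology (subtopology (L0_topology M) (full_group_lift M act))
       (orbit_map M act) (orbit_full_group M act)"

lemma topspace_full_group_topology:
  "topspace (full_group_topology M act) = orbit_full_group M act"
proof -
  have "orbit_map M act C \<in> orbit_full_group M act" if "C \<in> full_group_lift M act" for C
  proof -
    from that obtain T where T: "T \<in> mp_bijections M" "orbit_map M act C = ae_class M M T"
      by (auto simp: full_group_lift_def Aut_def)
    then have "T \<in> orbit_map M act C" by (simp add: ae_class_def mp_bijections_def)
    then obtain f where "AE x in M. T x = act (f x) x" by (auto simp: orbit_map_def)
    then have "AE x in M. T x \<in> range (\<lambda>g. act g x)" by eventually_elim simp
    with T show ?thesis by (auto simp: orbit_full_group_def)
  qed
  then show ?thesis
    unfolding full_group_topology_def by (intro topspace_quotient_topology) auto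
qed

end

theory Submission
  imports Defs "HOL-Library.Diagonal_Subsequence"
begin

text \<open>
  Following Keane, the homotopy moves \<open>T\<close> to the identity through the first return maps \<open>T\<^sub>A\<close> of \<open>T\<close>
  to the sets \<open>A = {u < 1 - t}\<close>, where \<open>u\<close> is an injective measurable function with values in \<open>[0,1)\<close>.
  If \<open>T x = f x \<cdot> x\<close>, then \<open>T\<^sub>A\<close> is given by the cocycle of \<open>f\<close> stopped at the return time, so it suffices
  that this cocycle depends continuously on \<open>(t, f)\<close> in measure: the interval is locally compact,
  hence the product of the quotient map \<open>\<Phi>\<close> with it is again a quotient map.

  The point is that convergence of \<open>f k\<close> to \<open>f\<close> in measure forces the maps \<open>T k\<close> to converge weakly to \<open>T\<close>,
  although the action is only Borel. A countable family of Vaught transforms is open along orbits and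
  separates points. For such a set \<open>A\<close> the events \<open>T k x \<in> A\<close> have constant probability and in the limit
  contain \<open>T x \<in> A\<close>, so they converge; and a countable separating family generates all measurable
  sets up to null sets, since a measurable injection is inverted on compact subsets of its graph.
  That \<open>\<Phi>\<close> is onto the full group is a measurable selection, obtained from Choquet's capacity argument.
\<close>

section \<open>Baire category and orbit-open sets\<close>

text \<open>The cocycle of length \<open>n\<close> evaluates \<open>f k\<close> at the moving point
  \<open>(T k ^^ n) x\<close>, whereas convergence in measure compares \<open>f k\<close> and
  \<open>f'\<close> at the same point. As \<open>f'\<close> is merely measurable, nothing is known a
  priori about \<open>f' (T k x)\<close> as \<open>k\<close> grows. This obstacle is the reason for
  the weak convergence: it is what allows \<open>f' (T k x)\<close> to be replaced by
  \<open>f' (T' x)\<close> in the limit.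

  The estimates are made upstairs, on group-valued functions, because the topology of the full group
  is given only as a quotient. The orbit-open sets stand in for a topology on the space in which the
  orbit maps are continuous.

  The inversion of injective Borel maps and the uniformization of Borel sets enter only in
  almost-everywhere form. In that form both come down to exhausting a set by compact pieces up to a
  null set.\<close>

definition meager :: "'a::topological_space set \<Rightarrow> bool" where
  "meager S \<longleftrightarrow> (\<exists>\<C>. countable \<C> \<and> (\<forall>C\<in>\<C>. closed C \<and> interior C = {}) \<and> S \<subseteq> \<Union>\<C>)"

lemma meager_subset: "meager T \<Longrightarrow> S \<subseteq> T \<Longrightarrow> meager S"
  unfolding meager_def by (meson order_trans)

lemma meager_empty [simp]: "meager {}"
  unfolding meager_def by (rule exI[of _ "{}"]) auto

lemma meager_UN:
  assumes "countable I" "\<And>i. i \<in> I \<Longrightarrow> meager (S i)"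
  shows "meager (\<Union>i\<in>I. S i)"
proof -
  from assms(2) have "\<forall>i\<in>I. \<exists>\<C>. countable \<C> \<and> (\<forall>C\<in>\<C>. closed C \<and> interior C = {}) \<and> S i \<subseteq> \<Union>\<C>"
    by (simp add: meager_def)
  then obtain \<C> where "\<forall>i\<in>I. countable (\<C> i) \<and> (\<forall>C\<in>\<C> i. closed C \<and> interior C = {}) \<and> S i \<subseteq> \<Union>(\<C> i)"
    by metis
  then show ?thesis unfolding meager_def
    by (intro exI[of _ "\<Union>i\<in>I. \<C> i"]) (use assms(1) in \<open>auto; blast\<close>)
qed

lemma meager_Un: "meager S \<Longrightarrow> meager T \<Longrightarrow> meager (S \<union> T)"
  using meager_UN[of "{True, False}" "\<lambda>b. if b then S else T"] by (simp add: Un_commute)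

lemma meager_nowhere_dense: "closed C \<Longrightarrow> interior C = {} \<Longrightarrow> meager C"
  unfolding meager_def by (rule exI[of _ "{C}"]) auto

lemma meager_open_iff:
  fixes U :: "'a::polish_space set"
  assumes "open U"
  shows "meager U \<longleftrightarrow> U = {}"
proof
  assume "meager U"
  then obtain \<C> where \<C>: "countable \<C>" "\<forall>C\<in>\<C>. closed C \<and> interior C = {}" "U \<subseteq> \<Union>\<C>"
    by (auto simp: meager_def)
  have "euclidean interior_of \<Union>\<C> = {}"
  proof (rule Baire_category_alt)
    show "completely_metrizable_space (euclidean :: 'a topology) \<or>
        locally_compact_space (euclidean :: 'a topology) \<and> regular_space (euclidean :: 'a topology)"
      using completely_metrizable_space_euclidean by blast
  qed (use \<C> in auto)
  then have "interior (\<Union>\<C>) = {}" by simp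
  with interior_maximal[OF \<C>(3) assms] show "U = {}" by simp
qed simp

lemma Borel_Baire_property:
  fixes A :: "'a::polish_space set"
  assumes "A \<in> sets borel"
  obtains U where "open U" "meager (A - U)" "meager (U - A)"
proof -
  have "A \<in> sigma_sets UNIV {S. open S}" using assms by (simp add: borel_def)
  then have "\<exists>U. open U \<and> meager (A - U) \<and> meager (U - A)"
  proof induction
    case (Basic a)
    then show ?case by (intro exI[of _ a]) simp
  next
    case Empty
    show ?case by (intro exI[of _ "{}"]) simp
  next
    case (Compl A)
    then obtain U where U: "open U" "meager (A - U)" "meager (U - A)" by auto
    \<comment> \<open>The boundary of \<open>U\<close> is closed and nowhere dense, so replacing the
      closed set \<open>- U\<close> by its interior costs only a meager set.\<close>
    let ?V = "interior (- U)"
    have "interior (- U - ?V) = {}"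
      using interior_mono[of "- U - ?V" "- U"] interior_subset[of "- U - ?V"] by blast
    then have "meager (- U - ?V)"
      using U(1) by (intro meager_nowhere_dense) (auto simp: closed_Diff)
    then have "meager ((U - A) \<union> (- U - ?V))" using U by (intro meager_Un)
    moreover have "(UNIV - A) - ?V \<subseteq> (U - A) \<union> (- U - ?V)" by auto
    ultimately have "meager ((UNIV - A) - ?V)" by (rule meager_subset)
    moreover have "?V - (UNIV - A) \<subseteq> A - U" using interior_subset by auto
    ultimately show ?case using U by (intro exI[of _ ?V]) (auto intro: meager_subset)
  next
    case (Union A)
    then obtain U where U: "\<And>i::nat. open (U i)" "\<And>i. meager (A i - U i)" "\<And>i. meager (U i - A i)"
      by metis
    have "meager (\<Union>i. A i - U i)" "meager (\<Union>i. U i - A i)" using U by (auto intro: meager_UN)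
    moreover have "(\<Union>i. A i) - (\<Union>i. U i) \<subseteq> (\<Union>i. A i - U i)"
      "(\<Union>i. U i) - (\<Union>i. A i) \<subseteq> (\<Union>i. U i - A i)" by auto
    ultimately show ?case using U(1)
      by (intro exI[of _ "\<Union>i. U i"]) (auto intro: meager_subset)
  qed
  with that show ?thesis by blast
qed

text \<open>Category inside \<open>U\<close> is read off the open representative \<open>W\<close> of
  \<open>A\<close>: up to a meager set \<open>A \<inter> U\<close> is \<open>W \<inter> U\<close>,
  and by Baire's theorem a meager open set is empty.\<close>

lemma meager_Int_open_iff:
  fixes W :: "'a::polish_space set"
  assumes "open W" "meager (A - W)" "meager (W - A)" "open U"
  shows "meager (A \<inter> U) \<longleftrightarrow> W \<inter> U = {}"
proof
  assume "meager (A \<inter> U)"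
  then have "meager ((A \<inter> U) \<union> (W - A))" using assms by (intro meager_Un)
  then have "meager (W \<inter> U)" by (rule meager_subset) auto
  then show "W \<inter> U = {}" using assms meager_open_iff[of "W \<inter> U"] by auto
next
  assume "W \<inter> U = {}"
  then have "A \<inter> U \<subseteq> A - W" by auto
  then show "meager (A \<inter> U)" using assms meager_subset by blast
qed

text \<open>Trades a statement about the complement of \<open>A\<close> for statements about
  \<open>A\<close> itself, one for each basic open subset of \<open>U\<close>; with a countable
  basis this is the complement step of a measurability induction. If \<open>A\<close> is nonmeager
  in every such subset, its open representative \<open>W\<close> is dense in
  \<open>U\<close>.\<close>

lemma meager_open_Diff_Borel_iff:
  fixes A :: "'a::polish_space set"
  assumes A: "A \<in> sets borel" and U: "open U" and \<V>: "topological_basis \<V>"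
  shows "meager (U - A) \<longleftrightarrow> (\<forall>V\<in>\<V>. V \<subseteq> U \<longrightarrow> V \<noteq> {} \<longrightarrow> \<not> meager (A \<inter> V))"
proof -
  obtain W where W: "open W" "meager (A - W)" "meager (W - A)" using Borel_Baire_property[OF A] .
  have V: "open V" if "V \<in> \<V>" for V using \<V> that by (simp add: topological_basis_open)
  show ?thesis
  proof
    assume m: "meager (U - A)"
    show "\<forall>V\<in>\<V>. V \<subseteq> U \<longrightarrow> V \<noteq> {} \<longrightarrow> \<not> meager (A \<inter> V)"
    proof (intro ballI impI notI)
      fix V assume "V \<in> \<V>" "V \<subseteq> U" "V \<noteq> {}" "meager (A \<inter> V)"
      then have "meager ((U - A) \<union> (A \<inter> V))" using m by (intro meager_Un)
      then have "meager V" by (rule meager_subset) (use \<open>V \<subseteq> U\<close> in auto)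
      then show False using V[OF \<open>V \<in> \<V>\<close>] \<open>V \<noteq> {}\<close> by (simp add: meager_open_iff)
    qed
  next
    assume *: "\<forall>V\<in>\<V>. V \<subseteq> U \<longrightarrow> V \<noteq> {} \<longrightarrow> \<not> meager (A \<inter> V)"
    have "interior (U - W) = {}"
    proof (rule ccontr)
      assume "interior (U - W) \<noteq> {}"
      then obtain x where "x \<in> interior (U - W)" by auto
      with topological_basisE[OF \<V> open_interior] obtain V where "V \<in> \<V>" "x \<in> V" "V \<subseteq> interior (U - W)"
        by metis
      then have "V \<in> \<V>" "x \<in> V" "V \<subseteq> U" "W \<inter> V = {}" using interior_subset by blast+
      with * have "\<not> meager (A \<inter> V)" by auto
      then show False using meager_Int_open_iff[OF W V[OF \<open>V \<in> \<V>\<close>]] \<open>W \<inter> V = {}\<close> by simp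
    qed
    \<comment> \<open>The meager cover must be closed, which \<open>U - W\<close> need not be.
      Passing to \<open>closure U\<close> adds only boundary points, and an open set that misses
      \<open>U\<close> misses its closure.\<close>
    moreover have "interior (closure U - W - U) = {}"
    proof -
      have "interior (closure U - W - U) \<inter> U = {}"
        using interior_subset by blast
      then have "interior (closure U - W - U) \<inter> closure U = {}"
        by (simp add: open_Int_closure_eq_empty)
      then show ?thesis using interior_subset by blast
    qed
    ultimately have "interior (closure U - W) = {}"
    proof -
      have "interior (closure U - W) \<inter> U \<subseteq> interior (U - W)"
        using interior_subset U by (intro interior_maximal) auto
      then have "interior (closure U - W) \<inter> U = {}" using \<open>interior (U - W) = {}\<close> by simp
      then have "interior (closure U - W) \<subseteq> closure U - W - U" using interior_subset by blast
      then have "interior (closure U - W) \<subseteq> interior (closure U - W - U)" by (intro interior_maximal) auto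
      then show ?thesis using \<open>interior (closure U - W - U) = {}\<close> by simp
    qed
    then have "meager (closure U - W)" using W by (intro meager_nowhere_dense) (auto simp: closed_Diff)
    then have "meager ((closure U - W) \<union> (W - A))" using W by (intro meager_Un)
    then show "meager (U - A)" by (rule meager_subset) (use closure_subset in auto)
  qed
qed

text \<open>The category counterpart of the measurability of section measures (Montgomery, Novikov).
  The induction treats all open \<open>U\<close> at once, because the complement case invokes the
  hypothesis for the basic open sets inside \<open>U\<close>.\<close>

lemma measurable_nonmeager_section:
  fixes E :: "('g::polish_space \<times> 'x) set"
  assumes E: "E \<in> sets (borel \<Otimes>\<^sub>M M)" and U: "open U"
  shows "{x \<in> space M. \<not> meager ({g. (g, x) \<in> E} \<inter> U)} \<in> sets M"
proof -
  have "E \<in> sigma_sets (UNIV \<times> space M) {a \<times> b |a b. a \<in> sets (borel :: 'g measure) \<and> b \<in> sets M}"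
    using E by (simp add: sets_pair_measure)
  then have "E \<in> sets (borel \<Otimes>\<^sub>M M) \<and> (\<forall>U. open U \<longrightarrow>
      {x \<in> space M. \<not> meager ({g. (g, x) \<in> E} \<inter> U)} \<in> sets M)"
  proof induction
    case (Basic c)
    then obtain a b where c: "c = a \<times> b" "a \<in> sets borel" "b \<in> sets M" by auto
    have "{x \<in> space M. \<not> meager ({g. (g, x) \<in> c} \<inter> U)} = (if meager (a \<inter> U) then {} else b)" for U
    proof -
      have "{g. (g, x) \<in> c} = (if x \<in> b then a else {})" for x using c(1) by auto
      then show ?thesis using sets.sets_into_space[OF c(3)] by auto
    qed
    with c show ?case by auto
  next
    case Empty
    then show ?case by simp
  next
    case (Compl E)
    then have [measurable]: "E \<in> sets (borel \<Otimes>\<^sub>M M)" by simp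
    obtain \<V> :: "'g set set" where \<V>: "countable \<V>" "topological_basis \<V>" using ex_countable_basis by auto
    have "{x \<in> space M. \<not> meager ({g. (g, x) \<in> UNIV \<times> space M - E} \<inter> U)}
        = space M - {x \<in> space M. \<forall>V\<in>{V\<in>\<V>. V \<subseteq> U \<and> V \<noteq> {}}. \<not> meager ({g. (g, x) \<in> E} \<inter> V)}"
      if "open U" for U
    proof -
      have "meager ({g. (g, x) \<in> UNIV \<times> space M - E} \<inter> U)
          \<longleftrightarrow> (\<forall>V\<in>{V\<in>\<V>. V \<subseteq> U \<and> V \<noteq> {}}. \<not> meager ({g. (g, x) \<in> E} \<inter> V))"
        if "x \<in> space M" for x
      proof -
        have "{g. (g, x) \<in> E} \<in> sets borel"
          using sets_Pair2[of E borel M x] by (simp add: vimage_def)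
        note * = meager_open_Diff_Borel_iff[OF this \<open>open U\<close> \<V>(2)]
        show ?thesis
        proof -
          have "{g. (g, x) \<in> UNIV \<times> space M - E} \<inter> U = U - {g. (g, x) \<in> E}" using that by auto
          with * show ?thesis by auto
        qed
      qed
      then show ?thesis by auto
    qed
    moreover have "{x \<in> space M. \<forall>V\<in>{V\<in>\<V>. V \<subseteq> U \<and> V \<noteq> {}}. \<not> meager ({g. (g, x) \<in> E} \<inter> V)} \<in> sets M" for U
    proof (rule sets.sets_Collect_countable_All')
      show "{x \<in> space M. \<not> meager ({g. (g, x) \<in> E} \<inter> V)} \<in> sets M" if "V \<in> {V\<in>\<V>. V \<subseteq> U \<and> V \<noteq> {}}" for V
        using Compl \<V> that topological_basis_open by blast
    qed (use \<V> in auto)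
    ultimately show ?case by (simp add: space_pair_measure[symmetric])
  next
    case (Union E)
    have "{x \<in> space M. \<not> meager ({g. (g, x) \<in> (\<Union>i::nat. E i)} \<inter> U)}
        = (\<Union>i. {x \<in> space M. \<not> meager ({g. (g, x) \<in> E i} \<inter> U)})" for U
    proof -
      have "meager ({g. (g, x) \<in> (\<Union>i::nat. E i)} \<inter> U) \<longleftrightarrow> (\<forall>i. meager ({g. (g, x) \<in> E i} \<inter> U))" for x
      proof
        assume "\<forall>i. meager ({g. (g, x) \<in> E i} \<inter> U)"
        then have "meager (\<Union>i. {g. (g, x) \<in> E i} \<inter> U)" by (intro meager_UN) auto
        then show "meager ({g. (g, x) \<in> (\<Union>i::nat. E i)} \<inter> U)" by (rule meager_subset) auto
      next
        assume m: "meager ({g. (g, x) \<in> (\<Union>i::nat. E i)} \<inter> U)"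
        show "\<forall>i. meager ({g. (g, x) \<in> E i} \<inter> U)"
          by (intro allI meager_subset[OF m]) auto
      qed
      then show ?thesis by auto
    qed
    with Union show ?case by auto
  qed
  with U show ?thesis by blast
qed

text \<open>
  The sets are Vaught transforms: the points \<open>x\<close> such that \<open>act g x \<in> A\<close> for a nonmeager set of \<open>g \<in> U\<close>.
  Translating by \<open>g\<close> turns \<open>U\<close> into \<open>U + g\<close>, and by the Baire property meeting \<open>U + g\<close> in a nonmeager set
  is an open condition on \<open>g\<close>.
\<close>

lemma orbit_open_separating:
  fixes M :: "'x measure"
    and act :: "'g::{polish_space,topological_group_add} \<Rightarrow> 'x \<Rightarrow> 'x"
    and B :: "nat \<Rightarrow> 'x set"
  assumes act: "borel_action M act"
    and B: "\<And>n. B n \<in> sets M"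
    and sep: "\<And>x y. x \<in> space M \<Longrightarrow> y \<in> space M \<Longrightarrow> x \<noteq> y \<Longrightarrow> \<exists>n. x \<in> B n \<and> y \<notin> B n"
  obtains Q :: "nat \<Rightarrow> 'x set" where "\<And>n. Q n \<in> sets M"
    "\<And>n x. x \<in> space M \<Longrightarrow> open {g. act g x \<in> Q n}"
    "\<And>x y. x \<in> space M \<Longrightarrow> y \<in> space M \<Longrightarrow> x \<noteq> y \<Longrightarrow> \<exists>n. x \<in> Q n \<and> y \<notin> Q n"
proof -
  have act0: "act 0 x = x" and actadd: "act (g + h) x = act g (act h x)"
    if "x \<in> space M" for x g h using act that by (auto simp: borel_action_def)
  have actm [measurable]: "(\<lambda>(g, x). act g x) \<in> measurable (borel \<Otimes>\<^sub>M M) M"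
    using act by (simp add: borel_action_def)
  have actx [measurable]: "(\<lambda>g. act g x) \<in> measurable borel M" if "x \<in> space M" for x
    using measurable_compose[OF measurable_Pair2' actm] that by simp
  have in_space: "act g x \<in> space M" if "x \<in> space M" for g x
    using measurable_space[OF actx[OF that]] by simp
  define \<Delta> where "\<Delta> A U = {x \<in> space M. \<not> meager ({g. act g x \<in> A} \<inter> U)}" for A and U :: "'g set"
  have Borel: "{g. act g x \<in> A} \<in> sets borel" if "A \<in> sets M" "x \<in> space M" for A x
    using measurable_sets[OF actx[OF that(2)] that(1)] by (simp add: vimage_def)
  have \<Delta>_sets: "\<Delta> A U \<in> sets M" if A: "A \<in> sets M" and U: "open U" for A U
  proof -
    have "{p \<in> space (borel \<Otimes>\<^sub>M M). (\<lambda>(g, x). act g x) p \<in> A} \<in> sets (borel \<Otimes>\<^sub>M M)"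
      using A by measurable
    from measurable_nonmeager_section[OF this U] have
      "{x \<in> space M. \<not> meager ({g. (g, x) \<in> {p \<in> space (borel \<Otimes>\<^sub>M M). (\<lambda>(g, x). act g x) p \<in> A}} \<inter> U)} \<in> sets M" .
    also have "{x \<in> space M. \<not> meager ({g. (g, x) \<in> {p \<in> space (borel \<Otimes>\<^sub>M M). (\<lambda>(g, x). act g x) p \<in> A}} \<inter> U)}
      = \<Delta> A U" by (auto simp: \<Delta>_def space_pair_measure)
    finally show ?thesis .
  qed
  have \<Delta>_open: "open {g. act g x \<in> \<Delta> A U}" if A: "A \<in> sets M" and U: "open U" and x: "x \<in> space M" for A U x
  proof -
    obtain W where W: "open W" "meager ({h. act h x \<in> A} - W)" "meager (W - {h. act h x \<in> A})"
      using Borel_Baire_property[OF Borel[OF A x]] .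
    have shift: "meager ((\<lambda>h. h + g) -` S)" if "meager S" for g and S :: "'g set"
    proof -
      from that obtain \<C> where \<C>: "countable \<C>" "\<forall>C\<in>\<C>. closed C \<and> interior C = {}" "S \<subseteq> \<Union>\<C>"
        by (auto simp: meager_def)
      have "closed ((\<lambda>h. h + g) -` C) \<and> interior ((\<lambda>h. h + g) -` C) = {}" if "C \<in> \<C>" for C
      proof
        show "closed ((\<lambda>h. h + g) -` C)"
          using \<C> that by (intro continuous_closed_vimage continuous_intros) auto
        let ?I = "interior ((\<lambda>h. h + g) -` C)"
        have "open ((\<lambda>h. h - g) -` ?I)" by (intro open_vimage continuous_intros) auto
        moreover have "(\<lambda>h. h - g) -` ?I \<subseteq> C"
        proof
          fix h assume "h \<in> (\<lambda>h. h - g) -` ?I"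
          then have "h - g \<in> (\<lambda>h. h + g) -` C" using interior_subset by blast
          then show "h \<in> C" by simp
        qed
        ultimately have "(\<lambda>h. h - g) -` ?I \<subseteq> interior C" by (rule interior_maximal[rotated])
        then have "(\<lambda>h. h - g) -` ?I = {}" using \<C> that by auto
        then have "h \<notin> ?I" for h using add_diff_cancel[of h g] by (metis empty_iff vimageI)
        then show "?I = {}" by auto
      qed
      then show ?thesis unfolding meager_def using \<C>
        by (intro exI[of _ "(\<lambda>C. (\<lambda>h. h + g) -` C) ` \<C>"]) (auto; blast)
    qed
    have "act g x \<in> \<Delta> A U \<longleftrightarrow> (\<exists>u\<in>U. u + g \<in> W)" for g
    proof -
      let ?W = "(\<lambda>h. h + g) -` W"
      have "open ?W" by (intro open_vimage continuous_intros W)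
      moreover have "{h. act h (act g x) \<in> A} = (\<lambda>h. h + g) -` {h. act h x \<in> A}"
        using x by (simp add: vimage_def actadd)
      then have "meager ({h. act h (act g x) \<in> A} - ?W)" "meager (?W - {h. act h (act g x) \<in> A})"
        using shift[OF W(2), of g] shift[OF W(3), of g] by (simp_all add: vimage_Diff)
      ultimately have "meager ({h. act h (act g x) \<in> A} \<inter> U) \<longleftrightarrow> ?W \<inter> U = {}"
        using U by (intro meager_Int_open_iff)
      then show ?thesis unfolding \<Delta>_def using in_space[OF x] by auto
    qed
    then have "{g. act g x \<in> \<Delta> A U} = (\<Union>u\<in>U. (\<lambda>g. u + g) -` W)" by auto
    moreover have "open (\<Union>u\<in>U. (\<lambda>g. u + g) -` W)"
      by (intro open_UN ballI open_vimage continuous_intros W)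
    ultimately show ?thesis by simp
  qed
  obtain \<V> :: "'g set set" where \<V>: "countable \<V>" "topological_basis \<V>" using ex_countable_basis by auto
  have \<V>ne: "\<V> \<noteq> {}" by (metis \<V>(2) empty_iff open_UNIV topological_basisE UNIV_I)
  define V where "V = from_nat_into \<V>"
  have Vo: "open (V n)" for n unfolding V_def by (rule topological_basis_open[OF \<V>(2) from_nat_into[OF \<V>ne]])
  define Q where "Q n = (case prod_decode n of (i, j) \<Rightarrow> \<Delta> (B i) (V j))" for n
  show thesis
  proof
    show "Q n \<in> sets M" for n using \<Delta>_sets[OF B Vo] by (auto simp: Q_def split: prod.splits)
    show "open {g. act g x \<in> Q n}" if "x \<in> space M" for n x
      using \<Delta>_open[OF B Vo that] by (auto simp: Q_def split: prod.splits)
  next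
    fix x y assume xy: "x \<in> space M" "y \<in> space M" "x \<noteq> y"
    have "act g x \<noteq> act g y" for g
    proof
      assume "act g x = act g y"
      then have "act (- g) (act g x) = act (- g) (act g y)" by simp
      then show False using xy by (simp add: actadd[symmetric] act0)
    qed
    then have "\<exists>n. act g x \<in> B n \<and> act g y \<notin> B n" for g using sep in_space xy by metis
    \<comment> \<open>Countably many sets cover the group, so by Baire's theorem a single
      \<open>n\<close> separates for a nonmeager set of \<open>g\<close>. On a basic open set inside
      its open representative comeager many \<open>g\<close> separate, so there the transform of
      \<open>B n\<close> contains \<open>x\<close> but not \<open>y\<close>.\<close>
    then have "UNIV = (\<Union>n. {g. act g x \<in> B n} - {g. act g y \<in> B n})" by auto
    moreover have "\<not> meager (UNIV :: 'g set)" by (simp add: meager_open_iff)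
    ultimately obtain n where n: "\<not> meager ({g. act g x \<in> B n} - {g. act g y \<in> B n})"
      using meager_UN[of UNIV "\<lambda>n. {g. act g x \<in> B n} - {g. act g y \<in> B n}"] by auto
    let ?Z = "{g. act g x \<in> B n} - {g. act g y \<in> B n}"
    obtain W where W: "open W" "meager (?Z - W)" "meager (W - ?Z)"
      using Borel_Baire_property[of ?Z] Borel[OF B] xy by blast
    have "W \<noteq> {}" using n W(2) by auto
    then obtain g where "g \<in> W" by auto
    then obtain V' where V': "V' \<in> \<V>" "g \<in> V'" "V' \<subseteq> W" using topological_basisE[OF \<V>(2) W(1)] by metis
    then obtain j where j: "V' = V j" unfolding V_def
      by (metis \<V>(1) from_nat_into_surj)
    have "meager ({g. act g y \<in> B n} \<inter> V')" by (rule meager_subset[OF W(3)]) (use V' in auto)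
    moreover have "\<not> meager ({g. act g x \<in> B n} \<inter> V')"
    proof
      assume "meager ({g. act g x \<in> B n} \<inter> V')"
      then have "meager (({g. act g x \<in> B n} \<inter> V') \<union> (W - ?Z))" using W by (intro meager_Un)
      then have "meager V'" by (rule meager_subset) (use V' in auto)
      then show False using V' j Vo by (auto simp: meager_open_iff)
    qed
    ultimately have "x \<in> \<Delta> (B n) (V j) \<and> y \<notin> \<Delta> (B n) (V j)" using xy j by (simp add: \<Delta>_def)
    then show "\<exists>k. x \<in> Q k \<and> y \<notin> Q k" by (intro exI[of _ "prod_encode (n, j)"]) (simp add: Q_def)
  qed
qed

section \<open>Standard Borel spaces\<close>

text \<open>Points are coded by their distances to a dense sequence. This moves from
  \<open>'x\<close>, whose topology is only a term, to the type
  \<open>nat \<Rightarrow> real\<close>, where the type-class results on Polish spaces apply; the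
  Borel left inverse \<open>e'\<close> leads back.\<close>

lemma standard_borel_embedding:
  fixes M :: "'x measure"
  assumes M: "standard_borel M" and ne: "space M \<noteq> {}"
  obtains e :: "'x \<Rightarrow> nat \<Rightarrow> real" and e' where "e \<in> borel_measurable M" "e' \<in> measurable borel M"
    "\<And>x. x \<in> space M \<Longrightarrow> e' (e x) = x"
proof -
  obtain T where T: "completely_metrizable_space T" "second_countable T" "topspace T = space M"
    and sets: "sets M = sigma_sets (topspace T) {U. openin T U}"
    using M by (auto simp: standard_borel_def)
  obtain S d where Sd: "Metric_space S d" "Metric_space.mcomplete S d" "T = Metric_space.mtopology S d"
    using T(1) by (auto simp: completely_metrizable_space_def)
  interpret Metric_space S d by fact
  have S: "S = space M" using T(3) Sd(3) by simp
  obtain C where C: "countable C" "C \<subseteq> S" "T closure_of C = S"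
    using second_countable_imp_separable_space[OF T(2)] T(3) S by (auto simp: separable_space_def)
  have dense: "\<exists>c\<in>C. d x c < r" if "x \<in> S" "r > 0" for x r
  proof -
    have "x \<in> mtopology closure_of C" using C(3) Sd(3) that by simp
    then show ?thesis using that by (auto simp: metric_closure_of in_mball)
  qed
  have "C \<noteq> {}"
  proof -
    obtain x where "x \<in> S" using ne S by auto
    then show ?thesis using dense[of x 1] by auto
  qed
  define q where "q = from_nat_into C"
  have qS: "q n \<in> S" for n unfolding q_def using C(2) from_nat_into[OF \<open>C \<noteq> {}\<close>, of n] by auto
  have dense': "\<exists>n. d x (q n) < r" if "x \<in> S" "r > 0" for x r
  proof -
    from dense[OF that] obtain c where c: "c \<in> C" "d x c < r" by auto
    obtain n where "from_nat_into C n = c" using from_nat_into_surj[OF C(1) c(1)] by auto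
    with c show ?thesis unfolding q_def by auto
  qed
  define e where "e x n = d x (q n)" for x n
  have openM: "U \<in> sets M" if "openin T U" for U using that sets by (auto intro: sigma_sets.Basic)
  have e_meas: "e \<in> borel_measurable M"
  proof (rule measurable_coordinatewise_then_product)
    fix n
    show "(\<lambda>x. e x n) \<in> borel_measurable M"
    proof (rule borel_measurableI_less)
      fix y
      have "{x \<in> space M. e x n < y} = mball (q n) y"
        using qS[of n] unfolding e_def S[symmetric] commute[of _ "q n"] mball_def by simp
      then show "{x \<in> space M. e x n < y} \<in> sets M" using openM Sd(3) by simp
    qed
  qed
  \<comment> \<open>This is the image of \<open>e\<close>. The inequalities say that
    \<open>a\<close> could be the distances from one additional point (a Katetov function). The last
    condition picks \<open>q n\<close> with \<open>a n\<close> arbitrarily small; such a sequence is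
    Cauchy, and completeness supplies the point.\<close>
  define R where "R = {a :: nat \<Rightarrow> real. (\<forall>n m. a n \<le> a m + d (q n) (q m) \<and> d (q n) (q m) \<le> a n + a m) \<and>
      (\<forall>k. \<exists>n. a n < inverse (real (Suc k)))}"
  have R_sets: "R \<in> sets borel"
  proof -
    have "{a :: nat \<Rightarrow> real. a n \<le> a m + c} \<in> sets borel" "{a :: nat \<Rightarrow> real. c \<le> a n + a m} \<in> sets borel"
      "{a :: nat \<Rightarrow> real. a n < c} \<in> sets borel" for n m c
      using borel_measurable_le[OF measurable_product_coordinates[of n] borel_measurable_add[OF
           measurable_product_coordinates[of m] borel_measurable_const[of c]]]
        borel_measurable_le[OF borel_measurable_const[of c] borel_measurable_add[OF
           measurable_product_coordinates[of n] measurable_product_coordinates[of m]]]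
        borel_measurable_less[OF measurable_product_coordinates[of n] borel_measurable_const[of c]]
      by simp_all
    then have "(\<Inter>n m. {a. a n \<le> a m + d (q n) (q m)} \<inter> {a. d (q n) (q m) \<le> a n + a m}) \<inter>
        (\<Inter>k. \<Union>n. {a. a n < inverse (real (Suc k))}) \<in> sets borel"
      by (intro sets.Int sets.countable_INT'' sets.countable_UN'' countableI_type UNIV_I) auto
    also have "(\<Inter>n m. {a. a n \<le> a m + d (q n) (q m)} \<inter> {a. d (q n) (q m) \<le> a n + a m}) \<inter>
        (\<Inter>k. \<Union>n. {a. a n < inverse (real (Suc k))}) = R" by (auto simp: R_def)
    finally show ?thesis .
  qed
  have eR: "e x \<in> R" if "x \<in> S" for x
  proof -
    have "d x (q n) \<le> d x (q m) + d (q n) (q m)" "d (q n) (q m) \<le> d x (q n) + d x (q m)" for n m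
      using triangle[OF that qS[of m] qS[of n]] triangle[OF qS[of n] that qS[of m]] by (simp_all add: commute)
    moreover have "\<exists>n. d x (q n) < inverse (real (Suc k))" for k using dense'[OF that] by simp
    ultimately show ?thesis unfolding R_def e_def by simp
  qed
  have inj: "x = y" if "x \<in> S" "y \<in> S" "e x = e y" for x y
  proof (rule ccontr)
    assume "x \<noteq> y"
    then have "d x y > 0" using that by simp
    then obtain n where n: "d x (q n) < d x y / 2" using dense'[of x "d x y / 2"] \<open>x \<in> S\<close> by auto
    have "d y (q n) = d x (q n)" using that(3) by (metis e_def)
    then show False using triangle[OF that(1) qS[of n] that(2)] n by (simp add: commute)
  qed
  have surj: "\<exists>x\<in>S. e x = a" if "a \<in> R" for a
  proof -
    have "\<forall>k. \<exists>n. a n < inverse (real (Suc k))" using that by (simp add: R_def)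
    then obtain N where N: "\<And>k. a (N k) < inverse (real (Suc k))" by metis
    have a1: "a n \<le> a m + d (q n) (q m)" and a2: "d (q n) (q m) \<le> a n + a m" for n m
      using that by (auto simp: R_def)
    have Nlim: "(\<lambda>k. inverse (real (Suc k))) \<longlonglongrightarrow> 0" by (rule LIMSEQ_inverse_real_of_nat)
    have a0: "0 \<le> a n" for n using a2[of n n] qS by simp
    have "MCauchy (\<lambda>k. q (N k))"
      unfolding MCauchy_def
    proof (intro conjI allI impI)
      show "range (\<lambda>k. q (N k)) \<subseteq> S" using qS by auto
      fix \<epsilon> :: real assume "\<epsilon> > 0"
      then obtain K where K: "inverse (real (Suc K)) < \<epsilon> / 2"
        using reals_Archimedean[of "\<epsilon> / 2"] by auto
      show "\<exists>K. \<forall>n n'. K \<le> n \<longrightarrow> K \<le> n' \<longrightarrow> d (q (N n)) (q (N n')) < \<epsilon>"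
      proof (intro exI[of _ K] allI impI)
        fix n n' assume n: "K \<le> n" "K \<le> n'"
        have "inverse (real (Suc k)) \<le> inverse (real (Suc K))" if "K \<le> k" for k using that by simp
        then have "a (N n) < \<epsilon> / 2" "a (N n') < \<epsilon> / 2" using N K n by (meson le_less_trans less_le_trans less_trans)+
        with a2[of "N n" "N n'"] show "d (q (N n)) (q (N n')) < \<epsilon>" by simp
      qed
    qed
    then obtain x where x: "limitin mtopology (\<lambda>k. q (N k)) x sequentially"
      using Sd(2) unfolding mcomplete_def by blast
    have xS: "x \<in> S" using x by (rule limitin_mspace)
    have lim0: "(\<lambda>k. d (q (N k)) x) \<longlonglongrightarrow> 0"
      using x by (simp add: limitin_metric_dist_null)
    have aN: "(\<lambda>k. a (N k)) \<longlonglongrightarrow> 0"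
      by (rule tendsto_sandwich[OF _ _ tendsto_const Nlim]) (use a0 N less_imp_le in \<open>auto intro!: always_eventually\<close>)
    have "e x m = a m" for m
    proof -
      have "\<bar>e x m - a m\<bar> \<le> d (q (N k)) x + a (N k)" for k
      proof -
        have "\<bar>a m - d (q (N k)) (q m)\<bar> \<le> a (N k)"
          using a1[of m "N k"] a2[of "N k" m] by (simp add: commute abs_le_iff)
        moreover have "\<bar>d (q (N k)) (q m) - d x (q m)\<bar> \<le> d (q (N k)) x"
          using triangle[OF qS[of "N k"] xS qS[of m]] triangle[OF xS qS[of "N k"] qS[of m]]
          by (simp add: commute abs_le_iff)
        ultimately show ?thesis unfolding e_def by linarith
      qed
      moreover have "(\<lambda>k. d (q (N k)) x + a (N k)) \<longlonglongrightarrow> 0 + 0" by (intro tendsto_add lim0 aN)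
      ultimately have "\<bar>e x m - a m\<bar> \<le> 0 + 0"
        by (intro LIMSEQ_le_const) auto
      then show ?thesis by simp
    qed
    with xS show ?thesis by auto
  qed
  obtain x0 where x0: "x0 \<in> S" using ne S by auto
  define e' where "e' a = (if a \<in> R then THE x. x \<in> S \<and> e x = a else x0)" for a
  have e'e: "e' (e x) = x" if "x \<in> S" for x
    unfolding e'_def using that eR inj by (auto intro!: the_equality)
  have e'S: "e' a \<in> S" and ee': "a \<in> R \<Longrightarrow> e (e' a) = a" for a
    using surj e'e x0 by (auto simp: e'_def) (metis e'_def e'e)+
  show thesis
  proof
    show "e \<in> borel_measurable M" by fact
    show "e' (e x) = x" if "x \<in> space M" for x using e'e that S by simp
    show "e' \<in> measurable borel M"
    proof (rule measurableI)
      show "e' a \<in> space M" for a using e'S S by simp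
      fix A assume "A \<in> sets M"
      then have "A \<in> sigma_sets S {U. openin T U}" using sets T(3) S by simp
      then have "e' -` A \<in> sets borel"
      proof induction
        case (Basic U)
        then have U: "openin T U" by simp
        \<comment> \<open>\<open>U\<close> is the union of the balls of radius
          \<open>inverse (real (Suc k))\<close> about the \<open>q n\<close> that it contains, and
          for \<open>a\<close> in \<open>R\<close> membership of \<open>e' a\<close> in such a ball
          is a condition on the coordinate \<open>a n\<close> alone.\<close>
        define I where "I = {(n, k). mball (q n) (inverse (real (Suc k))) \<subseteq> U}"
        have "e' a \<in> U \<longleftrightarrow> (\<exists>(n, k)\<in>I. a n < inverse (real (Suc k)))" if a: "a \<in> R" for a
        proof
          assume "e' a \<in> U"
          then obtain r where r: "r > 0" "mball (e' a) r \<subseteq> U" using U Sd(3) by (auto simp: openin_mtopology)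
          then obtain k where k: "inverse (real (Suc k)) < r / 2" using reals_Archimedean[of "r / 2"] by auto
          obtain n where n: "d (e' a) (q n) < inverse (real (Suc k))" using dense'[OF e'S, of "inverse (real (Suc k))"] by auto
          have "mball (q n) (inverse (real (Suc k))) \<subseteq> mball (e' a) r"
          proof
            fix y assume y: "y \<in> mball (q n) (inverse (real (Suc k)))"
            then have "d (e' a) y \<le> d (e' a) (q n) + d (q n) y" using e'S qS by (auto intro: triangle)
            with y n k show "y \<in> mball (e' a) r" using e'S by auto
          qed
          with r have "(n, k) \<in> I" by (auto simp: I_def)
          moreover have "a n < inverse (real (Suc k))" using n ee'[OF a] by (metis e_def)
          ultimately show "\<exists>(n, k)\<in>I. a n < inverse (real (Suc k))" by blast
        next
          assume "\<exists>(n, k)\<in>I. a n < inverse (real (Suc k))"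
          then obtain n k where nk: "(n, k) \<in> I" "a n < inverse (real (Suc k))" by auto
          have "d (e' a) (q n) < inverse (real (Suc k))" using nk ee'[OF a] by (metis e_def)
          then have "e' a \<in> mball (q n) (inverse (real (Suc k)))" using e'S qS by (auto simp: commute)
          with nk show "e' a \<in> U" by (auto simp: I_def)
        qed
        moreover have "e' a \<in> U \<longleftrightarrow> x0 \<in> U" if "a \<notin> R" for a using that by (simp add: e'_def)
        ultimately have "e' -` U = {a. a \<in> R \<and> (\<exists>(n, k)\<in>I. a n < inverse (real (Suc k)))} \<union> {a. a \<notin> R \<and> x0 \<in> U}"
          by blast
        also have "{a. a \<in> R \<and> (\<exists>(n, k)\<in>I. a n < inverse (real (Suc k)))}
            = R \<inter> (\<Union>(n, k)\<in>I. {a. a n < inverse (real (Suc k))})" by auto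
        also have "\<dots> \<union> {a. a \<notin> R \<and> x0 \<in> U} \<in> sets borel"
        proof (intro sets.Un sets.Int R_sets sets.countable_UN'')
          show "{a. a \<notin> R \<and> x0 \<in> U} \<in> sets borel"
            using R_sets by (cases "x0 \<in> U") (auto simp: Collect_neg_eq)
        qed (auto simp: split_beta)
        finally show ?case .
      next
        case (Compl A)
        have "e' -` (S - A) = UNIV - e' -` A" using e'S by auto
        then show ?case using Compl by auto
      next
        case (Union A)
        then show ?case by (auto simp: vimage_UN)
      qed auto
      then show "e' -` A \<inter> space borel \<in> sets borel" by simp
    qed
  qed
qed

text \<open>A compact subset of the graph of \<open>h\<close> projects homeomorphically, so its inverse is Borel on
  a compact set; by inner regularity countably many compact sets exhaust the graph up to a null set.\<close>

lemma borel_left_inverse_AE: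
  fixes N :: "'a::polish_space measure" and h :: "'a \<Rightarrow> 'b::polish_space"
  assumes N: "prob_space N" "sets N = sets borel"
    and S: "S \<in> sets borel" "AE x in N. x \<in> S"
    and h: "h \<in> borel_measurable borel" "inj_on h S"
  obtains r where "r \<in> borel_measurable borel" "AE x in N. r (h x) = x"
proof -
  interpret N: prob_space N by fact
  have [measurable_cong]: "sets N = sets borel" by fact
  have [simp]: "space N = UNIV" using sets_eq_imp_space_eq[OF N(2)] by simp
  note [measurable] = h(1) S(1)
  define P where "P = distr N borel (\<lambda>a. (a, h a))"
  have pm: "(\<lambda>a. (a, h a)) \<in> borel_measurable N"
    by (rule borel_measurable_Pair) measurable
  interpret P: prob_space P unfolding P_def by (rule N.prob_space_distr[OF pm])
  have [simp]: "sets P = sets borel" by (simp add: P_def)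
  define \<Gamma> where "\<Gamma> = {p. fst p \<in> S \<and> snd p = h (fst p)}"
  have \<Gamma>: "\<Gamma> \<in> sets borel"
  proof -
    have "{p \<in> space (borel \<Otimes>\<^sub>M borel). snd p = h (fst p)} \<in> sets (borel \<Otimes>\<^sub>M borel)"
      by (rule measurable_equality_set) measurable
    moreover have "S \<times> (UNIV :: 'b set) \<in> sets (borel \<Otimes>\<^sub>M borel)" by measurable
    moreover have "\<Gamma> = {p \<in> space (borel \<Otimes>\<^sub>M borel). snd p = h (fst p)} \<inter> (S \<times> UNIV)"
      by (auto simp: \<Gamma>_def space_pair_measure)
    ultimately have "\<Gamma> \<in> sets (borel \<Otimes>\<^sub>M borel)" by (simp only: sets.Int)
    then show ?thesis by (simp only: borel_prod)
  qed
  have "emeasure P \<Gamma> = 1"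
  proof -
    have "emeasure P \<Gamma> = emeasure N {a \<in> space N. a \<in> S}"
      unfolding P_def by (subst emeasure_distr[OF pm \<Gamma>]) (auto simp: \<Gamma>_def intro!: arg_cong[where f="emeasure N"])
    also have "\<dots> = 1" using S by (intro N.emeasure_eq_1_AE) auto
    finally show ?thesis .
  qed
  then have sup: "(SUP K \<in> {K. K \<subseteq> \<Gamma> \<and> compact K}. emeasure P K) = 1"
    using inner_regular[of P \<Gamma>] \<Gamma> P.emeasure_finite by simp
  have "\<exists>K. K \<subseteq> \<Gamma> \<and> compact K \<and> emeasure P K > ennreal (1 - inverse (real (Suc n)))" for n
  proof -
    have "ennreal (1 - inverse (real (Suc n))) < (SUP K \<in> {K. K \<subseteq> \<Gamma> \<and> compact K}. emeasure P K)"
      unfolding sup by (simp add: ennreal_less_one_iff)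
    then show ?thesis unfolding less_SUP_iff by auto
  qed
  then obtain K where K: "\<And>n. K n \<subseteq> \<Gamma>" "\<And>n. compact (K n)"
    "\<And>n::nat. emeasure P (K n) > ennreal (1 - inverse (real (Suc n)))" by metis
  have Kb [measurable]: "K n \<in> sets borel" for n using K(2) by (simp add: borel_compact)
  define L where "L = (\<Union>n. K n)"
  have Lb [measurable]: "L \<in> sets borel" unfolding L_def by auto
  have "P.prob L \<ge> 1 - inverse (real (Suc n))" for n
  proof -
    have "P.prob (K n) > 1 - inverse (real (Suc n))"
      using K(3)[of n] by (simp only: P.emeasure_eq_measure, subst (asm) ennreal_less_iff) (auto simp: field_simps)
    moreover have "P.prob (K n) \<le> P.prob L"
    proof (rule P.finite_measure_mono)
      show "K n \<subseteq> L" unfolding L_def by blast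
      show "L \<in> P.events" using Lb by simp
    qed
    ultimately show ?thesis by simp
  qed
  moreover have "(\<lambda>n. 1 - inverse (real (Suc n))) \<longlonglongrightarrow> 1 - 0"
    by (intro tendsto_intros LIMSEQ_inverse_real_of_nat)
  ultimately have "P.prob L \<ge> 1" by (intro LIMSEQ_le_const2) auto
  then have "P.prob L = 1" using P.prob_le_1 by (metis antisym)
  then have "AE p in P. p \<in> L" by (subst (asm) P.prob_eq_1) auto
  then have AE: "AE a in N. (a, h a) \<in> L"
    unfolding P_def by (subst (asm) AE_distr_iff[OF pm]) auto
  define r where "r b = (if b \<in> snd ` L then THE a. (a, b) \<in> L else undefined)" for b
  have r: "r b = a" if "(a, b) \<in> L" for a b
  proof -
    have "L \<subseteq> \<Gamma>" using K(1) unfolding L_def by blast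
    then have "a \<in> S" "b = h a" and "(a', b) \<in> L \<Longrightarrow> a' \<in> S \<and> b = h a'" for a'
      using that by (auto simp: \<Gamma>_def)
    then have "(a', b) \<in> L \<Longrightarrow> a' = a" for a' using inj_onD[OF h(2)] by metis
    moreover have "b \<in> snd ` L" using imageI[OF that, of snd] by simp
    moreover have "(THE a. (a, b) \<in> L) = a"
      using that \<open>\<And>a'. (a', b) \<in> L \<Longrightarrow> a' = a\<close> by (rule the_equality)
    ultimately show ?thesis by (simp add: r_def)
  qed
  have img: "snd ` (K n \<inter> (A \<times> UNIV)) \<in> sets borel" if "closed A" for n and A :: "'a set"
  proof -
    have "compact (K n \<inter> (A \<times> UNIV))" using K(2) that by (intro compact_Int_closed closed_Times) auto
    then have "compact (snd ` (K n \<inter> (A \<times> UNIV)))" by (intro compact_continuous_image continuous_intros)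
    then show ?thesis by (rule borel_compact)
  qed
  \<comment> \<open>Over the projection of \<open>L\<close> the preimage is a countable union of
    projections of compact sets. Off that projection \<open>r\<close> takes the constant value
    \<open>undefined\<close>, so a closed set containing this value picks up the complement of the
    projection as well.\<close>
  have closed: "r -` A \<in> sets borel" if A: "closed A" for A
  proof -
      have UN: "(\<Union>n. snd ` (K n \<inter> (A' \<times> UNIV))) = {b. \<exists>a\<in>A'. (a, b) \<in> L}" for A' :: "'a set"
        unfolding L_def by force
      have "b \<in> r -` A \<longleftrightarrow> (\<exists>a\<in>A. (a, b) \<in> L) \<or> (undefined \<in> A \<and> b \<notin> {b. \<exists>a\<in>UNIV. (a, b) \<in> L})" for b
      proof (cases "\<exists>a. (a, b) \<in> L")
        case True
        then obtain a where a: "(a, b) \<in> L" by blast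
        have "(a', b) \<in> L \<longleftrightarrow> a' = a" for a' using r[OF a] r[of a' b] a by blast
        then show ?thesis using r[OF a] by simp
      next
        case False
        then have "b \<notin> snd ` L" by force
        then have "r b = undefined" by (simp add: r_def)
        with False show ?thesis by simp
      qed
      then have "r -` A = {b. \<exists>a\<in>A. (a, b) \<in> L} \<union> (if undefined \<in> A then UNIV - {b. \<exists>a\<in>UNIV. (a, b) \<in> L} else {})"
        by auto
      also have "\<dots> \<in> sets borel"
      proof -
        have "{b. \<exists>a\<in>A'. (a, b) \<in> L} \<in> sets borel" if "closed A'" for A' :: "'a set"
          unfolding UN[symmetric] by (intro sets.countable_UN'' countableI_type img that)
        from this[OF A] this[OF closed_UNIV] show ?thesis by auto
      qed
      finally show ?thesis .
  qed
  show thesis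
  proof
    show "AE x in N. r (h x) = x" using AE by eventually_elim (rule r)
    show "r \<in> borel_measurable borel"
    proof (rule borel_measurableI)
      fix U :: "'a set" assume "open U"
      then have "r -` (- U) \<in> sets borel" by (intro closed) (simp add: closed_def)
      then have "space borel - r -` (- U) \<in> sets borel" by (rule sets.compl_sets)
      moreover have "r -` U = space borel - r -` (- U)" by auto
      ultimately show "r -` U \<inter> space borel \<in> sets borel" by simp
    qed
  qed
qed

text \<open>An almost-everywhere form of the Lusin-Souslin theorem. The law of \<open>e\<close>
  lives on the fixed points of \<open>e \<circ> e'\<close>, and there \<open>h \<circ> e'\<close>
  inherits injectivity from \<open>h\<close>, so the Polish case applies.\<close>

lemma left_inverse_AE:
  fixes M :: "'x measure" and h :: "'x \<Rightarrow> 'b::polish_space"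
  assumes M: "standard_borel M" "prob_space M"
    and h: "h \<in> borel_measurable M" "inj_on h (space M)"
  obtains r where "r \<in> measurable borel M" "AE x in M. r (h x) = x"
proof -
  interpret prob_space M by fact
  obtain e :: "'x \<Rightarrow> nat \<Rightarrow> real" and e' where e [measurable]: "e \<in> borel_measurable M" "e' \<in> measurable borel M"
    and e'e: "\<And>x. x \<in> space M \<Longrightarrow> e' (e x) = x"
    using standard_borel_embedding[OF M(1) not_empty] by blast
  note [measurable] = h(1)
  define R where "R = {a. e (e' a) = a}"
  have R: "R \<in> sets borel"
    using measurable_equality_set[OF measurable_compose[OF e(2) e(1)] measurable_ident] by (simp add: R_def)
  have AE_R: "AE a in distr M borel e. a \<in> R"
    using R by (subst AE_distr_iff[OF e(1)]) (simp_all add: e'e R_def)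
  have inj: "inj_on (\<lambda>a. h (e' a)) R"
  proof (rule inj_onI)
    fix a b assume ab: "a \<in> R" "b \<in> R" "h (e' a) = h (e' b)"
    have "e' a \<in> space M" "e' b \<in> space M" using measurable_space[OF e(2)] by simp_all
    with ab(3) have "e' a = e' b" using inj_onD[OF h(2)] by blast
    then have "e (e' a) = e (e' b)" by (rule arg_cong)
    with ab(1,2) show "a = b" by (simp only: R_def mem_Collect_eq)
  qed
  have he: "(\<lambda>a. h (e' a)) \<in> borel_measurable borel" by (rule measurable_compose[OF e(2) h(1)])
  obtain r where r: "r \<in> borel_measurable borel" and re: "AE a in distr M borel e. r (h (e' a)) = a"
    using borel_left_inverse_AE[OF prob_space_distr[OF e(1)] _ R AE_R he inj] by auto
  note [measurable] = r
  show thesis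
  proof
    show "(\<lambda>b. e' (r b)) \<in> measurable borel M" by measurable
    have "{a. r (h (e' a)) = a} \<in> sets borel"
      using measurable_equality_set[OF measurable_compose[OF he r] measurable_ident] by simp
    with re have "AE x in M. r (h (e' (e x))) = e x"
      using AE_distr_iff[OF e(1)] by simp
    then show "AE x in M. e' (r (h x)) = x"
      by (rule AE_mp) (auto simp: e'e intro!: AE_I2)
  qed
qed

lemma separating_sets:
  fixes M :: "'x measure"
  assumes M: "standard_borel M" and ne: "space M \<noteq> {}"
  obtains B :: "nat \<Rightarrow> 'x set" where "\<And>n. B n \<in> sets M"
    "\<And>x y. x \<in> space M \<Longrightarrow> y \<in> space M \<Longrightarrow> x \<noteq> y \<Longrightarrow> \<exists>n. x \<in> B n \<and> y \<notin> B n"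
proof -
  obtain e :: "'x \<Rightarrow> nat \<Rightarrow> real" and e' where e [measurable]: "e \<in> borel_measurable M" "e' \<in> measurable borel M"
    and e'e: "\<And>x. x \<in> space M \<Longrightarrow> e' (e x) = x"
    using standard_borel_embedding[OF M ne] by blast
  \<comment> \<open>Both half lines occur because the set has to contain \<open>x\<close> and miss
    \<open>y\<close>, in this order, whichever of the two coordinates is larger.\<close>
  define D where "D = (\<lambda>(i, q :: rat, b). if b then {x \<in> space M. e x i < of_rat q} else {x \<in> space M. e x i > of_rat q})"
  have [measurable]: "(\<lambda>x. e x i) \<in> borel_measurable M" for i
    by (rule measurable_product_then_coordinatewise) fact
  have D: "D p \<in> sets M" for p by (auto simp: D_def split: prod.splits)
  show thesis
  proof
    show "D (from_nat n) \<in> sets M" for n by (rule D)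
    fix x y assume xy: "x \<in> space M" "y \<in> space M" "x \<noteq> y"
    then have "e x \<noteq> e y" using e'e by metis
    then obtain i where "e x i \<noteq> e y i" by auto
    then consider "e x i < e y i" | "e y i < e x i" by linarith
    then have "\<exists>p. x \<in> D p \<and> y \<notin> D p"
    proof cases
      case 1
      then obtain q where "e x i < of_rat q" "of_rat q < e y i" using of_rat_dense by blast
      with xy show ?thesis by (intro exI[of _ "(i, q, True)"]) (auto simp: D_def)
    next
      case 2
      then obtain q where "e y i < of_rat q" "of_rat q < e x i" using of_rat_dense by blast
      with xy show ?thesis by (intro exI[of _ "(i, q, False)"]) (auto simp: D_def)
    qed
    then show "\<exists>n. x \<in> D (from_nat n) \<and> y \<notin> D (from_nat n)" by (metis from_nat_to_nat)
  qed
qed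

section \<open>Measurable selection\<close>

text \<open>The parameter space \<open>nat \<Rightarrow> real\<close> replaces Baire space, since it is an instance of \<open>polish_space\<close>.\<close>

definition analytic :: "'a::topological_space set \<Rightarrow> bool" where
  "analytic A \<longleftrightarrow> (\<exists>F :: ('a \<times> (nat \<Rightarrow> real)) set. closed F \<and> A = fst ` F)"

lemma analytic_closed:
  assumes "closed A"
  shows "analytic A"
  unfolding analytic_def
proof (intro exI conjI)
  show "closed (A \<times> (UNIV :: (nat \<Rightarrow> real) set))" using assms by (intro closed_Times) auto
  show "A = fst ` (A \<times> (UNIV :: (nat \<Rightarrow> real) set))" by force
qed

lemma analytic_UN:
  fixes A :: "nat \<Rightarrow> 'a::topological_space set"
  assumes "\<And>n. analytic (A n)"
  shows "analytic (\<Union>n. A n)"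
proof -
  obtain F :: "nat \<Rightarrow> ('a \<times> (nat \<Rightarrow> real)) set" where F: "\<And>n. closed (F n)" "\<And>n. A n = fst ` F n"
    using assms unfolding analytic_def by metis
  \<comment> \<open>Coordinate 0 stores the index \<open>n\<close> and the shifted sequence stores
    the witness. Since distinct naturals lie at distance at least 1, the sets \<open>G n\<close>
    form a locally finite family, so their union is closed.\<close>
  define G where "G n = {p. snd p 0 = real n \<and> (fst p, \<lambda>m. snd p (Suc m)) \<in> F n}" for n
  have cont: "continuous_on UNIV (\<lambda>p :: 'a \<times> (nat \<Rightarrow> real). (fst p, \<lambda>m. snd p (Suc m)))"
    by (intro continuous_intros continuous_on_coordinatewise_then_product
          continuous_on_product_then_coordinatewise)
  have cont0: "continuous_on UNIV (\<lambda>p :: 'a \<times> (nat \<Rightarrow> real). snd p 0)"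
    by (intro continuous_intros continuous_on_product_then_coordinatewise)
  have G: "closed (G n)" for n
  proof -
    have "closed {p :: 'a \<times> (nat \<Rightarrow> real). snd p 0 = real n}"
      by (intro closed_Collect_eq cont0 continuous_on_const)
    moreover have "closed ((\<lambda>p :: 'a \<times> (nat \<Rightarrow> real). (fst p, \<lambda>m. snd p (Suc m))) -` F n)"
      by (rule closed_vimage[OF F(1) cont])
    moreover have "G n = {p. snd p 0 = real n} \<inter> (\<lambda>p. (fst p, \<lambda>m. snd p (Suc m))) -` F n"
      by (auto simp: G_def)
    ultimately show ?thesis by auto
  qed
  have "open (- (\<Union>n. G n))"
    unfolding open_subopen[of "- (\<Union>n. G n)"]
  proof (intro ballI)
    fix p assume p: "p \<in> - (\<Union>n. G n)"
    define k where "k = nat (round (snd p 0))"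
    define U where "U = {p' :: 'a \<times> (nat \<Rightarrow> real). \<bar>snd p' 0 - snd p 0\<bar> < 1 / 4}"
    have "open U" unfolding U_def by (intro open_Collect_less continuous_intros cont0)
    then have "open (U - G k)" using G by auto
    moreover have "p \<in> U - G k" using p by (auto simp: U_def)
    moreover have "U - G k \<subseteq> - (\<Union>n. G n)"
    proof -
      have "n = k" if "p' \<in> U" "p' \<in> G n" for n p'
      proof -
        have "\<bar>real n - snd p 0\<bar> < 1 / 4" using that by (auto simp: U_def G_def)
        then have "round (snd p 0) = int n" by (intro round_unique') (auto simp: abs_minus_commute)
        then show ?thesis by (simp add: k_def)
      qed
      then show ?thesis by blast
    qed
    ultimately show "\<exists>T. open T \<and> p \<in> T \<and> T \<subseteq> - (\<Union>n. G n)" by blast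
  qed
  then have "closed (\<Union>n. G n)" by (simp add: closed_def)
  moreover have "(\<Union>n. A n) = fst ` (\<Union>n. G n)"
  proof (intro set_eqI iffI)
    fix x assume "x \<in> (\<Union>n. A n)"
    then obtain n s where s: "(x, s) \<in> F n" using F(2) by auto
    have "(x, case_nat (real n) s) \<in> G n" using s by (simp add: G_def)
    then show "x \<in> fst ` (\<Union>n. G n)" by force
  next
    fix x assume "x \<in> fst ` (\<Union>n. G n)"
    then obtain n p where "p \<in> G n" "x = fst p" by auto
    then have "(x, \<lambda>m. snd p (Suc m)) \<in> F n" by (simp add: G_def)
    then have "x \<in> A n" unfolding F(2) by force
    then show "x \<in> (\<Union>n. A n)" by blast
  qed
  ultimately show ?thesis unfolding analytic_def by blast
qed

lemma analytic_INT:
  fixes A :: "nat \<Rightarrow> 'a::topological_space set"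
  assumes "\<And>n. analytic (A n)"
  shows "analytic (\<Inter>n. A n)"
proof -
  obtain F :: "nat \<Rightarrow> ('a \<times> (nat \<Rightarrow> real)) set" where F: "\<And>n. closed (F n)" "\<And>n. A n = fst ` F n"
    using assms unfolding analytic_def by metis
  \<comment> \<open>A single parameter sequence carries a witness for every \<open>A n\<close>, the
    \<open>n\<close>-th one in row \<open>n\<close> of the pairing
    \<open>prod_encode\<close>.\<close>
  define G where "G n = (\<lambda>p. (fst p, \<lambda>m. snd p (prod_encode (n, m)))) -` F n" for n
  have "closed (G n)" for n
    unfolding G_def
    by (intro closed_vimage F continuous_intros continuous_on_coordinatewise_then_product
          continuous_on_product_then_coordinatewise)
  then have "closed (\<Inter>n. G n)" by auto
  moreover have "(\<Inter>n. A n) = fst ` (\<Inter>n. G n)"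
  proof (intro set_eqI iffI)
    fix x assume "x \<in> (\<Inter>n. A n)"
    then have "x \<in> fst ` F n" for n using F(2) by blast
    then have "\<forall>n. \<exists>s. (x, s) \<in> F n" by force
    then obtain s where s: "\<And>n. (x, s n) \<in> F n" by metis
    define t where "t k = (case prod_decode k of (n, m) \<Rightarrow> s n m)" for k
    have "(x, t) \<in> G n" for n using s[of n] by (simp add: G_def t_def)
    then have "(x, t) \<in> (\<Inter>n. G n)" by blast
    then show "x \<in> fst ` (\<Inter>n. G n)" by (metis fst_conv imageI)
  next
    fix x assume "x \<in> fst ` (\<Inter>n. G n)"
    then obtain p where p: "x = fst p" "\<And>n. p \<in> G n" by auto
    then have "(x, \<lambda>m. snd p (prod_encode (n, m))) \<in> F n" for n by (simp add: G_def)
    then have "x \<in> fst ` F n" for n by force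
    then show "x \<in> (\<Inter>n. A n)" using F(2) by auto
  qed
  ultimately show ?thesis unfolding analytic_def by blast
qed

lemma analytic_open:
  fixes U :: "'a::metric_space set"
  assumes U: "open U"
  shows "analytic U"
proof -
  define C where "C n = {x. \<forall>y. y \<notin> U \<longrightarrow> inverse (real (Suc n)) \<le> dist x y}" for n
  have "closed (C n)" for n
  proof -
    have "C n = (\<Inter>y\<in>- U. {x. inverse (real (Suc n)) \<le> dist x y})" by (auto simp: C_def)
    moreover have "closed {x. inverse (real (Suc n)) \<le> dist x y}" for y
      by (intro closed_Collect_le continuous_intros)
    ultimately show ?thesis by auto
  qed
  then have "analytic (\<Union>n. C n)" by (intro analytic_UN analytic_closed)
  moreover have "(\<Union>n. C n) = U"
  proof (intro set_eqI iffI)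
    fix x assume "x \<in> (\<Union>n. C n)"
    then obtain n where n: "x \<in> C n" by auto
    show "x \<in> U"
    proof (rule ccontr)
      assume "x \<notin> U"
      with n have "inverse (real (Suc n)) \<le> dist x x" unfolding C_def by blast
      then show False by simp
    qed
  next
    fix x assume "x \<in> U"
    then obtain d where d: "d > 0" "\<And>y. dist y x < d \<Longrightarrow> y \<in> U" using U unfolding open_dist by blast
    obtain n where n: "inverse (real (Suc n)) < d" using reals_Archimedean[OF d(1)] by blast
    have "x \<in> C n" unfolding C_def
    proof (intro CollectI allI impI)
      fix y assume "y \<notin> U"
      then have "\<not> dist y x < d" using d(2) by blast
      then show "inverse (real (Suc n)) \<le> dist x y" using n by (simp add: dist_commute)
    qed
    then show "x \<in> (\<Union>n. C n)" by blast
  qed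
  ultimately show ?thesis by simp
qed

text \<open>Analytic sets are not closed under complements in general, so the induction carries
  \<open>A\<close> and \<open>- A\<close> together and the complement case only swaps them.\<close>

lemma analytic_Borel:
  fixes A :: "'a::metric_space set"
  assumes "A \<in> sets borel"
  shows "analytic A"
proof -
  have "A \<in> sigma_sets UNIV {S. open S}" using assms by (simp add: borel_def)
  then have "analytic A \<and> analytic (- A)"
  proof induction
    case (Basic a)
    then show ?case by (auto intro: analytic_open analytic_closed)
  next
    case Empty
    show ?case by (auto intro: analytic_closed)
  next
    case (Compl a)
    then show ?case by (simp add: Compl_eq_Diff_UNIV[symmetric])
  next
    case (Union a)
    then show ?case by (auto intro: analytic_UN analytic_INT)
  qed
  then show ?thesis ..
qed

section \<open>Uniformization almost everywhere\<close>

lemma dense_sequence: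
  obtains q :: "nat \<Rightarrow> 'a::{metric_space,second_countable_topology}"
  where "\<And>x e. e > 0 \<Longrightarrow> \<exists>n. dist x (q n) < e"
proof -
  obtain D :: "'a set" where D: "countable D" "\<And>X. open X \<Longrightarrow> X \<noteq> {} \<Longrightarrow> \<exists>d\<in>D. d \<in> X"
    using countable_dense_setE by blast
  have "D \<noteq> {}" using D(2)[of UNIV] by auto
  show thesis
  proof
    fix x :: 'a and e :: real assume "e > 0"
    then have "open (ball x e)" "ball x e \<noteq> {}" by auto
    from D(2)[OF this] obtain d where d: "d \<in> D" "d \<in> ball x e" by auto
    from from_nat_into_surj[OF D(1) d(1)] obtain n where "from_nat_into D n = d" by auto
    with d(2) show "\<exists>n. dist x (from_nat_into D n) < e" by auto
  qed
qed

text \<open>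
  Choquet's capacity argument: intersecting with finitely many balls of radius \<open>1 / (n + 1)\<close> in step \<open>n\<close>
  keeps the outer measure above \<open>c\<close>, and the intersection of all steps is totally bounded.
\<close>

lemma compact_inner_projection:
  fixes N :: "'a::polish_space measure" and F :: "('a \<times> 'w::{complete_space,second_countable_topology}) set"
  assumes N: "sets N = sets borel" "finite_measure N"
    and F: "closed F" and c: "c < outer_measure_of N (fst ` F)"
  obtains K where "compact K" "K \<subseteq> F" "c \<le> emeasure N (fst ` K)"
proof -
  interpret N: finite_measure N by fact
  have sp: "space N = UNIV" using sets_eq_imp_space_eq[OF N(1)] by simp
  obtain q :: "nat \<Rightarrow> 'a \<times> 'w" where q: "\<And>x e. e > 0 \<Longrightarrow> \<exists>n. dist x (q n) < e"
    using dense_sequence by blast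
  define V where "V n m = (\<Union>j\<le>m. cball (q j) (inverse (real (Suc n))))" for n m
  have Vcl: "closed (V n m)" for n m unfolding V_def by auto
  have VU: "(\<Union>m. V n m) = UNIV" for n
  proof -
    have "\<exists>m. x \<in> V n m" for x
    proof -
      obtain j where "dist x (q j) < inverse (real (Suc n))" using q[of "inverse (real (Suc n))" x] by auto
      then have "x \<in> cball (q j) (inverse (real (Suc n)))" by (simp add: dist_commute)
      then show ?thesis unfolding V_def by blast
    qed
    then show ?thesis by blast
  qed
  have "\<exists>S. \<forall>n. (closed (S n) \<and> S n \<subseteq> F \<and> c < outer_measure_of N (fst ` S n)) \<and> (\<exists>m. S (Suc n) = S n \<inter> V n m)"
  proof (rule dependent_nat_choice)
    show "\<exists>S. closed S \<and> S \<subseteq> F \<and> c < outer_measure_of N (fst ` S)" using F c by blast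
  next
    fix S n assume S: "closed S \<and> S \<subseteq> F \<and> c < outer_measure_of N (fst ` S)"
    \<comment> \<open>The projections need not be Borel; outer measure is nevertheless continuous
      along increasing sequences of arbitrary sets.\<close>
    have "(SUP m. outer_measure_of N (fst ` (S \<inter> V n m))) = outer_measure_of N (\<Union>m. fst ` (S \<inter> V n m))"
    proof (rule SUP_outer_measure_of_incseq)
      show "incseq (\<lambda>m. fst ` (S \<inter> V n m))"
        unfolding V_def by (intro incseq_SucI image_mono Int_mono order_refl UN_mono) auto
    qed (simp add: sp)
    also have "(\<Union>m. fst ` (S \<inter> V n m)) = fst ` S"
    proof -
      have "(\<Union>m. fst ` (S \<inter> V n m)) = fst ` (S \<inter> (\<Union>m. V n m))" by blast
      then show ?thesis by (simp add: VU)
    qed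
    finally have "c < (SUP m. outer_measure_of N (fst ` (S \<inter> V n m)))" using S by simp
    then obtain m where "c < outer_measure_of N (fst ` (S \<inter> V n m))" unfolding less_SUP_iff by auto
    with S Vcl show "\<exists>S'. (closed S' \<and> S' \<subseteq> F \<and> c < outer_measure_of N (fst ` S')) \<and> (\<exists>m. S' = S \<inter> V n m)"
      by (intro exI[of _ "S \<inter> V n m"]) (auto simp: closed_Int)
  qed
  then obtain S where S: "\<And>n. closed (S n)" "\<And>n. S n \<subseteq> F" "\<And>n. c < outer_measure_of N (fst ` S n)"
    "\<And>n. \<exists>m. S (Suc n) = S n \<inter> V n m" by blast
  obtain m where m: "\<And>n. S (Suc n) = S n \<inter> V n (m n)" using S(4) by metis
  have dec: "S k \<subseteq> S n" if "n \<le> k" for n k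
    using that by (rule lift_Suc_antimono_le[rotated]) (simp add: m)
  \<comment> \<open>Total boundedness is needed for sequences running through the sets
    \<open>S n\<close>, not only for \<open>K\<close>. If no projection of an \<open>S n\<close>
    fitted into an open \<open>U\<close> around the projection of \<open>K\<close>, the points
    witnessing this would accumulate at a point of \<open>K\<close>.\<close>
  have tb: "\<exists>k. finite k \<and> closure (range z) \<subseteq> (\<Union>x\<in>k. ball x e)"
    if z: "\<And>n. z n \<in> S n" and e: "e > 0" for z and e :: real
  proof -
    obtain n where n: "inverse (real (Suc n)) < e" using reals_Archimedean[OF e] by blast
    let ?C = "z ` {..n} \<union> V n (m n)"
    have "z i \<in> ?C" for i
    proof (cases "i \<le> n")
      case False
      then have "z i \<in> S (Suc n)" using z[of i] dec[of "Suc n" i] by auto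
      then show ?thesis using m by auto
    qed auto
    moreover have "closed ?C" by (intro closed_Un Vcl finite_imp_closed) auto
    ultimately have "closure (range z) \<subseteq> ?C" by (intro closure_minimal) blast
    also have "?C \<subseteq> (\<Union>x\<in>z ` {..n} \<union> q ` {..m n}. ball x e)"
    proof
      fix p assume "p \<in> ?C"
      then consider i where "i \<le> n" "p = z i" | j where "j \<le> m n" "p \<in> cball (q j) (inverse (real (Suc n)))"
        unfolding V_def by blast
      then show "p \<in> (\<Union>x\<in>z ` {..n} \<union> q ` {..m n}. ball x e)"
      proof cases
        case 1
        then have "p \<in> ball (z i) e" using e by simp
        then show ?thesis using 1 by blast
      next
        case 2
        then have "p \<in> ball (q j) e" using n by simp
        then show ?thesis using 2 by blast
      qed
    qed
    finally show ?thesis by (intro exI[of _ "z ` {..n} \<union> q ` {..m n}"]) auto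
  qed
  define K where "K = (\<Inter>n. S n)"
  have Kcl: "closed K" unfolding K_def using S(1) by auto
  have tbK: "\<exists>k. finite k \<and> K \<subseteq> (\<Union>x\<in>k. ball x e)" if "e > 0" for e :: real
  proof -
    from reals_Archimedean[OF that] obtain n where n: "inverse (real (Suc n)) < e" by blast
    have "K \<subseteq> S (Suc n)" by (auto simp: K_def)
    also have "\<dots> \<subseteq> V n (m n)" by (simp add: m)
    also have "\<dots> \<subseteq> (\<Union>x\<in>q ` {..m n}. ball x e)"
    proof
      fix p assume "p \<in> V n (m n)"
      then obtain j where j: "j \<le> m n" "p \<in> cball (q j) (inverse (real (Suc n)))" unfolding V_def by blast
      then have "p \<in> ball (q j) e" using n by simp
      then show "p \<in> (\<Union>x\<in>q ` {..m n}. ball x e)" using j by blast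
    qed
    finally show ?thesis by (intro exI[of _ "q ` {..m n}"]) auto
  qed
  have "compact K"
    unfolding compact_eq_totally_bounded using Kcl tbK by (simp add: complete_eq_closed)
  moreover have "K \<subseteq> F" using S(2) by (auto simp: K_def)
  moreover have "c \<le> emeasure N (fst ` K)"
  proof -
    have cK: "compact (fst ` K)" using \<open>compact K\<close> by (intro compact_continuous_image continuous_intros)
    have "c \<le> emeasure N U" if U: "fst ` K \<subseteq> U" "open U" for U
    proof -
      have "\<exists>n. fst ` S n \<subseteq> U"
      proof (rule ccontr)
        assume "\<nexists>n. fst ` S n \<subseteq> U"
        then have "\<forall>n. \<exists>z. z \<in> S n \<and> fst z \<notin> U" by blast
        then obtain z where z: "\<And>n. z n \<in> S n" "\<And>n. fst (z n) \<notin> U" by metis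
        have "compact (closure (range z))"
          unfolding compact_eq_totally_bounded using tb[of z] z(1) by (simp add: complete_eq_closed)
        then have "seq_compact (closure (range z))" by (simp add: compact_eq_seq_compact_metric)
        moreover have "\<forall>n. z n \<in> closure (range z)" by (auto intro: subsetD[OF closure_subset])
        ultimately obtain l r where l: "strict_mono (r :: nat \<Rightarrow> nat)" "(z \<circ> r) \<longlonglongrightarrow> l"
          unfolding seq_compact_def by blast
        have "l \<in> S n" for n
        proof -
          have "eventually (\<lambda>i. (z \<circ> r) i \<in> S n) sequentially"
            unfolding eventually_sequentially
          proof (intro exI[of _ n] allI impI)
            fix i assume "n \<le> i"
            then have "n \<le> r i" using seq_suble[OF l(1), of i] by linarith
            then show "(z \<circ> r) i \<in> S n" using z(1)[of "r i"] dec by auto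
          qed
          then show ?thesis by (rule Lim_in_closed_set[OF S(1) _ _ l(2)]) simp
        qed
        then have "fst l \<in> U" using U(1) by (auto simp: K_def)
        moreover have "(\<lambda>i. fst ((z \<circ> r) i)) \<longlonglongrightarrow> fst l" by (rule tendsto_fst[OF l(2)])
        ultimately have "eventually (\<lambda>i. fst ((z \<circ> r) i) \<in> U) sequentially"
          using U(2) topological_tendstoD by blast
        then show False using z(2) by simp
      qed
      then obtain n where n: "fst ` S n \<subseteq> U" by blast
      have "c < outer_measure_of N (fst ` S n)" by (rule S(3))
      also have "\<dots> \<le> outer_measure_of N U" by (rule outer_measure_of_mono[OF n])
      also have "\<dots> = emeasure N U" using U(2) N(1) by (intro outer_measure_of_eq) simp
      finally show ?thesis by simp
    qed
    then have "c \<le> (INF U \<in> {U. fst ` K \<subseteq> U \<and> open U}. emeasure N U)"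
      by (intro INF_greatest) auto
    also have "\<dots> = emeasure N (fst ` K)"
      by (rule outer_regular[symmetric, OF N(1)]) (use cK borel_compact in auto)
    finally show ?thesis .
  qed
  ultimately show thesis by (rule that)
qed

text \<open>The selection follows the leftmost branch of a tree: a finite index sequence
  \<open>js\<close> survives at \<open>x\<close> if \<open>K\<close> has a point over
  \<open>x\<close> inside all the balls coded by \<open>js\<close>, and each step appends the least
  index that survives. Each \<open>S js\<close> is the projection of a compact set, hence Borel, so
  the branch depends measurably on \<open>x\<close>. The radii halve, so the centres converge, and
  \<open>K\<close> is closed.\<close>

lemma compact_selection:
  fixes K :: "('a::polish_space \<times> 'w::{complete_space,second_countable_topology}) set"
  assumes K: "compact K"
  obtains r where "r \<in> borel_measurable borel" "\<And>x. x \<in> fst ` K \<Longrightarrow> (x, r x) \<in> K"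
proof -
  obtain q :: "nat \<Rightarrow> 'w" where q: "\<And>x e. e > 0 \<Longrightarrow> \<exists>n. dist x (q n) < e"
    using dense_sequence by blast
  define W where "W js = (\<Inter>k<length js. cball (q (js ! k)) ((1/2)^k))" for js
  define S where "S js = fst ` (K \<inter> (UNIV \<times> W js))" for js
  have S_sets [measurable]: "S js \<in> sets borel" for js
  proof -
    have "closed (UNIV \<times> W js)" unfolding W_def by (intro closed_Times closed_UNIV closed_INT) auto
    then have "compact (K \<inter> (UNIV \<times> W js))" using K by (intro compact_Int_closed)
    then have "compact (S js)" unfolding S_def by (intro compact_continuous_image continuous_intros)
    then show ?thesis by (rule borel_compact)
  qed
  have W_snoc: "W (js @ [j]) = W js \<inter> cball (q j) ((1/2)^length js)" for js j
    unfolding W_def length_append_singleton lessThan_Suc INT_insert by (auto simp: nth_append)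
  have S_step: "\<exists>j. x \<in> S (js @ [j])" if x: "x \<in> S js" for x js
  proof -
    from x obtain w where w: "(x, w) \<in> K" "w \<in> W js" unfolding S_def by auto
    obtain j where "dist w (q j) < (1/2)^length js" using q[of "(1/2)^length js" w] by auto
    then have "w \<in> W (js @ [j])" using w(2) by (simp add: W_snoc dist_commute)
    then have "x \<in> S (js @ [j])" unfolding S_def using w(1) by force
    then show ?thesis ..
  qed
  define pre where "pre = rec_nat (\<lambda>x. []) (\<lambda>n p x. p x @ [LEAST j. x \<in> S (p x @ [j])])"
  have pre0: "pre 0 x = []" and preS: "pre (Suc n) x = pre n x @ [LEAST j. x \<in> S (pre n x @ [j])]" for n x
    by (simp_all add: pre_def)
  have pre_len: "length (pre n x) = n" for n x by (induction n) (simp_all add: pre0 preS)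
  have pre_nth: "pre n x ! k = pre (Suc k) x ! k" if "k < n" for n k x
    using that
  proof (induction n)
    case (Suc n)
    then show ?case by (cases "k = n") (auto simp: preS[of n] nth_append pre_len)
  qed simp
  have pre_meas: "pre n \<in> measurable borel (count_space UNIV)" for n
  proof (induction n)
    case 0
    have "pre 0 = (\<lambda>x. [])" by (simp add: pre0 fun_eq_iff)
    then show ?case by simp
  next
    case (Suc n)
    have *: "(\<lambda>x. js @ [LEAST j. x \<in> S (js @ [j])]) \<in> measurable borel (count_space UNIV)" for js
      by measurable
    have "(\<lambda>x. (\<lambda>js x. js @ [LEAST j. x \<in> S (js @ [j])]) (pre n x) x) \<in> measurable borel (count_space UNIV)"
      by (rule measurable_compose_countable[OF * Suc])
    then show ?case by (simp add: preS[abs_def])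
  qed
  have preS_in: "x \<in> S (pre n x)" if "x \<in> fst ` K" for n x
  proof (induction n)
    case 0
    then show ?case using that by (auto simp: pre0 S_def W_def)
  next
    case (Suc n)
    from LeastI_ex[OF S_step[OF this]] show ?case by (simp add: preS)
  qed
  define u where "u n x = (if x \<in> fst ` K then q (pre (Suc n) x ! n) else q 0)" for n x
  have near: "\<exists>w. (x, w) \<in> K \<and> (\<forall>k<n. dist (u k x) w \<le> (1/2)^k)" if "x \<in> fst ` K" for x n
  proof -
    from preS_in[OF that, of n] obtain w where w: "(x, w) \<in> K" "w \<in> W (pre n x)" unfolding S_def by auto
    have "dist (u k x) w \<le> (1/2)^k" if "k < n" for k
    proof -
      have "dist (q (pre n x ! k)) w \<le> (1/2)^k" using w(2) that by (simp add: W_def pre_len)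
      then show ?thesis using \<open>x \<in> fst ` K\<close> pre_nth[OF that, of x] by (simp add: u_def)
    qed
    with w(1) show ?thesis by blast
  qed
  have near2: "dist (u k x) (u l x) \<le> (1/2)^k + (1/2)^l" if "x \<in> fst ` K" for x k l
  proof -
    from near[OF that, of "Suc (max k l)"] obtain w where
      w: "\<And>i. i < Suc (max k l) \<Longrightarrow> dist (u i x) w \<le> (1/2)^i" by blast
    have "dist (u k x) w \<le> (1/2)^k" "dist (u l x) w \<le> (1/2)^l" by (auto intro: w)
    then show ?thesis using dist_triangle2[of "u k x" "u l x" w] by linarith
  qed
  have half: "(\<lambda>k. (1/2 :: real)^k) \<longlonglongrightarrow> 0" by (intro LIMSEQ_power_zero) simp
  have conv: "convergent (\<lambda>n. u n x)" for x
  proof (cases "x \<in> fst ` K")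
    case False
    then show ?thesis by (simp add: u_def convergent_const)
  next
    case True
    have "Cauchy (\<lambda>n. u n x)"
    proof (rule metric_CauchyI)
      fix e :: real assume "e > 0"
      then obtain M where M: "(1/2 :: real)^M < e / 2" using real_arch_pow_inv[of "e/2" "1/2"] by auto
      have "dist (u k x) (u l x) < e" if "k \<ge> M" "l \<ge> M" for k l
      proof -
        have "(1/2 :: real)^k \<le> (1/2)^M" "(1/2 :: real)^l \<le> (1/2)^M" using that by (auto intro!: power_decreasing)
        then show ?thesis using near2[OF True, of k l] M by linarith
      qed
      then show "\<exists>M. \<forall>m\<ge>M. \<forall>n\<ge>M. dist (u m x) (u n x) < e" by blast
    qed
    then show ?thesis by (rule Cauchy_convergent)
  qed
  have fK [measurable]: "fst ` K \<in> sets borel"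
    using K by (intro borel_compact compact_continuous_image continuous_intros)
  have u_meas: "u n \<in> borel_measurable borel" for n
  proof -
    have "(\<lambda>x. pre (Suc n) x) \<in> measurable borel (count_space UNIV)" by (rule pre_meas)
    from measurable_compose[OF this, of "\<lambda>js. q (js ! n)" borel]
    have [measurable]: "(\<lambda>x. q (pre (Suc n) x ! n)) \<in> borel_measurable borel" by simp
    show ?thesis unfolding u_def[abs_def] by measurable
  qed
  show thesis
  proof
    show "(\<lambda>x. lim (\<lambda>n. u n x)) \<in> borel_measurable borel"
      by (rule borel_measurable_LIMSEQ_metric[where f = u, OF u_meas]) (use conv convergent_LIMSEQ_iff in blast)
    fix x assume x: "x \<in> fst ` K"
    have ul: "(\<lambda>n. u n x) \<longlonglongrightarrow> lim (\<lambda>n. u n x)" using conv convergent_LIMSEQ_iff by blast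
    have "\<forall>n. \<exists>w. (x, w) \<in> K \<and> dist (u n x) w \<le> (1/2)^n"
    proof
      fix n show "\<exists>w. (x, w) \<in> K \<and> dist (u n x) w \<le> (1/2)^n" using near[OF x, of "Suc n"] by blast
    qed
    then obtain w where w: "\<And>n. (x, w n) \<in> K" "\<And>n. dist (u n x) (w n) \<le> (1/2)^n" by metis
    have "(\<lambda>n. dist (u n x) (w n)) \<longlonglongrightarrow> 0"
      by (rule tendsto_sandwich[OF _ _ tendsto_const half]) (use w(2) in \<open>auto intro!: always_eventually\<close>)
    then have "(\<lambda>n. dist (u n x) (w n) + dist (u n x) (lim (\<lambda>n. u n x))) \<longlonglongrightarrow> 0 + 0"
      by (rule tendsto_add) (rule iffD1[OF tendsto_dist_iff ul])
    then have lim0: "(\<lambda>n. dist (u n x) (w n) + dist (u n x) (lim (\<lambda>n. u n x))) \<longlonglongrightarrow> 0" by simp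
    have "(\<lambda>n. dist (w n) (lim (\<lambda>n. u n x))) \<longlonglongrightarrow> 0"
      by (rule tendsto_sandwich[OF _ _ tendsto_const lim0]) (auto intro!: always_eventually dist_triangle3)
    then have "w \<longlonglongrightarrow> lim (\<lambda>n. u n x)" by (rule iffD2[OF tendsto_dist_iff])
    then have "(\<lambda>n. (x, w n)) \<longlonglongrightarrow> (x, lim (\<lambda>n. u n x))" by (intro tendsto_intros)
    then show "(x, lim (\<lambda>n. u n x)) \<in> K"
      by (rule Lim_in_closed_set[OF compact_imp_closed[OF K] _ _, rotated 2]) (simp_all add: w(1))
  qed
qed

text \<open>Compact subsets of \<open>F\<close> have projections of measure close to 1; each admits
  a selection, and the one with the least index that reaches \<open>x\<close> is used. The Borel set
  \<open>E\<close> serves to bound the outer measure of the projection of \<open>F\<close>, which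
  itself need not be Borel.\<close>

lemma closed_uniformization_AE:
  fixes N :: "'a::polish_space measure" and F :: "('a \<times> 'w::{complete_space,second_countable_topology}) set"
  assumes N: "sets N = sets borel" "prob_space N"
    and F: "closed F" and E: "E \<in> sets borel" "AE x in N. x \<in> E" "E \<subseteq> fst ` F"
  obtains r where "r \<in> borel_measurable borel" "AE x in N. (x, r x) \<in> F"
proof -
  interpret N: prob_space N by fact
  have "1 = emeasure N E" using N.emeasure_eq_1_AE[of E] E N(1) by simp
  also have "\<dots> = outer_measure_of N E" using E N(1) by (intro outer_measure_of_eq[symmetric]) simp
  also have "\<dots> \<le> outer_measure_of N (fst ` F)" by (rule outer_measure_of_mono[OF E(3)])
  finally have out: "1 \<le> outer_measure_of N (fst ` F)" .
  have "\<exists>K. compact K \<and> K \<subseteq> F \<and> ennreal (1 - inverse (real (Suc n))) \<le> emeasure N (fst ` K)" for n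
  proof -
    have "ennreal (1 - inverse (real (Suc n))) < 1" by (simp add: ennreal_less_one_iff)
    also note out
    finally have *: "ennreal (1 - inverse (real (Suc n))) < outer_measure_of N (fst ` F)" .
    show ?thesis
      by (rule compact_inner_projection[OF N(1) N.finite_measure_axioms F *]) blast
  qed
  then obtain K where K: "\<And>n. compact (K n)" "\<And>n. K n \<subseteq> F"
    "\<And>n. ennreal (1 - inverse (real (Suc n))) \<le> emeasure N (fst ` K n)" by metis
  have "\<exists>r. r \<in> borel_measurable borel \<and> (\<forall>x\<in>fst ` K n. (x, r x) \<in> K n)" for n
    by (rule compact_selection[OF K(1)[of n]]) blast
  then obtain r where r: "\<And>n. r n \<in> borel_measurable borel" "\<And>n x. x \<in> fst ` K n \<Longrightarrow> (x, r n x) \<in> K n"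
    by metis
  have fK [measurable]: "fst ` K n \<in> sets borel" for n
    using K(1) by (intro borel_compact compact_continuous_image continuous_intros)
  define L where "L = (\<Union>n. fst ` K n)"
  have L: "L \<in> sets borel" unfolding L_def using fK by (intro sets.countable_UN'') auto
  have "1 - inverse (real (Suc n)) \<le> N.prob L" for n
  proof -
    have "ennreal (1 - inverse (real (Suc n))) \<le> ennreal (N.prob (fst ` K n))"
      using K(3)[of n] by (simp only: N.emeasure_eq_measure)
    then have "1 - inverse (real (Suc n)) \<le> N.prob (fst ` K n)" by (simp add: ennreal_le_iff)
    also have "\<dots> \<le> N.prob L"
    proof (rule N.finite_measure_mono)
      show "fst ` K n \<subseteq> L" unfolding L_def by blast
      show "L \<in> N.events" using L N(1) by simp
    qed
    finally show ?thesis .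
  qed
  moreover have "(\<lambda>n. 1 - inverse (real (Suc n))) \<longlonglongrightarrow> 1 - 0"
    by (intro tendsto_intros LIMSEQ_inverse_real_of_nat)
  ultimately have "N.prob L \<ge> 1" by (intro LIMSEQ_le_const2) auto
  then have "N.prob L = 1" using N.prob_le_1[of L] by linarith
  then have AE: "AE x in N. x \<in> L" using L N(1) by (subst (asm) N.prob_eq_1) auto
  define R where "R x = r (LEAST n. x \<in> fst ` K n) x" for x
  show thesis
  proof
    have *: "(\<lambda>x. LEAST n. x \<in> fst ` K n) \<in> measurable borel (count_space UNIV)" by measurable
    show "R \<in> borel_measurable borel"
      unfolding R_def[abs_def] by (rule measurable_compose_countable[OF r(1) *])
    show "AE x in N. (x, R x) \<in> F"
      using AE
    proof eventually_elim
      fix x assume "x \<in> L"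
      then have "\<exists>n. x \<in> fst ` K n" unfolding L_def by blast
      then have "x \<in> fst ` K (LEAST n. x \<in> fst ` K n)" by (rule LeastI_ex)
      from r(2)[OF this] have "(x, R x) \<in> K (LEAST n. x \<in> fst ` K n)" by (simp only: R_def)
      then show "(x, R x) \<in> F" using K(2) by blast
    qed
  qed
qed

text \<open>An almost-everywhere form of the Jankov-von Neumann theorem. A Borel set is the
  projection of a closed set with one more variable; both variables are selected together and the
  auxiliary one is forgotten.\<close>

lemma borel_uniformization_AE:
  fixes N :: "'a::polish_space measure" and B :: "('a \<times> 'w::{complete_space,second_countable_topology}) set"
  assumes N: "sets N = sets borel" "prob_space N"
    and B: "B \<in> sets borel" and E: "E \<in> sets borel" "AE x in N. x \<in> E" "E \<subseteq> fst ` B"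
  obtains r where "r \<in> borel_measurable borel" "AE x in N. (x, r x) \<in> B"
proof -
  obtain F :: "(('a \<times> 'w) \<times> (nat \<Rightarrow> real)) set" where F: "closed F" "B = fst ` F"
    using analytic_Borel[OF B] unfolding analytic_def by blast
  define F' where "F' = (\<lambda>p. ((fst p, fst (snd p)), snd (snd p))) -` F"
  have F': "closed F'" unfolding F'_def by (intro closed_vimage F(1) continuous_intros)
  have "E \<subseteq> fst ` F'"
  proof
    fix x assume "x \<in> E"
    then obtain w where "(x, w) \<in> B" using E(3) by auto
    then obtain s where "((x, w), s) \<in> F" using F(2) by auto
    then have "(x, w, s) \<in> F'" by (simp add: F'_def)
    then show "x \<in> fst ` F'" by force
  qed
  from closed_uniformization_AE[OF N F' E(1,2) this]
  obtain r where r: "r \<in> borel_measurable borel" "AE x in N. (x, r x) \<in> F'" by blast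
  show thesis
  proof
    show "(\<lambda>x. fst (r x)) \<in> borel_measurable borel"
      by (rule measurable_compose[OF r(1)]) (intro borel_measurable_continuous_onI continuous_intros)
    show "AE x in N. (x, fst (r x)) \<in> B"
      using r(2)
    proof eventually_elim
      fix x assume "(x, r x) \<in> F'"
      then have "((x, fst (r x)), snd (r x)) \<in> F" by (simp add: F'_def)
      then show "(x, fst (r x)) \<in> B" unfolding F(2) by force
    qed
  qed
qed

lemma orbit_selection_AE:
  fixes M :: "'x measure"
    and act :: "'g::{polish_space,topological_group_add} \<Rightarrow> 'x \<Rightarrow> 'x"
  assumes M: "standard_borel M" "prob_space M" and act: "borel_action M act"
    and T: "T \<in> measurable M M" "AE x in M. T x \<in> range (\<lambda>g. act g x)"
  obtains f where "f \<in> borel_measurable M" "AE x in M. T x = act (f x) x"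
proof -
  interpret prob_space M by fact
  obtain e :: "'x \<Rightarrow> nat \<Rightarrow> real" and e' where e: "e \<in> borel_measurable M" and e': "e' \<in> measurable borel M"
    and e'e: "\<And>x. x \<in> space M \<Longrightarrow> e' (e x) = x"
    using standard_borel_embedding[OF M(1) not_empty] by blast
  have e'sp: "e' a \<in> space M" for a using measurable_space[OF e'] by simp
  define N where "N = distr M borel e"
  have N: "sets N = sets borel" "prob_space N" unfolding N_def by (simp_all add: prob_space_distr[OF e])
  have actm: "(\<lambda>(g, x). act g x) \<in> measurable (borel \<Otimes>\<^sub>M M) M"
    using act by (simp add: borel_action_def)
  have act_space: "act g x \<in> space M" if "x \<in> space M" for g x
    using measurable_space[OF actm, of "(g, x)"] that by (simp add: space_pair_measure)
  \<comment> \<open>Equality of points of \<open>'x\<close> is tested after applying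
    \<open>e\<close>, which makes \<open>B\<close> a Borel subset of a product of Polish types;
    \<open>e'\<close> later removes \<open>e\<close> again.\<close>
  define B where "B = {p :: (nat \<Rightarrow> real) \<times> 'g. e (act (snd p) (e' (fst p))) = e (T (e' (fst p)))}"
  have B: "B \<in> sets borel"
  proof -
    have 1: "(\<lambda>p :: (nat \<Rightarrow> real) \<times> 'g. (snd p, e' (fst p))) \<in> measurable (borel \<Otimes>\<^sub>M borel) (borel \<Otimes>\<^sub>M M)"
      by (intro measurable_Pair measurable_snd measurable_compose[OF measurable_fst e'])
    have 2: "(\<lambda>p :: (nat \<Rightarrow> real) \<times> 'g. e (act (snd p) (e' (fst p)))) \<in> borel_measurable (borel \<Otimes>\<^sub>M borel)"
      using measurable_compose[OF measurable_compose[OF 1 actm] e] by simp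
    have 3: "(\<lambda>p :: (nat \<Rightarrow> real) \<times> 'g. e (T (e' (fst p)))) \<in> borel_measurable (borel \<Otimes>\<^sub>M borel)"
      by (rule measurable_compose[OF measurable_compose[OF measurable_compose[OF measurable_fst e'] T(1)] e])
    have "B = {p \<in> space (borel \<Otimes>\<^sub>M borel). e (act (snd p) (e' (fst p))) = e (T (e' (fst p)))}"
      by (simp add: B_def space_pair_measure)
    with measurable_equality_set[OF 2 3] have "B \<in> sets (borel \<Otimes>\<^sub>M borel)" by (simp only:)
    then show ?thesis by (simp only: borel_prod)
  qed
  \<comment> \<open>The set of \<open>x\<close> with \<open>T x\<close> in the orbit of
    \<open>x\<close> is not known to be measurable, so a measurable null set containing the
    exceptions is removed instead.\<close>
  from T(2) obtain N0 where N0: "N0 \<in> null_sets M" "{x \<in> space M. T x \<notin> range (\<lambda>g. act g x)} \<subseteq> N0"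
    by (auto elim!: AE_E simp: null_sets_def)
  define E where "E = e' -` (space M - N0) \<inter> space borel"
  have E: "E \<in> sets borel" unfolding E_def using N0 by (intro measurable_sets[OF e']) auto
  have "AE x in M. x \<notin> N0" using N0(1) by (rule AE_not_in)
  then have "AE x in M. e x \<in> E"
    by (rule AE_mp) (auto simp: E_def e'e intro!: AE_I2)
  then have AE_E: "AE a in N. a \<in> E" unfolding N_def using E by (subst AE_distr_iff[OF e]) simp_all
  have EB: "E \<subseteq> fst ` B"
  proof
    fix a assume "a \<in> E"
    then have "T (e' a) \<in> range (\<lambda>g. act g (e' a))" using N0(2) by (auto simp: E_def)
    then obtain g where "T (e' a) = act g (e' a)" by auto
    then have "(a, g) \<in> B" by (simp add: B_def)
    then show "a \<in> fst ` B" by force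
  qed
  from borel_uniformization_AE[OF N B E AE_E EB]
  obtain r where r: "r \<in> borel_measurable borel" "AE a in N. (a, r a) \<in> B" by blast
  have rB: "{a. (a, r a) \<in> B} \<in> sets borel"
  proof -
    have "(\<lambda>a. (a, r a)) \<in> borel_measurable borel" by (rule borel_measurable_Pair) (use r in auto)
    from measurable_sets[OF this B] show ?thesis by (simp add: vimage_def)
  qed
  have "AE x in M. (e x, r (e x)) \<in> B"
    using r(2) rB unfolding N_def by (subst (asm) AE_distr_iff[OF e]) simp_all
  then have "AE x in M. T x = act (r (e x)) x"
  proof (rule AE_mp, intro AE_I2 impI)
    fix x assume x: "x \<in> space M" "(e x, r (e x)) \<in> B"
    then have "e (act (r (e x)) x) = e (T x)" by (simp add: B_def e'e)
    then have "e' (e (act (r (e x)) x)) = e' (e (T x))" by (rule arg_cong)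
    then show "T x = act (r (e x)) x"
      using e'e act_space[OF x(1)] measurable_space[OF T(1) x(1)] by simp
  qed
  then show thesis by (intro that[of "\<lambda>x. r (e x)"] measurable_compose[OF e r(1)])
qed

section \<open>Convergence in measure\<close>

lemma tendsto_subseqI:
  fixes a :: "nat \<Rightarrow> 'b::metric_space"
  assumes "\<And>s :: nat \<Rightarrow> nat. strict_mono s \<Longrightarrow> \<exists>r. strict_mono r \<and> (\<lambda>n. a (s (r n))) \<longlonglongrightarrow> l"
  shows "a \<longlonglongrightarrow> l"
proof (rule ccontr)
  assume "\<not> a \<longlonglongrightarrow> l"
  then obtain e where e: "e > 0" "\<And>N. \<exists>n\<ge>N. dist (a n) l \<ge> e"
    unfolding lim_sequentially by (metis not_le)
  define S where "S = {n. dist (a n) l \<ge> e}"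
  have inf: "infinite S" unfolding infinite_nat_iff_unbounded_le S_def using e(2) by auto
  have "strict_mono (enumerate S)" using inf by (simp add: strict_mono_enumerate)
  from assms[OF this] obtain r where r: "strict_mono r" "(\<lambda>n. a (enumerate S (r n))) \<longlonglongrightarrow> l" by blast
  from r(2) e(1) obtain n where "dist (a (enumerate S (r n))) l < e"
    unfolding lim_sequentially by blast
  moreover have "enumerate S (r n) \<in> S" by (rule enumerate_in_set[OF inf])
  ultimately show False by (simp add: S_def)
qed

lemma tendsto_indicator_iff:
  "((\<lambda>k. indicator (A k) (y k) :: real) \<longlonglongrightarrow> indicator B z) \<longleftrightarrow> (\<forall>\<^sub>F k in sequentially. y k \<in> A k \<longleftrightarrow> z \<in> B)"
proof
  assume "(\<lambda>k. indicator (A k) (y k) :: real) \<longlonglongrightarrow> indicator B z"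
  then have "\<forall>\<^sub>F k in sequentially. dist (indicator (A k) (y k) :: real) (indicator B z) < 1"
    by (rule tendstoD) simp
  then show "\<forall>\<^sub>F k in sequentially. y k \<in> A k \<longleftrightarrow> z \<in> B"
    by eventually_elim (auto simp: indicator_def dist_real_def split: if_splits)
next
  assume "\<forall>\<^sub>F k in sequentially. y k \<in> A k \<longleftrightarrow> z \<in> B"
  then have "\<forall>\<^sub>F k in sequentially. indicator (A k) (y k) = (indicator B z :: real)"
    by eventually_elim (auto simp: indicator_def)
  then show "(\<lambda>k. indicator (A k) (y k) :: real) \<longlonglongrightarrow> indicator B z" by (rule tendsto_eventually)
qed

text \<open>The integrand is that of \<open>L0_dist\<close>, so for measurable functions this is
  convergence of their classes in that metric.\<close>

definition conv_meas :: "'x measure \<Rightarrow> (nat \<Rightarrow> 'x \<Rightarrow> 'y::metric_space) \<Rightarrow> ('x \<Rightarrow> 'y) \<Rightarrow> bool" where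
  "conv_meas M F f \<longleftrightarrow> (\<lambda>k. LINT x|M. min 1 (dist (F k x) (f x))) \<longlonglongrightarrow> 0"

text \<open>Invertibility is left out on purpose: a map \<open>\<lambda>x. act (f x) x\<close> that
  represents an element of the full group is only known to agree with a bijection almost
  everywhere.\<close>

definition mpres :: "'x measure \<Rightarrow> ('x \<Rightarrow> 'x) \<Rightarrow> bool" where
  "mpres M T \<longleftrightarrow> T \<in> measurable M M \<and> distr M M T = M"

text \<open>Says that the symmetric difference of the preimages of \<open>A\<close> under
  \<open>T k\<close> and \<open>T'\<close> has measure tending to 0; on automorphisms this is
  convergence in the weak topology.\<close>

definition weak_conv_maps :: "'x measure \<Rightarrow> (nat \<Rightarrow> 'x \<Rightarrow> 'x) \<Rightarrow> ('x \<Rightarrow> 'x) \<Rightarrow> bool" where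
  "weak_conv_maps M T T' \<longleftrightarrow>
     (\<forall>A\<in>sets M. conv_meas M (\<lambda>k x. indicator A (T k x) :: real) (\<lambda>x. indicator A (T' x)))"

lemma conv_meas_subseq: "conv_meas M F f \<Longrightarrow> strict_mono s \<Longrightarrow> conv_meas M (\<lambda>k. F (s k)) f"
  unfolding conv_meas_def using LIMSEQ_subseq_LIMSEQ by (fastforce simp: o_def)

lemma mpresD: "mpres M T \<Longrightarrow> T \<in> measurable M M"
  by (simp add: mpres_def)

lemma mpres_AE: "mpres M T \<Longrightarrow> AE x in M. P x \<Longrightarrow> AE x in M. P (T x)"
  unfolding mpres_def by (metis AE_distrD)

lemma mpres_integral:
  fixes g :: "'x \<Rightarrow> real"
  assumes "mpres M T" "g \<in> borel_measurable M"
  shows "(LINT x|M. g (T x)) = (LINT x|M. g x)"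
  using integral_distr[of T M M g] assms by (simp add: mpres_def)

lemma mpres_ident: "mpres M (\<lambda>x. x)"
  by (simp add: mpres_def distr_id)

lemma mpres_compose:
  assumes "mpres M S" "mpres M T"
  shows "mpres M (\<lambda>x. S (T x))"
proof -
  have "distr M M (\<lambda>x. S (T x)) = distr (distr M M T) M S"
    using assms by (subst distr_distr) (auto simp: mpres_def o_def)
  then show ?thesis using assms by (auto simp: mpres_def)
qed

lemma mpres_cong_AE:
  assumes "mpres M S" "T \<in> measurable M M" "AE x in M. T x = S x"
  shows "mpres M T"
proof -
  have "distr M M T = distr M M S"
    using assms by (intro distr_cong_AE) (auto simp: mpres_def)
  then show ?thesis using assms by (simp add: mpres_def)
qed

context prob_space
begin

lemma integrable_min_dist:
  fixes F f :: "'a \<Rightarrow> 'y::polish_space"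
  assumes "F \<in> borel_measurable M" "f \<in> borel_measurable M"
  shows "integrable M (\<lambda>x. min 1 (dist (F x) (f x)))"
proof (rule integrable_const_bound[where B=1])
  note [measurable] = assms
  show "(\<lambda>x. min 1 (dist (F x) (f x))) \<in> borel_measurable M" by measurable
qed auto

lemma conv_meas_AE_subseq:
  fixes F :: "nat \<Rightarrow> 'a \<Rightarrow> 'y::polish_space"
  assumes F: "\<And>k. F k \<in> borel_measurable M" "f \<in> borel_measurable M" and c: "conv_meas M F f"
  shows "\<exists>r. strict_mono r \<and> (AE x in M. (\<lambda>k. F (r k) x) \<longlonglongrightarrow> f x)"
proof -
  have "(\<lambda>k. LINT x|M. norm (min 1 (dist (F k x) (f x)))) \<longlonglongrightarrow> 0"
    using c by (simp add: conv_meas_def)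
  from tendsto_L1_AE_subseq[OF integrable_min_dist[OF F] this]
  obtain r where r: "strict_mono r" "AE x in M. (\<lambda>k. min 1 (dist (F (r k) x) (f x))) \<longlonglongrightarrow> 0" by blast
  from r(2) have "AE x in M. (\<lambda>k. F (r k) x) \<longlonglongrightarrow> f x"
  proof eventually_elim
    fix x assume x: "(\<lambda>k. min 1 (dist (F (r k) x) (f x))) \<longlonglongrightarrow> 0"
    then have ev: "\<forall>\<^sub>F k in sequentially. min 1 (dist (F (r k) x) (f x)) < 1"
      by (rule order_tendstoD) simp
    have "\<forall>\<^sub>F k in sequentially. min 1 (dist (F (r k) x) (f x)) = dist (F (r k) x) (f x)"
      using ev by eventually_elim auto
    then have "(\<lambda>k. dist (F (r k) x) (f x)) \<longlonglongrightarrow> 0" using x by (rule Lim_transform_eventually[rotated])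
    then show "(\<lambda>k. F (r k) x) \<longlonglongrightarrow> f x" by (rule iffD2[OF tendsto_dist_iff])
  qed
  with r(1) show ?thesis by blast
qed

text \<open>The converse half of the subsequence principle. Together with
  \<open>conv_meas_AE_subseq\<close> it reduces statements about convergence in measure to pointwise
  ones along a further subsequence, where continuity can be applied.\<close>

lemma conv_measI_AE:
  fixes F :: "nat \<Rightarrow> 'a \<Rightarrow> 'y::polish_space"
  assumes F: "\<And>k. F k \<in> borel_measurable M" "f \<in> borel_measurable M"
    and sub: "\<And>s :: nat \<Rightarrow> nat. strict_mono s \<Longrightarrow>
      \<exists>r. strict_mono r \<and> (AE x in M. (\<lambda>k. F (s (r k)) x) \<longlonglongrightarrow> f x)"
  shows "conv_meas M F f"
  unfolding conv_meas_def
proof (rule tendsto_subseqI)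
  fix s :: "nat \<Rightarrow> nat" assume "strict_mono s"
  from sub[OF this] obtain r where r: "strict_mono r" "AE x in M. (\<lambda>k. F (s (r k)) x) \<longlonglongrightarrow> f x" by blast
  have "(\<lambda>k. LINT x|M. min 1 (dist (F (s (r k)) x) (f x))) \<longlonglongrightarrow> (LINT x|M. 0 :: real)"
  proof (rule integral_dominated_convergence[where w = "\<lambda>_. 1"])
    show "AE x in M. (\<lambda>k. min 1 (dist (F (s (r k)) x) (f x))) \<longlonglongrightarrow> 0"
      using r(2)
    proof eventually_elim
      fix x assume "(\<lambda>k. F (s (r k)) x) \<longlonglongrightarrow> f x"
      then have "(\<lambda>k. dist (F (s (r k)) x) (f x)) \<longlonglongrightarrow> 0" by (rule iffD1[OF tendsto_dist_iff])
      then have "(\<lambda>k. min 1 (dist (F (s (r k)) x) (f x))) \<longlonglongrightarrow> min 1 0"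
        by (intro tendsto_min tendsto_const)
      then show "(\<lambda>k. min 1 (dist (F (s (r k)) x) (f x))) \<longlonglongrightarrow> 0" by simp
    qed
    show "(\<lambda>x. min 1 (dist (F (s (r k)) x) (f x))) \<in> borel_measurable M" for k
      using integrable_min_dist[OF F] by (rule borel_measurable_integrable)
  qed auto
  with r(1) show "\<exists>r. strict_mono r \<and> (\<lambda>k. LINT x|M. min 1 (dist (F (s (r k)) x) (f x))) \<longlonglongrightarrow> 0"
    by auto
qed

lemma conv_meas_AE_subseq_all:
  fixes F :: "nat \<Rightarrow> nat \<Rightarrow> 'a \<Rightarrow> 'y::polish_space"
  assumes F: "\<And>n k. F n k \<in> borel_measurable M" "\<And>n. f n \<in> borel_measurable M"
    and c: "\<And>n. conv_meas M (F n) (f n)"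
  shows "\<exists>r. strict_mono r \<and> (AE x in M. \<forall>n. (\<lambda>k. F n (r k) x) \<longlonglongrightarrow> f n x)"
proof -
  define P where "P n s \<longleftrightarrow> (AE x in M. (\<lambda>k. F n (s k) x) \<longlonglongrightarrow> f n x)" for n and s :: "nat \<Rightarrow> nat"
  interpret subseqs P
  proof
    fix n and s :: "nat \<Rightarrow> nat" assume s: "strict_mono s"
    from conv_meas_AE_subseq[OF F(1) F(2) conv_meas_subseq[OF c s]]
    show "\<exists>r'. strict_mono r' \<and> P n (s \<circ> r')" by (simp add: P_def)
  qed
  have "AE x in M. (\<lambda>k. F n (diagseq k) x) \<longlonglongrightarrow> f n x" for n
  proof -
    \<comment> \<open>The diagonal sequence is guaranteed to refine the \<open>n\<close>-th stage
      only after its first \<open>Suc n\<close> terms; dropping finitely many terms does not affect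
      the limit.\<close>
    have "P n (diagseq \<circ> ((+) (Suc n)))"
    proof (rule diagseq_holds)
      fix r s :: "nat \<Rightarrow> nat" and n assume rs: "strict_mono r" "P n s"
      from rs(2) show "P n (s \<circ> r)" unfolding P_def
      proof eventually_elim
        fix x assume "(\<lambda>k. F n (s k) x) \<longlonglongrightarrow> f n x"
        from LIMSEQ_subseq_LIMSEQ[OF this rs(1)] show "(\<lambda>k. F n ((s \<circ> r) k) x) \<longlonglongrightarrow> f n x"
          by (simp add: o_def)
      qed
    qed
    then have "AE x in M. (\<lambda>k. F n (diagseq (k + Suc n)) x) \<longlonglongrightarrow> f n x"
      by (simp only: P_def o_def add.commute[of "Suc n"])
    then show ?thesis
    proof eventually_elim
      fix x assume "(\<lambda>k. F n (diagseq (k + Suc n)) x) \<longlonglongrightarrow> f n x"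
      then show "(\<lambda>k. F n (diagseq k) x) \<longlonglongrightarrow> f n x" by (rule LIMSEQ_offset)
    qed
  qed
  then show ?thesis using subseq_diagseq by (intro exI[of _ diagseq]) (simp add: AE_all_countable)
qed

text \<open>The metric of the group need not be translation invariant, so the distance of two sums
  has no direct estimate. Continuity of addition is applied along almost everywhere convergent
  subsequences instead.\<close>

lemma conv_meas_add:
  fixes F G :: "nat \<Rightarrow> 'a \<Rightarrow> 'g::{polish_space,topological_monoid_add}"
  assumes F: "\<And>k. F k \<in> borel_measurable M" "f \<in> borel_measurable M" "conv_meas M F f"
    and G: "\<And>k. G k \<in> borel_measurable M" "g \<in> borel_measurable M" "conv_meas M G g"
  shows "conv_meas M (\<lambda>k x. F k x + G k x) (\<lambda>x. f x + g x)"
proof (rule conv_measI_AE)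
  show "(\<lambda>x. F k x + G k x) \<in> borel_measurable M" for k
    by (rule borel_measurable_continuous_Pair[OF F(1) G(1)]) (intro continuous_intros)
  show "(\<lambda>x. f x + g x) \<in> borel_measurable M"
    by (rule borel_measurable_continuous_Pair[OF F(2) G(2)]) (intro continuous_intros)
  fix s :: "nat \<Rightarrow> nat" assume s: "strict_mono s"
  obtain r where r: "strict_mono r" "AE x in M. (\<lambda>k. F (s (r k)) x) \<longlonglongrightarrow> f x"
    using conv_meas_AE_subseq[OF F(1,2) conv_meas_subseq[OF F(3) s]] by blast
  have sr: "strict_mono (\<lambda>k. s (r k))" using strict_mono_o[OF s r(1)] by (simp add: o_def)
  obtain q where q: "strict_mono q" "AE x in M. (\<lambda>k. G (s (r (q k))) x) \<longlonglongrightarrow> g x"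
    using conv_meas_AE_subseq[OF G(1,2) conv_meas_subseq[OF G(3) sr]] by blast
  have "AE x in M. (\<lambda>k. F (s (r (q k))) x + G (s (r (q k))) x) \<longlonglongrightarrow> f x + g x"
    using r(2) q(2)
  proof eventually_elim
    fix x assume "(\<lambda>k. F (s (r k)) x) \<longlonglongrightarrow> f x" "(\<lambda>k. G (s (r (q k))) x) \<longlonglongrightarrow> g x"
    from LIMSEQ_subseq_LIMSEQ[OF this(1) q(1)] this(2)
    show "(\<lambda>k. F (s (r (q k))) x + G (s (r (q k))) x) \<longlonglongrightarrow> f x + g x"
      by (intro tendsto_add) (simp_all add: o_def)
  qed
  then show "\<exists>r. strict_mono r \<and> (AE x in M. (\<lambda>k. F (s (r k)) x + G (s (r k)) x) \<longlonglongrightarrow> f x + g x)"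
    using strict_mono_o[OF r(1) q(1)] by (intro exI[of _ "r \<circ> q"]) simp
qed

text \<open>Since all maps preserve the measure, the events \<open>T k x \<in> A\<close> all have the same probability,
  so one inclusion in the limit suffices.\<close>

lemma conv_meas_indicatorI:
  assumes T: "\<And>k. mpres M (T k)" "mpres M T'" and A: "A \<in> sets M"
    and sub: "\<And>s :: nat \<Rightarrow> nat. strict_mono s \<Longrightarrow> \<exists>r. strict_mono r \<and>
      (AE x in M. T' x \<in> A \<longrightarrow> (\<forall>\<^sub>F k in sequentially. T (s (r k)) x \<in> A))"
  shows "conv_meas M (\<lambda>k x. indicator A (T k x) :: real) (\<lambda>x. indicator A (T' x))"
proof -
  note [measurable] = mpresD[OF T(1)] mpresD[OF T(2)] A
  let ?i = "\<lambda>T x. indicator A (T x) :: real"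
  define g where "g k x = ?i T' x * (1 - ?i (T k) x)" for k x
  have [measurable]: "g k \<in> borel_measurable M" for k unfolding g_def[abs_def] by measurable
  have intg: "integrable M (g k)" for k
    by (rule integrable_const_bound[where B=1]) (auto simp: g_def indicator_def)
  have inti: "integrable M (?i (T k))" "integrable M (?i T')" for k
    by (rule integrable_const_bound[where B=1]; auto simp: indicator_def)+
  have "(LINT x|M. min 1 (dist (?i (T k) x) (?i T' x))) = 2 * (LINT x|M. g k x)" for k
  proof -
    \<comment> \<open>For \<open>a\<close> and \<open>b\<close> in {0, 1} one has |a - b| = a - b +
      2 b (1 - a). Invariance of the measure then cancels the integrals of the first two
      terms.\<close>
    have "(LINT x|M. min 1 (dist (?i (T k) x) (?i T' x))) = (LINT x|M. ?i (T k) x - ?i T' x + 2 * g k x)"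
      by (rule Bochner_Integration.integral_cong) (auto simp: g_def indicator_def)
    also have "\<dots> = (LINT x|M. ?i (T k) x) - (LINT x|M. ?i T' x) + 2 * (LINT x|M. g k x)"
      using inti intg by simp
    also have "(LINT x|M. ?i (T k) x) = (LINT x|M. indicator A x)"
      by (rule mpres_integral[OF T(1)]) simp
    also have "(LINT x|M. ?i T' x) = (LINT x|M. indicator A x)"
      by (rule mpres_integral[OF T(2)]) simp
    finally show ?thesis by simp
  qed
  moreover have "(\<lambda>k. LINT x|M. g k x) \<longlonglongrightarrow> 0"
  proof (rule tendsto_subseqI)
    fix s :: "nat \<Rightarrow> nat" assume "strict_mono s"
    from sub[OF this] obtain r where r: "strict_mono r"
      "AE x in M. T' x \<in> A \<longrightarrow> (\<forall>\<^sub>F k in sequentially. T (s (r k)) x \<in> A)" by blast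
    have "(\<lambda>k. LINT x|M. g (s (r k)) x) \<longlonglongrightarrow> (LINT x|M. 0 :: real)"
    proof (rule integral_dominated_convergence[where w = "\<lambda>_. 1"])
      show "AE x in M. (\<lambda>k. g (s (r k)) x) \<longlonglongrightarrow> 0"
        using r(2)
      proof eventually_elim
        fix x assume x: "T' x \<in> A \<longrightarrow> (\<forall>\<^sub>F k in sequentially. T (s (r k)) x \<in> A)"
        show "(\<lambda>k. g (s (r k)) x) \<longlonglongrightarrow> 0"
        proof (cases "T' x \<in> A")
          case True
          with x have "\<forall>\<^sub>F k in sequentially. T (s (r k)) x \<in> A" by simp
          then have "\<forall>\<^sub>F k in sequentially. g (s (r k)) x = 0"
            by eventually_elim (simp add: g_def)
          then show ?thesis by (rule tendsto_eventually)
        qed (simp add: g_def)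
      qed
      show "AE x in M. norm (g (s (r k)) x) \<le> 1" for k by (auto simp: g_def indicator_def)
    qed auto
    with r(1) show "\<exists>r. strict_mono r \<and> (\<lambda>k. LINT x|M. g (s (r k)) x) \<longlonglongrightarrow> 0" by auto
  qed
  then have "(\<lambda>k. 2 * (LINT x|M. g k x)) \<longlonglongrightarrow> 2 * 0" by (intro tendsto_mult tendsto_const)
  ultimately show ?thesis by (simp add: conv_meas_def)
qed

section \<open>Weak convergence of measure-preserving maps\<close>

lemma conv_meas_indicator_subseq:
  assumes T: "\<And>k. mpres M (T k)" "mpres M T'" and A: "\<And>n :: nat. A n \<in> sets M"
    and c: "\<And>n. conv_meas M (\<lambda>k x. indicator (A n) (T k x) :: real) (\<lambda>x. indicator (A n) (T' x))"
  shows "\<exists>r. strict_mono r \<and> (AE x in M. \<forall>n. \<forall>\<^sub>F k in sequentially. T (r k) x \<in> A n \<longleftrightarrow> T' x \<in> A n)"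
proof -
  note [measurable] = mpresD[OF T(1)] mpresD[OF T(2)] A
  have "(\<lambda>x. indicator (A n) (T k x) :: real) \<in> borel_measurable M"
    "(\<lambda>x. indicator (A n) (T' x) :: real) \<in> borel_measurable M" for n k by measurable
  from conv_meas_AE_subseq_all[OF this c] show ?thesis by (simp add: tendsto_indicator_iff)
qed

text \<open>Countable unions are the delicate case. If \<open>T' x\<close> lies outside all
  \<open>A n\<close>, the points \<open>T k x\<close> may still enter \<open>A n\<close> with
  \<open>n\<close> growing along \<open>k\<close>, so pointwise only one inclusion passes to the
  union. By \<open>conv_meas_indicatorI\<close> that inclusion suffices.\<close>

lemma sigma_algebra_indicator_conv:
  assumes T: "\<And>k. mpres M (T k)" "mpres M T'"
  shows "sigma_algebra (space M)
    {A \<in> sets M. conv_meas M (\<lambda>k x. indicator A (T k x) :: real) (\<lambda>x. indicator A (T' x))}"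
    (is "sigma_algebra _ ?\<A>")
  unfolding sigma_algebra_iff2
proof (intro conjI ballI allI impI)
  show "?\<A> \<subseteq> Pow (space M)" using sets.sets_into_space by auto
  show "{} \<in> ?\<A>" by (simp add: conv_meas_def)
next
  fix A assume A: "A \<in> ?\<A>"
  have "conv_meas M (\<lambda>k x. indicator (space M - A) (T k x) :: real) (\<lambda>x. indicator (space M - A) (T' x))"
  proof -
    have "(LINT x|M. min 1 (dist (indicator (space M - A) (T k x) :: real) (indicator (space M - A) (T' x))))
        = (LINT x|M. min 1 (dist (indicator A (T k x) :: real) (indicator A (T' x))))" for k
      using measurable_space[OF mpresD[OF T(1)]] measurable_space[OF mpresD[OF T(2)]]
      by (intro Bochner_Integration.integral_cong) (auto simp: indicator_def)
    then show ?thesis using A by (simp add: conv_meas_def)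
  qed
  with A show "space M - A \<in> ?\<A>" by auto
next
  fix A :: "nat \<Rightarrow> 'a set" assume "range A \<subseteq> ?\<A>"
  then have A: "A n \<in> sets M" "conv_meas M (\<lambda>k x. indicator (A n) (T k x) :: real) (\<lambda>x. indicator (A n) (T' x))" for n
    by auto
  have "conv_meas M (\<lambda>k x. indicator (\<Union>n. A n) (T k x) :: real) (\<lambda>x. indicator (\<Union>n. A n) (T' x))"
  proof (rule conv_meas_indicatorI[OF T])
    show "(\<Union>n. A n) \<in> sets M" using A by auto
    fix s :: "nat \<Rightarrow> nat" assume s: "strict_mono s"
    have "\<exists>r. strict_mono r \<and> (AE x in M. \<forall>n. \<forall>\<^sub>F k in sequentially. T (s (r k)) x \<in> A n \<longleftrightarrow> T' x \<in> A n)"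
      by (rule conv_meas_indicator_subseq[where T = "\<lambda>k. T (s k)"]) (rule T A conv_meas_subseq[OF A(2) s])+
    then obtain r where r: "strict_mono r"
      "AE x in M. \<forall>n. \<forall>\<^sub>F k in sequentially. T (s (r k)) x \<in> A n \<longleftrightarrow> T' x \<in> A n" by (elim exE conjE)
    from r(2) have "AE x in M. T' x \<in> (\<Union>n. A n) \<longrightarrow> (\<forall>\<^sub>F k in sequentially. T (s (r k)) x \<in> (\<Union>n. A n))"
    proof (eventually_elim, intro impI)
      fix x assume x: "\<forall>n. \<forall>\<^sub>F k in sequentially. T (s (r k)) x \<in> A n \<longleftrightarrow> T' x \<in> A n" "T' x \<in> (\<Union>n. A n)"
      then obtain n where n: "T' x \<in> A n" by blast
      from x(1) have "\<forall>\<^sub>F k in sequentially. T (s (r k)) x \<in> A n \<longleftrightarrow> T' x \<in> A n" by blast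
      then show "\<forall>\<^sub>F k in sequentially. T (s (r k)) x \<in> (\<Union>n. A n)"
        by eventually_elim (use n in blast)
    qed
    with r(1) show "\<exists>r. strict_mono r \<and>
        (AE x in M. T' x \<in> (\<Union>n. A n) \<longrightarrow> (\<forall>\<^sub>F k in sequentially. T (s (r k)) x \<in> (\<Union>n. A n)))" by blast
  qed
  with A(1) show "(\<Union>i. A i) \<in> ?\<A>" by auto
qed

text \<open>It is enough to test the preimages under \<phi> of countably many small balls. Along a
  subsequence \<open>T k x\<close> eventually lies in the same preimages as \<open>T' x\<close>, and
  each ball around \<open>\<phi> (T' x)\<close> then captures \<open>\<phi> (T k x)\<close>.\<close>

lemma weak_conv_maps_comp:
  fixes \<phi> :: "'a \<Rightarrow> 'y::polish_space"
  assumes T: "\<And>k. mpres M (T k)" "mpres M T'" and w: "weak_conv_maps M T T'"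
    and \<phi>: "\<phi> \<in> borel_measurable M"
  shows "conv_meas M (\<lambda>k x. \<phi> (T k x)) (\<lambda>x. \<phi> (T' x))"
proof (rule conv_measI_AE)
  show "(\<lambda>x. \<phi> (T k x)) \<in> borel_measurable M" for k by (rule measurable_compose[OF mpresD[OF T(1)] \<phi>])
  show "(\<lambda>x. \<phi> (T' x)) \<in> borel_measurable M" by (rule measurable_compose[OF mpresD[OF T(2)] \<phi>])
  fix s :: "nat \<Rightarrow> nat" assume s: "strict_mono s"
  obtain q :: "nat \<Rightarrow> 'y" where q: "\<And>x e. e > 0 \<Longrightarrow> \<exists>n. dist x (q n) < e"
    using dense_sequence by blast
  define A where "A n = (case prod_decode n of (i, j) \<Rightarrow> \<phi> -` ball (q i) (inverse (real (Suc j))) \<inter> space M)" for n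
  have A: "A n \<in> sets M" for n
    unfolding A_def by (auto split: prod.splits intro!: measurable_sets[OF \<phi>])
  have "conv_meas M (\<lambda>k x. indicator (A n) (T (s k) x) :: real) (\<lambda>x. indicator (A n) (T' x))" for n
  proof -
    have "conv_meas M (\<lambda>k x. indicator (A n) (T k x) :: real) (\<lambda>x. indicator (A n) (T' x))"
      using w A[of n] by (simp add: weak_conv_maps_def)
    from conv_meas_subseq[OF this s] show ?thesis .
  qed
  then have "\<exists>r. strict_mono r \<and> (AE x in M. \<forall>n. \<forall>\<^sub>F k in sequentially. T (s (r k)) x \<in> A n \<longleftrightarrow> T' x \<in> A n)"
    by (intro conv_meas_indicator_subseq[where T = "\<lambda>k. T (s k)"]) (rule T A | assumption)+
  then obtain r where r: "strict_mono r"
    "AE x in M. \<forall>n. \<forall>\<^sub>F k in sequentially. T (s (r k)) x \<in> A n \<longleftrightarrow> T' x \<in> A n" by (elim exE conjE)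
  from r(2) have "AE x in M. (\<lambda>k. \<phi> (T (s (r k)) x)) \<longlonglongrightarrow> \<phi> (T' x)"
  proof (rule AE_mp, intro AE_I2 impI)
    fix x assume x: "x \<in> space M" "\<forall>n. \<forall>\<^sub>F k in sequentially. T (s (r k)) x \<in> A n \<longleftrightarrow> T' x \<in> A n"
    have T'x: "T' x \<in> space M" by (rule measurable_space[OF mpresD[OF T(2)] x(1)])
    show "(\<lambda>k. \<phi> (T (s (r k)) x)) \<longlonglongrightarrow> \<phi> (T' x)"
    proof (rule tendstoI)
      fix e :: real assume "e > 0"
      then obtain j where j: "inverse (real (Suc j)) < e / 2" using reals_Archimedean[of "e / 2"] by auto
      obtain i where i: "dist (\<phi> (T' x)) (q i) < inverse (real (Suc j))" using q[of "inverse (real (Suc j))"] by auto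
      have "T' x \<in> A (prod_encode (i, j))" using i T'x by (simp add: A_def dist_commute)
      moreover from x(2) have "\<forall>\<^sub>F k in sequentially. T (s (r k)) x \<in> A (prod_encode (i, j)) \<longleftrightarrow> T' x \<in> A (prod_encode (i, j))"
        by blast
      ultimately have "\<forall>\<^sub>F k in sequentially. T (s (r k)) x \<in> A (prod_encode (i, j))" by simp
      then show "\<forall>\<^sub>F k in sequentially. dist (\<phi> (T (s (r k)) x)) (\<phi> (T' x)) < e"
      proof eventually_elim
        fix k assume "T (s (r k)) x \<in> A (prod_encode (i, j))"
        then have "dist (q i) (\<phi> (T (s (r k)) x)) < inverse (real (Suc j))" by (simp add: A_def)
        then show "dist (\<phi> (T (s (r k)) x)) (\<phi> (T' x)) < e"
          using dist_triangle[of "\<phi> (T (s (r k)) x)" "\<phi> (T' x)" "q i"] i j by (simp add: dist_commute)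
      qed
    qed
  qed
  with r(1) show "\<exists>r. strict_mono r \<and> (AE x in M. (\<lambda>k. \<phi> (T (s (r k)) x)) \<longlonglongrightarrow> \<phi> (T' x))" by blast
qed

text \<open>The error is split at \<open>f (T k x)\<close>. The part with \<open>F k\<close> is
  carried back by the invariance of the measure under \<open>T k\<close>, and the other part
  concerns the fixed map \<open>f\<close>, where weak convergence applies.\<close>

lemma conv_meas_comp:
  fixes F :: "nat \<Rightarrow> 'a \<Rightarrow> 'y::polish_space"
  assumes T: "\<And>k. mpres M (T k)" "mpres M T'" "weak_conv_maps M T T'"
    and F: "\<And>k. F k \<in> borel_measurable M" "f \<in> borel_measurable M" "conv_meas M F f"
  shows "conv_meas M (\<lambda>k x. F k (T k x)) (\<lambda>x. f (T' x))"
  unfolding conv_meas_def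
proof (rule tendsto_sandwich)
  note m = measurable_compose[OF mpresD[OF T(1)] F(1)] measurable_compose[OF mpresD[OF T(1)] F(2)]
    measurable_compose[OF mpresD[OF T(2)] F(2)]
  show "\<forall>\<^sub>F k in sequentially. 0 \<le> (LINT x|M. min 1 (dist (F k (T k x)) (f (T' x))))"
    by (intro always_eventually allI Bochner_Integration.integral_nonneg) auto
  show "\<forall>\<^sub>F k in sequentially. (LINT x|M. min 1 (dist (F k (T k x)) (f (T' x))))
      \<le> (LINT x|M. min 1 (dist (F k x) (f x))) + (LINT x|M. min 1 (dist (f (T k x)) (f (T' x))))"
  proof (intro always_eventually allI)
    fix k
    have "(LINT x|M. min 1 (dist (F k (T k x)) (f (T' x))))
        \<le> (LINT x|M. min 1 (dist (F k (T k x)) (f (T k x))) + min 1 (dist (f (T k x)) (f (T' x))))"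
    proof (rule integral_mono)
      show "min 1 (dist (F k (T k x)) (f (T' x)))
          \<le> min 1 (dist (F k (T k x)) (f (T k x))) + min 1 (dist (f (T k x)) (f (T' x)))" for x
        using dist_triangle[of "F k (T k x)" "f (T' x)" "f (T k x)"] zero_le_dist[of "F k (T k x)" "f (T k x)"]
          zero_le_dist[of "f (T k x)" "f (T' x)"] unfolding min_def by (smt (verit))
    qed (intro integrable_min_dist m Bochner_Integration.integrable_add)+
    also have "\<dots> = (LINT x|M. min 1 (dist (F k (T k x)) (f (T k x)))) + (LINT x|M. min 1 (dist (f (T k x)) (f (T' x))))"
      by (intro Bochner_Integration.integral_add integrable_min_dist m)
    also have "(LINT x|M. min 1 (dist (F k (T k x)) (f (T k x)))) = (LINT x|M. min 1 (dist (F k x) (f x)))"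
      using mpres_integral[OF T(1) borel_measurable_integrable[OF integrable_min_dist[OF F(1,2)]]] .
    finally show "(LINT x|M. min 1 (dist (F k (T k x)) (f (T' x))))
      \<le> (LINT x|M. min 1 (dist (F k x) (f x))) + (LINT x|M. min 1 (dist (f (T k x)) (f (T' x))))" .
  qed
  have "(\<lambda>k. (LINT x|M. min 1 (dist (F k x) (f x))) + (LINT x|M. min 1 (dist (f (T k x)) (f (T' x))))) \<longlonglongrightarrow> 0 + 0"
    using F(3) weak_conv_maps_comp[OF T F(2)] unfolding conv_meas_def by (rule tendsto_add)
  then show "(\<lambda>k. (LINT x|M. min 1 (dist (F k x) (f x))) + (LINT x|M. min 1 (dist (f (T k x)) (f (T' x))))) \<longlonglongrightarrow> 0"
    by simp
qed simp

end

lemma borel_action_measurable: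
  assumes act: "borel_action M act" and f: "f \<in> borel_measurable M"
  shows "(\<lambda>x. act (f x) x) \<in> measurable M M"
proof -
  have actm: "(\<lambda>(g, x). act g x) \<in> measurable (borel \<Otimes>\<^sub>M M) M"
    using act by (simp add: borel_action_def)
  have "(\<lambda>x. (f x, x)) \<in> measurable M (borel \<Otimes>\<^sub>M M)" by (intro measurable_Pair f measurable_ident_sets refl)
  from measurable_compose[OF this actm] show ?thesis by simp
qed

text \<open>The good events form a sigma-algebra containing the orbit-open sets; these separate points, so
  \<open>left_inverse_AE\<close> recovers every measurable set from them up to a null set.\<close>

lemma weak_conv_maps_act:
  fixes M :: "'x measure"
    and act :: "'g::{polish_space,topological_group_add} \<Rightarrow> 'x \<Rightarrow> 'x"
  assumes M: "standard_borel M" "prob_space M" and act: "borel_action M act"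
    and f: "\<And>k. f k \<in> borel_measurable M" "f' \<in> borel_measurable M" "conv_meas M f f'"
    and mp: "\<And>k. mpres M (\<lambda>x. act (f k x) x)" "mpres M (\<lambda>x. act (f' x) x)"
  shows "weak_conv_maps M (\<lambda>k x. act (f k x) x) (\<lambda>x. act (f' x) x)"
proof -
  interpret prob_space M by fact
  define T where "T k x = act (f k x) x" for k x
  define T' where "T' x = act (f' x) x" for x
  have T: "mpres M (T k)" "mpres M T'" for k using mp by (simp_all add: T_def[abs_def] T'_def[abs_def])
  define \<A> where "\<A> = {A \<in> sets M. conv_meas M (\<lambda>k x. indicator A (T k x) :: real) (\<lambda>x. indicator A (T' x))}"
  interpret \<A>: sigma_algebra "space M" \<A> unfolding \<A>_def by (rule sigma_algebra_indicator_conv[OF T])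
  obtain B :: "nat \<Rightarrow> 'x set" where B: "\<And>n. B n \<in> sets M"
    "\<And>x y. x \<in> space M \<Longrightarrow> y \<in> space M \<Longrightarrow> x \<noteq> y \<Longrightarrow> \<exists>n. x \<in> B n \<and> y \<notin> B n"
    using separating_sets[OF M(1) not_empty] by blast
  obtain Q :: "nat \<Rightarrow> 'x set" where Q: "\<And>n. Q n \<in> sets M"
    and Qopen: "\<And>n x. x \<in> space M \<Longrightarrow> open {g. act g x \<in> Q n}"
    and Qsep: "\<And>x y. x \<in> space M \<Longrightarrow> y \<in> space M \<Longrightarrow> x \<noteq> y \<Longrightarrow> \<exists>n. x \<in> Q n \<and> y \<notin> Q n"
    by (rule orbit_open_separating[OF act B]) auto
  have Q\<A>: "Q n \<in> \<A>" for n
  proof -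
    have "conv_meas M (\<lambda>k x. indicator (Q n) (T k x) :: real) (\<lambda>x. indicator (Q n) (T' x))"
    proof (rule conv_meas_indicatorI[OF T Q])
      fix s :: "nat \<Rightarrow> nat" assume s: "strict_mono s"
      obtain r where r: "strict_mono r" "AE x in M. (\<lambda>k. f (s (r k)) x) \<longlonglongrightarrow> f' x"
        using conv_meas_AE_subseq[OF f(1,2) conv_meas_subseq[OF f(3) s]] by blast
      from r(2) have "AE x in M. T' x \<in> Q n \<longrightarrow> (\<forall>\<^sub>F k in sequentially. T (s (r k)) x \<in> Q n)"
      proof (rule AE_mp, intro AE_I2 impI)
        fix x assume x: "x \<in> space M" "(\<lambda>k. f (s (r k)) x) \<longlonglongrightarrow> f' x" "T' x \<in> Q n"
        have "f' x \<in> {g. act g x \<in> Q n}" using x(3) by (simp add: T'_def)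
        from topological_tendstoD[OF x(2) Qopen[OF x(1)] this]
        show "\<forall>\<^sub>F k in sequentially. T (s (r k)) x \<in> Q n" by (simp add: T_def)
      qed
      with r(1) show "\<exists>r. strict_mono r \<and> (AE x in M. T' x \<in> Q n \<longrightarrow> (\<forall>\<^sub>F k in sequentially. T (s (r k)) x \<in> Q n))"
        by blast
    qed
    with Q show ?thesis by (simp add: \<A>_def)
  qed
  define h where "h x = (\<lambda>n. indicator (Q n) x :: real)" for x
  have hm: "h \<in> borel_measurable N" if "space N = space M" "\<And>n. Q n \<in> sets N" for N
  proof (rule measurable_coordinatewise_then_product)
    show "(\<lambda>x. h x i) \<in> borel_measurable N" for i
      unfolding h_def using that(2) by (intro borel_measurable_indicator)
  qed
  have hM: "h \<in> borel_measurable M" using Q by (intro hm) auto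
  have h\<A>: "h -` C \<inter> space M \<in> \<A>" if "C \<in> sets borel" for C
  proof -
    let ?N = "sigma (space M) \<A>"
    have sN: "sets ?N = \<A>" by (rule \<A>.sets_measure_of_eq)
    have "h \<in> borel_measurable ?N" using Q\<A> sN \<A>.space_closed by (intro hm) (auto simp: space_measure_of)
    from measurable_sets[OF this that] show ?thesis
      using sN \<A>.space_closed by (simp add: space_measure_of)
  qed
  have inj: "inj_on h (space M)"
  proof (rule inj_onI, rule ccontr)
    fix x y assume xy: "x \<in> space M" "y \<in> space M" "h x = h y" "x \<noteq> y"
    from Qsep[OF xy(1,2,4)] obtain n where "x \<in> Q n" "y \<notin> Q n" by blast
    then have "h x n \<noteq> h y n" by (simp add: h_def)
    with xy(3) show False by simp
  qed
  obtain r where r: "r \<in> measurable borel M" "AE x in M. r (h x) = x"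
    using left_inverse_AE[OF M hM inj] by blast
  have "conv_meas M (\<lambda>k x. indicator A (T k x) :: real) (\<lambda>x. indicator A (T' x))" if A: "A \<in> sets M" for A
  proof -
    define A' where "A' = h -` (r -` A \<inter> space borel) \<inter> space M"
    have A': "A' \<in> \<A>" unfolding A'_def by (rule h\<A>[OF measurable_sets[OF r(1) A]])
    have "AE x in M. x \<in> A' \<longleftrightarrow> x \<in> A"
      using r(2) by (rule AE_mp) (auto simp: A'_def intro!: AE_I2)
    then have ae: "AE x in M. T k x \<in> A' \<longleftrightarrow> T k x \<in> A" "AE x in M. T' x \<in> A' \<longleftrightarrow> T' x \<in> A" for k
      using mpres_AE[OF T(1)] mpres_AE[OF T(2)] by blast+
    note [measurable] = mpresD[OF T(1)] mpresD[OF T(2)] A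
    have [measurable]: "A' \<in> sets M" using A' by (simp add: \<A>_def)
    have "(LINT x|M. min 1 (dist (indicator A (T k x) :: real) (indicator A (T' x))))
       = (LINT x|M. min 1 (dist (indicator A' (T k x) :: real) (indicator A' (T' x))))" for k
    proof (rule integral_cong_AE)
      show "AE x in M. min 1 (dist (indicator A (T k x) :: real) (indicator A (T' x)))
        = min 1 (dist (indicator A' (T k x) :: real) (indicator A' (T' x)))"
        using ae(1)[of k] ae(2) by eventually_elim (auto simp: indicator_def)
    qed measurable
    then show ?thesis using A' by (simp add: \<A>_def conv_meas_def)
  qed
  then show ?thesis unfolding weak_conv_maps_def T_def T'_def by blast
qed

section \<open>Iterates of measure-preserving maps\<close>

lemma mp_bijections_mpres: "T \<in> mp_bijections M \<Longrightarrow> mpres M T"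
  by (simp add: mp_bijections_def mpres_def)

lemma mpres_funpow: "mpres M T \<Longrightarrow> mpres M (T ^^ n)"
proof (induction n)
  case 0
  then show ?case by (simp add: mpres_ident id_def)
next
  case (Suc n)
  from mpres_compose[OF Suc(2) Suc(1)[OF Suc(2)]] show ?case by (simp add: o_def)
qed

lemma mpres_emeasure:
  assumes "mpres M T" "A \<in> sets M"
  shows "emeasure M {x \<in> space M. T x \<in> A} = emeasure M A"
proof -
  have "emeasure M A = emeasure (distr M M T) A" using assms by (simp add: mpres_def)
  also have "\<dots> = emeasure M (T -` A \<inter> space M)" using assms by (intro emeasure_distr mpresD)
  also have "T -` A \<inter> space M = {x \<in> space M. T x \<in> A}" by auto
  finally show ?thesis ..
qed

lemma funpow_in_space:
  "T \<in> measurable M M \<Longrightarrow> x \<in> space M \<Longrightarrow> (T ^^ n) x \<in> space M"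
  by (induction n) (auto dest: measurable_space)

lemma measurable_funpow: "T \<in> measurable M M \<Longrightarrow> T ^^ n \<in> measurable M M"
  by (induction n) (auto intro: measurable_comp)

section \<open>Recurrence and induced transformations\<close>

text \<open>Return time \<open>0\<close> marks the points outside \<open>A\<close> and those that never return; the induced map fixes them.\<close>

definition return_time :: "'x set \<Rightarrow> ('x \<Rightarrow> 'x) \<Rightarrow> 'x \<Rightarrow> nat" where
  "return_time A T x = (if x \<in> A \<and> (\<exists>n>0. (T ^^ n) x \<in> A) then LEAST n. 0 < n \<and> (T ^^ n) x \<in> A else 0)"

definition induced_map :: "'x set \<Rightarrow> ('x \<Rightarrow> 'x) \<Rightarrow> 'x \<Rightarrow> 'x" where
  "induced_map A T x = (T ^^ return_time A T x) x"

text \<open>The group need not be commutative: the newest increment is added on the left, matching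
  the action law, so that the cocycle of length \<open>n\<close> acts as the \<open>n\<close>-th
  iterate.\<close>

primrec cocycle :: "('x \<Rightarrow> 'g::monoid_add) \<Rightarrow> ('x \<Rightarrow> 'x) \<Rightarrow> nat \<Rightarrow> 'x \<Rightarrow> 'g" where
  "cocycle f T 0 x = 0"
| "cocycle f T (Suc n) x = f ((T ^^ n) x) + cocycle f T n x"

definition induced_cocycle :: "'x set \<Rightarrow> ('x \<Rightarrow> 'g::monoid_add) \<Rightarrow> ('x \<Rightarrow> 'x) \<Rightarrow> 'x \<Rightarrow> 'g" where
  "induced_cocycle A f T x = cocycle f T (return_time A T x) x"

lemma return_time_eqI:
  assumes "x \<in> A" "0 < N" "(T ^^ N) x \<in> A" "\<And>m. 0 < m \<Longrightarrow> m < N \<Longrightarrow> (T ^^ m) x \<notin> A"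
  shows "return_time A T x = N"
proof -
  have "(LEAST n. 0 < n \<and> (T ^^ n) x \<in> A) = N"
    using assms by (intro Least_equality) (auto simp: not_less[symmetric])
  then show ?thesis using assms unfolding return_time_def by auto
qed

lemma return_timeD:
  assumes "x \<in> A" "0 < n" "(T ^^ n) x \<in> A"
  shows "0 < return_time A T x" "(T ^^ return_time A T x) x \<in> A"
    "\<And>m. 0 < m \<Longrightarrow> m < return_time A T x \<Longrightarrow> (T ^^ m) x \<notin> A"
proof -
  let ?P = "\<lambda>n. 0 < n \<and> (T ^^ n) x \<in> A"
  have "x \<in> A \<and> (\<exists>n>0. (T ^^ n) x \<in> A)" using assms by blast
  then have eq: "return_time A T x = (LEAST n. ?P n)" unfolding return_time_def by (rule if_P)
  have "?P (LEAST n. ?P n)" using assms by (intro LeastI[of ?P n]) auto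
  then show "0 < return_time A T x" "(T ^^ return_time A T x) x \<in> A" by (simp_all add: eq)
  show "(T ^^ m) x \<notin> A" if "0 < m" "m < return_time A T x" for m
    using not_less_Least[of m ?P] that by (simp add: eq)
qed

lemma return_time_outside: "x \<notin> A \<Longrightarrow> return_time A T x = 0"
  by (simp add: return_time_def)

lemma return_time_cong:
  assumes "\<And>n. (T ^^ n) x \<in> A \<longleftrightarrow> (S ^^ n) x \<in> B"
  shows "return_time A T x = return_time B S x"
proof -
  have "x \<in> A \<longleftrightarrow> x \<in> B" using assms[of 0] by simp
  then show ?thesis by (simp only: return_time_def assms)
qed

lemma return_time_measurable:
  assumes T: "T \<in> measurable M M" and A: "A \<in> sets M"
  shows "return_time A T \<in> measurable M (count_space UNIV)"
proof -
  note [measurable] = measurable_funpow[OF T] A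
  show ?thesis unfolding return_time_def[abs_def] by measurable
qed

lemma induced_map_measurable:
  assumes T: "T \<in> measurable M M" and A: "A \<in> sets M"
  shows "induced_map A T \<in> measurable M M"
  unfolding induced_map_def[abs_def]
  by (rule measurable_compose_countable[OF measurable_funpow[OF T] return_time_measurable[OF T A]])

lemma cocycle_measurable:
  fixes f :: "'x \<Rightarrow> 'g::{polish_space,topological_monoid_add}"
  assumes T: "T \<in> measurable M M" and f: "f \<in> borel_measurable M"
  shows "cocycle f T n \<in> borel_measurable M"
proof (induction n)
  case 0
  have "cocycle f T 0 = (\<lambda>x. 0)" by (simp add: fun_eq_iff)
  then show ?case by simp
next
  case (Suc n)
  have "(\<lambda>x. f ((T ^^ n) x) + cocycle f T n x) \<in> borel_measurable M"
    by (rule borel_measurable_continuous_Pair[OF measurable_compose[OF measurable_funpow[OF T] f] Suc])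
      (intro continuous_intros)
  moreover have "cocycle f T (Suc n) = (\<lambda>x. f ((T ^^ n) x) + cocycle f T n x)" by (simp add: fun_eq_iff)
  ultimately show ?case by simp
qed

lemma induced_cocycle_measurable:
  fixes f :: "'x \<Rightarrow> 'g::{polish_space,topological_monoid_add}"
  assumes T: "T \<in> measurable M M" and f: "f \<in> borel_measurable M" and A: "A \<in> sets M"
  shows "induced_cocycle A f T \<in> borel_measurable M"
  unfolding induced_cocycle_def[abs_def]
  by (rule measurable_compose_countable[OF cocycle_measurable[OF T f] return_time_measurable[OF T A]])

lemma act_cocycle:
  assumes act: "borel_action M act" and f: "f \<in> borel_measurable M" and x: "x \<in> space M"
  shows "act (cocycle f (\<lambda>x. act (f x) x) n x) x = ((\<lambda>x. act (f x) x) ^^ n) x"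
proof (induction n)
  case 0
  then show ?case using act x by (simp add: borel_action_def)
next
  case (Suc n)
  let ?T = "\<lambda>x. act (f x) x"
  have "act (cocycle f ?T (Suc n) x) x = act (f ((?T ^^ n) x)) (act (cocycle f ?T n x) x)"
    using act x by (simp add: borel_action_def)
  also have "\<dots> = (?T ^^ Suc n) x" by (simp add: Suc)
  finally show ?case .
qed

lemma act_induced_cocycle:
  assumes act: "borel_action M act" and f: "f \<in> borel_measurable M" and x: "x \<in> space M"
  shows "act (induced_cocycle A f (\<lambda>x. act (f x) x) x) x = induced_map A (\<lambda>x. act (f x) x) x"
  unfolding induced_cocycle_def induced_map_def by (rule act_cocycle[OF assms])

text \<open>The exceptional null set has to be avoided along a whole orbit; its preimages under the
  iterates of \<open>S\<close> are null because these preserve the measure.\<close>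

lemma AE_funpow_eq:
  assumes "mpres M S" "mpres M T" "AE x in M. T x = S x"
  shows "AE x in M. \<forall>n. (T ^^ n) x = (S ^^ n) x"
  unfolding AE_all_countable
proof
  fix n
  show "AE x in M. (T ^^ n) x = (S ^^ n) x"
  proof (induction n)
    case (Suc n)
    from Suc mpres_AE[OF mpres_funpow[OF assms(1)] assms(3)] show ?case
      by eventually_elim simp
  qed simp
qed

lemma induced_map_cong_AE:
  assumes "mpres M S" "mpres M T" "AE x in M. T x = S x"
  shows "AE x in M. induced_map A T x = induced_map A S x"
  using AE_funpow_eq[OF assms]
proof eventually_elim
  fix x assume x: "\<forall>n. (T ^^ n) x = (S ^^ n) x"
  then have "return_time A T x = return_time A S x" by (intro return_time_cong) simp
  with x show "induced_map A T x = induced_map A S x" by (simp add: induced_map_def)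
qed

context prob_space
begin

text \<open>The points of \<open>A\<close> that never return form a set whose preimages under the
  iterates are disjoint and of equal measure, hence null in a probability space. Recurrence is
  asserted at every visit of the orbit so that it can be iterated.\<close>

lemma Poincare_recurrence:
  assumes T: "mpres M T" and A: "A \<in> sets M"
  shows "AE x in M. \<forall>k. (T ^^ k) x \<in> A \<longrightarrow> (\<exists>n>0. (T ^^ n) ((T ^^ k) x) \<in> A)"
proof -
  note [measurable] = measurable_funpow[OF mpresD[OF T]] A
  define B where "B = {x \<in> space M. x \<in> A \<and> (\<forall>n. 0 < n \<longrightarrow> (T ^^ n) x \<notin> A)}"
  have B [measurable]: "B \<in> sets M" unfolding B_def by measurable
  define C where "C n = {x \<in> space M. (T ^^ n) x \<in> B}" for n
  have C: "C n \<in> sets M" for n unfolding C_def by measurable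
  have prob_C: "prob (C n) = prob B" for n
    using mpres_emeasure[OF mpres_funpow[OF T] B] unfolding C_def by (simp add: measure_def)
  have disj: "C n \<inter> C m = {}" if "n < m" for n m
  proof (rule ccontr)
    assume "C n \<inter> C m \<noteq> {}"
    then obtain x where x: "(T ^^ n) x \<in> B" "(T ^^ m) x \<in> B" by (auto simp: C_def)
    have "(T ^^ (m - n)) ((T ^^ n) x) = (T ^^ m) x" using that by (simp add: funpow_add[THEN fun_cong, unfolded o_def, symmetric])
    then show False using x that unfolding B_def by (metis (no_types, lifting) mem_Collect_eq zero_less_diff)
  qed
  have "disjoint_family C" unfolding disjoint_family_on_def
    using disj by (metis Int_commute linorder_neqE_nat)
  then have "(\<lambda>n. prob (C n)) sums prob (\<Union>n. C n)" using C by (intro finite_measure_UNION) auto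
  then have "(\<lambda>n. prob B) sums prob (\<Union>n. C n)" by (simp add: prob_C)
  then have "(\<lambda>n. prob B) \<longlonglongrightarrow> 0" by (intro summable_LIMSEQ_zero sums_summable)
  then have "prob B = 0" by (simp add: LIMSEQ_const_iff)
  then have "AE x in M. x \<notin> B" using B by (intro AE_not_in) (simp add: null_sets_def emeasure_eq_measure)
  then have "AE x in M. (T ^^ k) x \<notin> B" for k by (rule mpres_AE[OF mpres_funpow[OF T]])
  then have "AE x in M. \<forall>k. (T ^^ k) x \<notin> B" by (simp add: AE_all_countable)
  then show ?thesis
  proof (rule AE_mp, intro AE_I2 impI allI)
    fix x k assume x: "x \<in> space M" "\<forall>k. (T ^^ k) x \<notin> B" "(T ^^ k) x \<in> A"
    have "(T ^^ k) x \<in> space M" by (rule funpow_in_space[OF mpresD[OF T] x(1)])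
    moreover have "(T ^^ k) x \<notin> B" using x(2) by blast
    ultimately show "\<exists>n>0. (T ^^ n) ((T ^^ k) x) \<in> A" using x(3) unfolding B_def by blast
  qed
qed

lemma infinite_recurrence:
  assumes T: "mpres M T" and A: "A \<in> sets M"
  shows "AE x in M. x \<in> A \<longrightarrow> (\<forall>N. \<exists>n\<ge>N. (T ^^ n) x \<in> A)"
  using Poincare_recurrence[OF assms]
proof (eventually_elim, intro impI allI)
  fix x N assume x: "\<forall>k. (T ^^ k) x \<in> A \<longrightarrow> (\<exists>n>0. (T ^^ n) ((T ^^ k) x) \<in> A)" "x \<in> A"
  show "\<exists>n\<ge>N. (T ^^ n) x \<in> A"
  proof (induction N)
    case 0
    show ?case using x(2) by (intro exI[of _ 0]) simp
  next
    case (Suc N)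
    then obtain k where k: "k \<ge> N" "(T ^^ k) x \<in> A" by blast
    with x(1) obtain n where n: "n > 0" "(T ^^ n) ((T ^^ k) x) \<in> A" by blast
    then have "(T ^^ (n + k)) x \<in> A" by (simp add: funpow_add)
    then show ?case using k n by (intro exI[of _ "n + k"]) simp
  qed
qed

end

section \<open>Continuity of the induced cocycle in measure\<close>

lemma conv_meas_cong:
  assumes "\<And>k x. x \<in> space M \<Longrightarrow> F k x = G k x" "\<And>x. x \<in> space M \<Longrightarrow> f x = g x"
  shows "conv_meas M F f \<longleftrightarrow> conv_meas M G g"
proof -
  have "(LINT x|M. min 1 (dist (F k x) (f x))) = (LINT x|M. min 1 (dist (G k x) (g x)))" for k
    using assms by (intro Bochner_Integration.integral_cong) auto
  then show ?thesis by (simp add: conv_meas_def)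
qed

text \<open>The two claims feed each other. The cocycle of length \<open>n\<close> is itself a
  group-valued function that induces the \<open>n\<close>-th iterate, so its convergence in measure
  gives weak convergence of the iterates by \<open>weak_conv_maps_act\<close>. This in turn makes
  the next increment \<open>f k ((T k ^^ n) x)\<close> converge.\<close>

lemma conv_meas_cocycle:
  fixes M :: "'x measure"
    and act :: "'g::{polish_space,topological_group_add} \<Rightarrow> 'x \<Rightarrow> 'x"
  assumes M: "standard_borel M" "prob_space M" and act: "borel_action M act"
    and f: "\<And>k. f k \<in> borel_measurable M" "f' \<in> borel_measurable M" "conv_meas M f f'"
    and mp: "\<And>k. mpres M (\<lambda>x. act (f k x) x)" "mpres M (\<lambda>x. act (f' x) x)"
  shows "conv_meas M (\<lambda>k. cocycle (f k) (\<lambda>x. act (f k x) x) n) (cocycle f' (\<lambda>x. act (f' x) x) n) \<and>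
    weak_conv_maps M (\<lambda>k. (\<lambda>x. act (f k x) x) ^^ n) ((\<lambda>x. act (f' x) x) ^^ n)"
proof -
  interpret prob_space M by fact
  define T where "T k x = act (f k x) x" for k x
  define T' where "T' x = act (f' x) x" for x
  have T: "mpres M (T k)" "mpres M T'" for k using mp by (simp_all add: T_def[abs_def] T'_def[abs_def])
  have Tm: "T k \<in> measurable M M" "T' \<in> measurable M M" for k using T by (auto dest: mpresD)
  have ac: "act (cocycle (f k) (T k) n x) x = (T k ^^ n) x" "act (cocycle f' T' n x) x = (T' ^^ n) x"
    if "x \<in> space M" for k n x
    using act_cocycle[OF act f(1) that] act_cocycle[OF act f(2) that] by (simp_all add: T_def[abs_def] T'_def[abs_def])
  have cm: "cocycle (f k) (T k) n \<in> borel_measurable M" "cocycle f' T' n \<in> borel_measurable M" for k n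
    using cocycle_measurable Tm f by blast+
  have weak: "weak_conv_maps M (\<lambda>k. T k ^^ n) (T' ^^ n)"
    if c: "conv_meas M (\<lambda>k. cocycle (f k) (T k) n) (cocycle f' T' n)" for n
  proof -
    have "mpres M (\<lambda>x. act (cocycle (f k) (T k) n x) x)" for k
      using ac(1) by (intro mpres_cong_AE[OF mpres_funpow[OF T(1), of n k] borel_action_measurable[OF act cm(1)]] AE_I2)
    moreover have "mpres M (\<lambda>x. act (cocycle f' T' n x) x)"
      using ac(2) by (intro mpres_cong_AE[OF mpres_funpow[OF T(2), of n] borel_action_measurable[OF act cm(2)]] AE_I2)
    ultimately have "weak_conv_maps M (\<lambda>k x. act (cocycle (f k) (T k) n x) x) (\<lambda>x. act (cocycle f' T' n x) x)"
      by (rule weak_conv_maps_act[OF M act cm(1) cm(2) c])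
    moreover have "conv_meas M (\<lambda>k x. indicator A (act (cocycle (f k) (T k) n x) x) :: real) (\<lambda>x. indicator A (act (cocycle f' T' n x) x))
        \<longleftrightarrow> conv_meas M (\<lambda>k x. indicator A ((T k ^^ n) x) :: real) (\<lambda>x. indicator A ((T' ^^ n) x))" for A
      by (rule conv_meas_cong) (simp_all add: ac)
    ultimately show ?thesis unfolding weak_conv_maps_def by simp
  qed
  have "conv_meas M (\<lambda>k. cocycle (f k) (T k) n) (cocycle f' T' n)"
  proof (induction n)
    case 0
    then show ?case by (simp add: conv_meas_def)
  next
    case (Suc n)
    have "conv_meas M (\<lambda>k x. f k ((T k ^^ n) x)) (\<lambda>x. f' ((T' ^^ n) x))"
      by (rule conv_meas_comp[OF mpres_funpow[OF T(1)] mpres_funpow[OF T(2)] weak[OF Suc] f])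
    from conv_meas_add[OF _ _ this cm(1) cm(2) Suc]
    have "conv_meas M (\<lambda>k x. f k ((T k ^^ n) x) + cocycle (f k) (T k) n x) (\<lambda>x. f' ((T' ^^ n) x) + cocycle f' T' n x)"
      using measurable_compose[OF measurable_funpow[OF Tm(1)] f(1)] measurable_compose[OF measurable_funpow[OF Tm(2)] f(2)]
      by simp
    moreover have "cocycle (f k) (T k) (Suc n) = (\<lambda>x. f k ((T k ^^ n) x) + cocycle (f k) (T k) n x)"
      "cocycle f' T' (Suc n) = (\<lambda>x. f' ((T' ^^ n) x) + cocycle f' T' n x)" for k by (simp_all add: fun_eq_iff)
    ultimately show ?case by simp
  qed
  with weak show ?thesis by (simp add: T_def[abs_def] T'_def[abs_def])
qed

text \<open>By recurrence of the limit map almost every point of \<open>A'\<close> returns after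
  some finite number \<open>N\<close> of steps, and the memberships at times 0 to \<open>N\<close>
  already determine the return time. Along a subsequence these agree eventually, so the
  approximating cocycles are stopped at the same \<open>N\<close>, where convergence is
  known.\<close>

lemma conv_meas_induced_cocycle:
  fixes M :: "'x measure"
    and act :: "'g::{polish_space,topological_group_add} \<Rightarrow> 'x \<Rightarrow> 'x"
  assumes M: "standard_borel M" "prob_space M" and act: "borel_action M act"
    and f: "\<And>k. f k \<in> borel_measurable M" "f' \<in> borel_measurable M" "conv_meas M f f'"
    and mp: "\<And>k. mpres M (\<lambda>x. act (f k x) x)" "mpres M (\<lambda>x. act (f' x) x)"
    and A: "\<And>k. A k \<in> sets M" "A' \<in> sets M"
      "conv_meas M (\<lambda>k x. indicator (A k) x :: real) (\<lambda>x. indicator A' x)"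
  shows "conv_meas M (\<lambda>k. induced_cocycle (A k) (f k) (\<lambda>x. act (f k x) x))
    (induced_cocycle A' f' (\<lambda>x. act (f' x) x))"
proof -
  interpret prob_space M by fact
  define T where "T k x = act (f k x) x" for k x
  define T' where "T' x = act (f' x) x" for x
  have T: "mpres M (T k)" "mpres M T'" for k using mp by (simp_all add: T_def[abs_def] T'_def[abs_def])
  have Tm: "T k \<in> measurable M M" "T' \<in> measurable M M" for k using T by (auto dest: mpresD)
  have coc: "conv_meas M (\<lambda>k. cocycle (f k) (T k) n) (cocycle f' T' n)"
    and weak: "weak_conv_maps M (\<lambda>k. T k ^^ n) (T' ^^ n)" for n
    using conv_meas_cocycle[OF M act f mp, of n] by (simp_all add: T_def[abs_def] T'_def[abs_def])
  have cm: "cocycle (f k) (T k) n \<in> borel_measurable M" "cocycle f' T' n \<in> borel_measurable M" for k n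
    using cocycle_measurable Tm f by blast+
  have Am: "(\<lambda>x. indicator (A k) x :: real) \<in> borel_measurable M" "(\<lambda>x. indicator A' x :: real) \<in> borel_measurable M" for k
    using A by (auto intro: borel_measurable_indicator)
  have ind: "conv_meas M (\<lambda>k x. indicator (A k) ((T k ^^ n) x) :: real) (\<lambda>x. indicator A' ((T' ^^ n) x))" for n
    by (rule conv_meas_comp[OF mpres_funpow[OF T(1)] mpres_funpow[OF T(2)] weak Am A(3)])
  have im: "(\<lambda>x. indicator (A k) ((T k ^^ n) x) :: real) \<in> borel_measurable M"
    "(\<lambda>x. indicator A' ((T' ^^ n) x) :: real) \<in> borel_measurable M" for k n
    using measurable_compose[OF measurable_funpow[OF Tm(1)] Am(1)] measurable_compose[OF measurable_funpow[OF Tm(2)] Am(2)]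
    by simp_all
  have "conv_meas M (\<lambda>k. induced_cocycle (A k) (f k) (T k)) (induced_cocycle A' f' T')"
  proof (rule conv_measI_AE)
    show "induced_cocycle (A k) (f k) (T k) \<in> borel_measurable M" for k
      by (rule induced_cocycle_measurable[OF Tm(1) f(1) A(1)])
    show "induced_cocycle A' f' T' \<in> borel_measurable M"
      by (rule induced_cocycle_measurable[OF Tm(2) f(2) A(2)])
    fix s :: "nat \<Rightarrow> nat" assume s: "strict_mono s"
    obtain r where r: "strict_mono r"
      and rc: "AE x in M. \<forall>n. (\<lambda>k. cocycle (f (s (r k))) (T (s (r k))) n x) \<longlonglongrightarrow> cocycle f' T' n x"
      using conv_meas_AE_subseq_all[where F = "\<lambda>n k. cocycle (f (s k)) (T (s k)) n", OF cm conv_meas_subseq[OF coc s]]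
      by (elim exE conjE)
    have sr: "strict_mono (\<lambda>k. s (r k))" using strict_mono_o[OF s r] by (simp add: o_def)
    obtain q where q: "strict_mono q"
      and qi: "AE x in M. \<forall>n. (\<lambda>k. indicator (A (s (r (q k)))) ((T (s (r (q k))) ^^ n) x) :: real)
        \<longlonglongrightarrow> indicator A' ((T' ^^ n) x)"
      using conv_meas_AE_subseq_all[where F = "\<lambda>n k x. indicator (A (s (r k))) ((T (s (r k)) ^^ n) x) :: real",
          OF im conv_meas_subseq[OF ind sr]]
      by (elim exE conjE)
    define p where "p k = s (r (q k))" for k
    have "AE x in M. (\<lambda>k. induced_cocycle (A (p k)) (f (p k)) (T (p k)) x) \<longlonglongrightarrow> induced_cocycle A' f' T' x"
      using rc qi Poincare_recurrence[OF T(2) A(2)]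
    proof eventually_elim
      fix x
      assume rx: "\<forall>n. (\<lambda>k. cocycle (f (s (r k))) (T (s (r k))) n x) \<longlonglongrightarrow> cocycle f' T' n x"
        and qx: "\<forall>n. (\<lambda>k. indicator (A (s (r (q k)))) ((T (s (r (q k))) ^^ n) x) :: real) \<longlonglongrightarrow> indicator A' ((T' ^^ n) x)"
        and rec: "\<forall>k. (T' ^^ k) x \<in> A' \<longrightarrow> (\<exists>n>0. (T' ^^ n) ((T' ^^ k) x) \<in> A')"
      have cx: "(\<lambda>k. cocycle (f (p k)) (T (p k)) n x) \<longlonglongrightarrow> cocycle f' T' n x" for n
        using LIMSEQ_subseq_LIMSEQ[OF rx[rule_format, of n] q] by (simp add: o_def p_def)
      have ix: "\<forall>\<^sub>F k in sequentially. (T (p k) ^^ n) x \<in> A (p k) \<longleftrightarrow> (T' ^^ n) x \<in> A'" for n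
        using qx[rule_format, of n] by (simp add: tendsto_indicator_iff p_def)
      define N where "N = return_time A' T' x"
      have "\<forall>\<^sub>F k in sequentially. return_time (A (p k)) (T (p k)) x = N"
      proof (cases "x \<in> A'")
        case False
        then have N0: "N = 0" by (simp add: N_def return_time_outside)
        from ix[of 0] show ?thesis
          by eventually_elim (use False in \<open>simp add: N0 return_time_outside\<close>)
      next
        case True
        then obtain n where n: "n > 0" "(T' ^^ n) x \<in> A'" using rec[rule_format, of 0] by auto
        note N = return_timeD[OF True n, folded N_def]
        have "\<forall>\<^sub>F k in sequentially. \<forall>m\<in>{..N}. (T (p k) ^^ m) x \<in> A (p k) \<longleftrightarrow> (T' ^^ m) x \<in> A'"
          by (intro eventually_ball_finite ballI ix) simp
        then show ?thesis
        proof eventually_elim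
          fix k assume k: "\<forall>m\<in>{..N}. (T (p k) ^^ m) x \<in> A (p k) \<longleftrightarrow> (T' ^^ m) x \<in> A'"
          show "return_time (A (p k)) (T (p k)) x = N"
          proof (rule return_time_eqI)
            show "x \<in> A (p k)" using k[rule_format, of 0] True by simp
            show "(T (p k) ^^ N) x \<in> A (p k)" using k[rule_format, of N] N(2) by simp
            show "(T (p k) ^^ m) x \<notin> A (p k)" if "0 < m" "m < N" for m
              using k[rule_format, of m] N(3)[OF that] that by simp
          qed (rule N(1))
        qed
      qed
      then have "\<forall>\<^sub>F k in sequentially. cocycle (f (p k)) (T (p k)) N x = induced_cocycle (A (p k)) (f (p k)) (T (p k)) x"
        by eventually_elim (simp add: induced_cocycle_def)
      from Lim_transform_eventually[OF cx[of N] this]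
      show "(\<lambda>k. induced_cocycle (A (p k)) (f (p k)) (T (p k)) x) \<longlonglongrightarrow> induced_cocycle A' f' T' x"
        by (simp add: induced_cocycle_def N_def)
    qed
    then show "\<exists>r. strict_mono r \<and> (AE x in M. (\<lambda>k. induced_cocycle (A (s (r k))) (f (s (r k))) (T (s (r k))) x)
        \<longlonglongrightarrow> induced_cocycle A' f' T' x)"
      using strict_mono_o[OF r q] by (intro exI[of _ "r \<circ> q"]) (simp add: p_def)
  qed
  then show ?thesis by (simp add: T_def[abs_def] T'_def[abs_def])
qed

section \<open>Induced transformations of measure-preserving bijections\<close>

text \<open>From \<open>left_inverse_AE\<close> the inverse of \<open>T\<close> is obtained as a
  measurable map only up to a null set. Both maps are kept on a conull set invariant under each of
  them and replaced by the identity elsewhere.\<close>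

lemma bimeasurable_modification:
  fixes M :: "'x measure"
  assumes M: "standard_borel M" "prob_space M" and T: "T \<in> mp_bijections M"
  obtains S S' where "S \<in> measurable M M" "S' \<in> measurable M M"
    "\<And>x. x \<in> space M \<Longrightarrow> S' (S x) = x" "\<And>x. x \<in> space M \<Longrightarrow> S (S' x) = x"
    "AE x in M. S x = T x"
proof -
  interpret prob_space M by fact
  have Tm: "T \<in> measurable M M" and Tb: "bij_betw T (space M) (space M)" and Td: "distr M M T = M"
    using T by (auto simp: mp_bijections_def)
  have Tmp: "mpres M T" by (rule mp_bijections_mpres[OF T])
  obtain e :: "'x \<Rightarrow> nat \<Rightarrow> real" and e' where e: "e \<in> borel_measurable M" and e': "e' \<in> measurable borel M"
    and e'e: "\<And>x. x \<in> space M \<Longrightarrow> e' (e x) = x"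
    by (rule standard_borel_embedding[OF M(1) not_empty]) blast
  have e_inj: "x = y" if "x \<in> space M" "y \<in> space M" "e x = e y" for x y
    using arg_cong[OF that(3), of e'] by (simp only: e'e that(1,2))
  have "inj_on (\<lambda>x. e (T x)) (space M)"
  proof (rule inj_onI)
    fix x y assume xy: "x \<in> space M" "y \<in> space M" "e (T x) = e (T y)"
    then have "T x = T y" by (intro e_inj measurable_space[OF Tm])
    from inj_onD[OF bij_betw_imp_inj_on[OF Tb] this xy(1,2)] show "x = y" .
  qed
  from left_inverse_AE[OF M measurable_compose[OF Tm e] this]
  obtain r where r: "r \<in> measurable borel M" "AE x in M. r (e (T x)) = x" by blast
  define T' where "T' x = r (e x)" for x
  have T'm: "T' \<in> measurable M M" unfolding T'_def[abs_def] by (rule measurable_compose[OF e r(1)])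
  have T'T: "AE x in M. T' (T x) = x" using r(2) by (simp add: T'_def)
  have "distr M M (\<lambda>x. T' (T x)) = distr M M (\<lambda>x. x)"
    by (rule distr_cong_AE) (use T'T measurable_compose[OF Tm T'm] in auto)
  moreover have "distr M M (\<lambda>x. T' (T x)) = distr (distr M M T) M T'"
    by (subst distr_distr[OF T'm Tm]) (simp add: o_def)
  ultimately have T'mp: "mpres M T'" using T'm Td by (simp add: mpres_def distr_id)
  define P where "P = {x \<in> space M. e (T (T' x)) = e x}"
  have P: "P \<in> sets M" unfolding P_def
    by (rule measurable_equality_set[OF measurable_compose[OF measurable_compose[OF T'm Tm] e] e])
  have PD: "T (T' x) = x" if "x \<in> P" for x
    using that by (intro e_inj measurable_space[OF Tm] measurable_space[OF T'm]) (simp_all add: P_def)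
  have "AE x in M. T x \<in> P"
    using T'T by (rule AE_mp) (use measurable_space[OF Tm] in \<open>auto simp: P_def intro!: AE_I2\<close>)
  then have "AE x in distr M M T. x \<in> P" using P by (subst AE_distr_iff[OF Tm]) auto
  then have PAE: "AE x in M. x \<in> P" by (simp only: Td)
  \<comment> \<open>On \<open>P\<close> the map \<open>T'\<close> is a right inverse of
    \<open>T\<close>; points of \<open>Q\<close> keep their forward \<open>T\<close>-orbit in
    \<open>P\<close>, and points of \<open>Y\<close> keep their \<open>T'\<close>-orbit in
    \<open>Q\<close>. This nesting makes \<open>Y\<close> invariant under both: on \<open>Y\<close>
    injectivity of \<open>T\<close> turns the right inverse into a left inverse, so the
    \<open>T'\<close>-orbit of \<open>T x\<close> is \<open>T x\<close> followed by that of
    \<open>x\<close>.\<close>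
  define Q where "Q = {x \<in> space M. \<forall>n. (T ^^ n) x \<in> P}"
  have [measurable]: "T ^^ n \<in> measurable M M" "T' ^^ n \<in> measurable M M" for n
    using measurable_funpow Tm T'm by blast+
  note [measurable] = P
  have Q [measurable]: "Q \<in> sets M" unfolding Q_def by measurable
  have "AE x in M. \<forall>n. (T ^^ n) x \<in> P"
    unfolding AE_all_countable using mpres_AE[OF mpres_funpow[OF Tmp] PAE] by blast
  then have QAE: "AE x in M. x \<in> Q" by (rule AE_mp) (auto simp: Q_def intro!: AE_I2)
  define Y where "Y = {x \<in> space M. \<forall>m. (T' ^^ m) x \<in> Q}"
  have Y [measurable]: "Y \<in> sets M" unfolding Y_def by measurable
  have "AE x in M. \<forall>n. (T' ^^ n) x \<in> Q"
    unfolding AE_all_countable using mpres_AE[OF mpres_funpow[OF T'mp] QAE] by blast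
  then have YAE: "AE x in M. x \<in> Y" by (rule AE_mp) (auto simp: Y_def intro!: AE_I2)
  have YQ: "x \<in> space M" "(T' ^^ m) x \<in> Q" if "x \<in> Y" for x m using that by (auto simp: Y_def)
  have QP: "(T ^^ n) x \<in> P" if "x \<in> Q" for x n using that by (auto simp: Q_def)
  have TT'Y: "T (T' x) = x" if "x \<in> Y" for x
    using PD QP[OF YQ(2)[OF that, of 0], of 0] by simp
  have T'TY: "T' (T x) = x" if "x \<in> Y" for x
  proof -
    have "T x \<in> P" using QP[OF YQ(2)[OF that, of 0], of 1] by simp
    then have "T (T' (T x)) = T x" by (rule PD)
    moreover have "T' (T x) \<in> space M" by (intro measurable_space[OF Tm] measurable_space[OF T'm] YQ(1)[OF that])
    ultimately show ?thesis by (rule inj_onD[OF bij_betw_imp_inj_on[OF Tb] _ _ YQ(1)[OF that]])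
  qed
  have T'Y: "T' x \<in> Y" if "x \<in> Y" for x
  proof -
    have "(T' ^^ m) (T' x) \<in> Q" for m
      using YQ(2)[OF that, of "Suc m"] by (simp add: funpow_swap1)
    then show ?thesis using measurable_space[OF T'm YQ(1)[OF that]] by (simp add: Y_def)
  qed
  have TY: "T x \<in> Y" if "x \<in> Y" for x
  proof -
    have sp: "T x \<in> space M" by (rule measurable_space[OF Tm YQ(1)[OF that]])
    have "(T ^^ n) (T x) \<in> P" for n
      using QP[OF YQ(2)[OF that, of 0], of "Suc n"] by (simp add: funpow_swap1)
    then have "T x \<in> Q" using sp by (simp add: Q_def)
    moreover have "(T' ^^ Suc m) (T x) \<in> Q" for m
      using YQ(2)[OF that, of m] T'TY[OF that] by (simp add: funpow_Suc_right del: funpow.simps)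
    ultimately have "(T' ^^ m) (T x) \<in> Q" for m by (cases m) auto
    then show ?thesis using sp by (simp add: Y_def)
  qed
  show thesis
  proof
    show "(\<lambda>x. if x \<in> Y then T x else x) \<in> measurable M M" using Tm by measurable
    show "(\<lambda>x. if x \<in> Y then T' x else x) \<in> measurable M M" using T'm by measurable
    show "(if (if x \<in> Y then T x else x) \<in> Y then T' (if x \<in> Y then T x else x) else (if x \<in> Y then T x else x)) = x" for x
      using TY T'TY by simp
    show "(if (if x \<in> Y then T' x else x) \<in> Y then T (if x \<in> Y then T' x else x) else (if x \<in> Y then T' x else x)) = x" for x
      using T'Y TT'Y by simp
    show "AE x in M. (if x \<in> Y then T x else x) = T x" using YAE by eventually_elim simp
  qed
qed

lemma funpow_inverse:
  assumes S: "\<And>x. x \<in> X \<Longrightarrow> S x \<in> X" "\<And>x. x \<in> X \<Longrightarrow> S' (S x) = x" and x: "x \<in> X"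
  shows "m \<le> n \<Longrightarrow> (S' ^^ m) ((S ^^ n) x) = (S ^^ (n - m)) x"
proof -
  have X: "(S ^^ n) x \<in> X" for n by (induction n) (auto simp: S x)
  show ?thesis if "m \<le> n"
    using that
  proof (induction m arbitrary: n)
    case (Suc m)
    then obtain n' where n': "n = Suc n'" by (cases n) auto
    have "(S' ^^ Suc m) ((S ^^ n) x) = (S' ^^ m) (S' (S ((S ^^ n') x)))"
      by (simp add: n' funpow_swap1)
    also have "\<dots> = (S' ^^ m) ((S ^^ n') x)" using S(2)[OF X] by simp
    also have "\<dots> = (S ^^ (n' - m)) x" using Suc n' by simp
    finally show ?case by (simp add: n')
  qed simp
qed

text \<open>First returns are symmetric under time reversal: strictly between \<open>x\<close> and
  its first return the orbit avoids \<open>A\<close> whichever way it is read, so \<open>S'\<close>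
  comes back after the same number of steps.\<close>

lemma induced_map_inverse:
  assumes S: "\<And>x. x \<in> X \<Longrightarrow> S x \<in> X" "\<And>x. x \<in> X \<Longrightarrow> S' (S x) = x"
    and rec: "\<And>x. x \<in> A \<Longrightarrow> \<exists>n>0. (S ^^ n) x \<in> A" and x: "x \<in> X"
  shows "induced_map A S' (induced_map A S x) = x"
proof (cases "x \<in> A")
  case False
  then show ?thesis by (simp add: induced_map_def return_time_outside)
next
  case True
  from rec[OF True] obtain n where "n > 0" "(S ^^ n) x \<in> A" by blast
  note N = return_timeD[OF True this]
  define N where "N = return_time A S x"
  have inv: "(S' ^^ m) ((S ^^ N) x) = (S ^^ (N - m)) x" if "m \<le> N" for m
    using funpow_inverse[of X S S', OF S x that] .
  have "return_time A S' ((S ^^ N) x) = N"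
  proof (rule return_time_eqI)
    show "(S ^^ N) x \<in> A" "0 < N" using N by (simp_all add: N_def)
    show "(S' ^^ N) ((S ^^ N) x) \<in> A" using inv[of N] True by simp
    show "(S' ^^ m) ((S ^^ N) x) \<notin> A" if "0 < m" "m < N" for m
      using inv[of m] N(3)[of "N - m"] that by (simp add: N_def)
  qed
  then show ?thesis using inv[of N] by (simp add: induced_map_def N_def[symmetric])
qed

lemma induced_map_in_mp_bijections:
  assumes M: "prob_space M"
    and S: "S \<in> measurable M M" "S' \<in> measurable M M" "mpres M S'"
      "\<And>x. x \<in> space M \<Longrightarrow> S' (S x) = x" "\<And>x. x \<in> space M \<Longrightarrow> S (S' x) = x"
    and A: "A \<in> sets M"
    and rec: "\<And>x. x \<in> A \<Longrightarrow> \<exists>n>0. (S ^^ n) x \<in> A" "\<And>x. x \<in> A \<Longrightarrow> \<exists>n>0. (S' ^^ n) x \<in> A"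
  shows "induced_map A S \<in> mp_bijections M"
proof -
  interpret prob_space M by fact
  define R where "R = induced_map A S"
  define R' where "R' = induced_map A S'"
  have R [measurable]: "R \<in> measurable M M" "R' \<in> measurable M M"
    unfolding R_def R'_def by (intro induced_map_measurable S A)+
  have sp: "S x \<in> space M" "S' x \<in> space M" if "x \<in> space M" for x
    using measurable_space[OF S(1) that] measurable_space[OF S(2) that] by blast+
  have R'R: "R' (R x) = x" if "x \<in> space M" for x unfolding R_def R'_def
    by (rule induced_map_inverse[of "space M" S S' A, OF sp(1) S(4) rec(1) that])
  have RR': "R (R' x) = x" if "x \<in> space M" for x unfolding R_def R'_def
    by (rule induced_map_inverse[of "space M" S' S A, OF sp(2) S(5) rec(2) that])
  have Rsp: "R x \<in> space M" "R' x \<in> space M" if "x \<in> space M" for x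
    using measurable_space[OF R(1) that] measurable_space[OF R(2) that] by blast+
  have Sn: "(S ^^ n) x \<in> space M" "(S' ^^ n) x \<in> space M" if "x \<in> space M" for x n
    by (rule funpow_in_space[OF S(1) that], rule funpow_in_space[OF S(2) that])
  have S'S: "(S' ^^ n) ((S ^^ n) x) = x" if "x \<in> space M" for x n
    using funpow_inverse[of "space M" S S', OF sp(1) S(4) that, of n n] by simp
  have SS': "(S ^^ n) ((S' ^^ n) x) = x" if "x \<in> space M" for x n
    using funpow_inverse[of "space M" S' S, OF sp(2) S(5) that, of n n] by simp
  note [measurable] = measurable_funpow[OF S(1)] measurable_funpow[OF S(2)] return_time_measurable[OF S(1) A]
  have "distr M M R = M"
  proof (rule measure_eqI)
    fix B assume "B \<in> sets (distr M M R)"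
    then have B [measurable]: "B \<in> sets M" by simp
    \<comment> \<open>The preimage of \<open>B\<close> is cut by return time. On \<open>C n\<close>
      the map \<open>R\<close> is the \<open>n\<close>-th power of \<open>S\<close>, which carries
      \<open>C n\<close> onto \<open>D n\<close> and preserves the measure; the sets
      \<open>D n\<close> partition \<open>B\<close>. The index 0 covers the points outside
      \<open>A\<close>, which \<open>R\<close> fixes.\<close>
    define C where "C n = {x \<in> space M. return_time A S x = n \<and> (S ^^ n) x \<in> B}" for n
    define D where "D n = {y \<in> space M. return_time A S (R' y) = n \<and> y \<in> B}" for n
    have C: "C n \<in> sets M" and D: "D n \<in> sets M" for n unfolding C_def D_def by measurable
    have CD: "emeasure M (C n) = emeasure M (D n)" for n
    proof -
      have "emeasure M (C n) = emeasure M {y \<in> space M. (S' ^^ n) y \<in> C n}"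
        by (rule mpres_emeasure[OF mpres_funpow[OF S(3)] C, symmetric])
      also have "{y \<in> space M. (S' ^^ n) y \<in> C n} = D n"
      proof (intro set_eqI iffI)
        fix y assume "y \<in> {y \<in> space M. (S' ^^ n) y \<in> C n}"
        then have y: "y \<in> space M" "return_time A S ((S' ^^ n) y) = n" "y \<in> B"
          using SS' by (auto simp: C_def)
        have "R ((S' ^^ n) y) = y" using y SS' by (simp add: R_def induced_map_def)
        then have "R' y = (S' ^^ n) y" using R'R[OF Sn(2)[OF y(1), of n]] by simp
        with y show "y \<in> D n" by (simp add: D_def)
      next
        fix y assume "y \<in> D n"
        then have y: "y \<in> space M" "return_time A S (R' y) = n" "y \<in> B" by (auto simp: D_def)
        have "(S ^^ n) (R' y) = y" using RR'[OF y(1)] y(2) by (simp add: R_def induced_map_def)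
        then have "(S' ^^ n) y = R' y" using S'S[OF Rsp(2)[OF y(1)], of n] by simp
        with y Sn SS' show "y \<in> {y \<in> space M. (S' ^^ n) y \<in> C n}"
          using Rsp(2)[OF y(1)] by (auto simp: C_def) (metis SS')
      qed
      finally show ?thesis .
    qed
    have "emeasure (distr M M R) B = emeasure M (R -` B \<inter> space M)" by (rule emeasure_distr[OF R(1) B])
    also have "R -` B \<inter> space M = (\<Union>n. C n)" by (auto simp: C_def R_def induced_map_def)
    also have "emeasure M (\<Union>n. C n) = (\<Sum>n. emeasure M (C n))"
      using C by (intro suminf_emeasure[symmetric]) (auto simp: disjoint_family_on_def C_def)
    also have "\<dots> = (\<Sum>n. emeasure M (D n))" by (simp only: CD)
    also have "\<dots> = emeasure M (\<Union>n. D n)"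
      using D by (intro suminf_emeasure) (auto simp: disjoint_family_on_def D_def)
    also have "(\<Union>n. D n) = B" using sets.sets_into_space[OF B] by (auto simp: D_def)
    finally show "emeasure (distr M M R) B = emeasure M B" .
  qed simp
  moreover have "bij_betw R (space M) (space M)"
    using R'R RR' Rsp by (intro bij_betw_byWitness[where f' = R']) auto
  ultimately show ?thesis using R(1) by (simp add: mp_bijections_def R_def)
qed

lemma induced_map_AE_mp_bijection:
  fixes M :: "'x measure"
  assumes M: "standard_borel M" "prob_space M" and T: "T \<in> mp_bijections M" and A: "A \<in> sets M"
  obtains R where "R \<in> mp_bijections M" "AE x in M. induced_map A T x = R x"
proof -
  interpret prob_space M by fact
  obtain S S' where S: "S \<in> measurable M M" "S' \<in> measurable M M"
    and S'S: "\<And>x. x \<in> space M \<Longrightarrow> S' (S x) = x" and SS': "\<And>x. x \<in> space M \<Longrightarrow> S (S' x) = x"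
    and ST: "AE x in M. S x = T x"
    using bimeasurable_modification[OF M T] by blast
  have Tmp: "mpres M T" by (rule mp_bijections_mpres[OF T])
  have Smp: "mpres M S" by (rule mpres_cong_AE[OF Tmp S(1) ST])
  have S'mp: "mpres M S'"
  proof -
    have "distr M M S' = distr (distr M M S) M S'" using Smp by (simp add: mpres_def)
    also have "\<dots> = distr M M (\<lambda>x. S' (S x))" by (subst distr_distr[OF S(2) S(1)]) (simp add: o_def)
    also have "\<dots> = distr M M (\<lambda>x. x)" by (rule distr_cong) (auto simp: S'S)
    finally show ?thesis using S(2) by (simp add: mpres_def distr_id)
  qed
  have sp: "S x \<in> space M" "S' x \<in> space M" if "x \<in> space M" for x
    using measurable_space[OF S(1) that] measurable_space[OF S(2) that] by blast+
  note [measurable] = measurable_funpow[OF S(1)] measurable_funpow[OF S(2)] A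
  \<comment> \<open>Visiting \<open>A\<close> infinitely often in both directions is a property of
    the whole orbit, so every visit to \<open>A\<close> of an orbit starting in \<open>A'\<close>
    lies in \<open>A'\<close> again. A single return to \<open>A\<close> would not be inherited in
    this way.\<close>
  define A' where "A' = {x \<in> space M. x \<in> A \<and> (\<forall>N. \<exists>n\<ge>N. (S ^^ n) x \<in> A) \<and> (\<forall>N. \<exists>n\<ge>N. (S' ^^ n) x \<in> A)}"
  have A': "A' \<in> sets M" unfolding A'_def by measurable
  have A'AE: "AE x in M. x \<in> A \<longleftrightarrow> x \<in> A'"
    using infinite_recurrence[OF Smp A] infinite_recurrence[OF S'mp A] AE_space
    by eventually_elim (auto simp: A'_def)
  \<comment> \<open>Stated for arbitrary \<open>S\<close> and \<open>S'\<close> so that it serves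
    both directions of time.\<close>
  have step: "(S ^^ n) x \<in> A'"
    if SS: "\<And>x. x \<in> space M \<Longrightarrow> S x \<in> space M" "\<And>x. x \<in> space M \<Longrightarrow> S' (S x) = x"
      and x: "x \<in> space M" "\<forall>N. \<exists>n\<ge>N. (S ^^ n) x \<in> A" "\<forall>N. \<exists>n\<ge>N. (S' ^^ n) x \<in> A"
      and n: "(S ^^ n) x \<in> A" and A': "A' = {x \<in> space M. x \<in> A \<and> (\<forall>N. \<exists>n\<ge>N. (S ^^ n) x \<in> A) \<and> (\<forall>N. \<exists>n\<ge>N. (S' ^^ n) x \<in> A)}"
    for S S' x n A'
  proof -
    have "\<exists>m\<ge>N. (S ^^ m) ((S ^^ n) x) \<in> A" for N
    proof -
      obtain m where m: "m \<ge> N + n" "(S ^^ m) x \<in> A" using x(2) by blast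
      have "(S ^^ (m - n)) ((S ^^ n) x) = (S ^^ ((m - n) + n)) x" by (simp add: funpow_add)
      with m show ?thesis by (intro exI[of _ "m - n"]) simp
    qed
    moreover have "\<exists>m\<ge>N. (S' ^^ m) ((S ^^ n) x) \<in> A" for N
    proof -
      obtain m where m: "m \<ge> N" "(S' ^^ m) x \<in> A" using x(3) by blast
      have "(S' ^^ (m + n)) ((S ^^ n) x) = (S' ^^ m) x"
        using funpow_inverse[of "space M" S S', OF SS x(1), of n n] by (simp add: funpow_add)
      with m show ?thesis by (intro exI[of _ "m + n"]) simp
    qed
    moreover have "(S ^^ n) x \<in> space M" using SS(1) x(1) by (induction n) auto
    ultimately show ?thesis using n A' by simp
  qed
  have rec1: "\<exists>n>0. (S ^^ n) x \<in> A'" if "x \<in> A'" for x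
  proof -
    from that have x: "x \<in> space M" "\<forall>N. \<exists>n\<ge>N. (S ^^ n) x \<in> A" "\<forall>N. \<exists>n\<ge>N. (S' ^^ n) x \<in> A"
      by (auto simp: A'_def)
    from x(2) obtain n where n: "n \<ge> 1" "(S ^^ n) x \<in> A" by blast
    have "(S ^^ n) x \<in> A'" by (rule step[of S S', OF sp(1) S'S x n(2) A'_def])
    with n show ?thesis by (intro exI[of _ n]) simp
  qed
  have rec2: "\<exists>n>0. (S' ^^ n) x \<in> A'" if "x \<in> A'" for x
  proof -
    from that have x: "x \<in> space M" "\<forall>N. \<exists>n\<ge>N. (S ^^ n) x \<in> A" "\<forall>N. \<exists>n\<ge>N. (S' ^^ n) x \<in> A"
      by (auto simp: A'_def)
    from x(3) obtain n where n: "n \<ge> 1" "(S' ^^ n) x \<in> A" by blast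
    have "A' = {x \<in> space M. x \<in> A \<and> (\<forall>N. \<exists>n\<ge>N. (S' ^^ n) x \<in> A) \<and> (\<forall>N. \<exists>n\<ge>N. (S ^^ n) x \<in> A)}"
      by (auto simp: A'_def)
    from step[of S' S, OF sp(2) SS' x(1,3,2) n(2) this] n show ?thesis by (intro exI[of _ n]) simp
  qed
  show thesis
  proof
    show "induced_map A' S \<in> mp_bijections M"
      by (rule induced_map_in_mp_bijections[OF M(2) S S'mp S'S SS' A' rec1 rec2])
    have "AE x in M. \<forall>n. (S ^^ n) x \<in> A \<longleftrightarrow> (S ^^ n) x \<in> A'"
      unfolding AE_all_countable using mpres_AE[OF mpres_funpow[OF Smp] A'AE] by blast
    moreover have "AE x in M. induced_map A T x = induced_map A S x"
      by (rule induced_map_cong_AE[OF Smp Tmp]) (use ST in \<open>eventually_elim; simp\<close>)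
    ultimately show "AE x in M. induced_map A T x = induced_map A' S x"
    proof eventually_elim
      fix x assume x: "\<forall>n. (S ^^ n) x \<in> A \<longleftrightarrow> (S ^^ n) x \<in> A'" "induced_map A T x = induced_map A S x"
      from x(1) have "return_time A S x = return_time A' S x" by (intro return_time_cong) blast
      with x(2) show "induced_map A T x = induced_map A' S x" by (simp add: induced_map_def)
    qed
  qed
qed

section \<open>The homotopy\<close>

text \<open>In base 3 the tail of the difference series stays below its leading term.\<close>

lemma ternary_expansion_inj:
  fixes a b :: "nat \<Rightarrow> real"
  assumes ab: "\<And>n. a n \<in> {0, 1}" "\<And>n. b n \<in> {0, 1}"
    and eq: "(\<Sum>n. (1/3)^n * a n) = (\<Sum>n. (1/3)^n * b n)"
  shows "a n = b n"
proof -
  define d where "d n = a n - b n" for n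
  have d: "d n = 0 \<or> \<bar>d n\<bar> = 1" for n using ab[of n] by (auto simp: d_def)
  have d1: "\<bar>d n\<bar> \<le> 1" for n using d[of n] by auto
  define s where "s n = (\<Sum>k. (1/3)^k * d (k + n))" for n
  have geo: "summable (\<lambda>k. (1/3 :: real)^k)" "(\<Sum>k. (1/3 :: real)^k) = 3/2"
    using summable_geometric[of "1/3 :: real"] suminf_geometric[of "1/3 :: real"] by simp_all
  have bound: "norm ((1/3)^k * d (k + n)) \<le> (1/3)^k" for k n
    using d1[of "k + n"] by (simp add: abs_mult mult_left_le)
  have sum: "summable (\<lambda>k. (1/3)^k * d (k + n))" for n
    by (rule summable_comparison_test'[OF geo(1)]) (rule bound)
  have s_le: "\<bar>s n\<bar> \<le> 3/2" for n
  proof -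
    have "norm (\<Sum>k. (1/3)^k * d (k + n)) \<le> (\<Sum>k. (1/3 :: real)^k)"
      by (rule norm_suminf_le[OF bound geo(1)])
    then show ?thesis by (simp add: s_def geo(2))
  qed
  have s_Suc: "s n = d n + s (Suc n) / 3" for n
  proof -
    have "s n = d n + (\<Sum>k. (1/3)^(Suc k) * d (Suc k + n))"
      using suminf_split_head[OF sum[of n]] by (simp add: s_def)
    also have "(\<lambda>k. (1/3)^(Suc k) * d (Suc k + n)) = (\<lambda>k. (1/3) * ((1/3)^k * d (k + Suc n)))"
      by (simp add: fun_eq_iff)
    also have "(\<Sum>k. (1/3) * ((1/3)^k * d (k + Suc n))) = s (Suc n) / 3"
      by (subst suminf_mult[OF sum]) (simp add: s_def)
    finally show ?thesis .
  qed
  have bound_ab: "norm ((1/3)^n * a n) \<le> (1/3)^n" "norm ((1/3)^n * b n) \<le> (1/3)^n" for n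
    using ab[of n] by auto
  have sa: "summable (\<lambda>n. (1/3)^n * a n)" "summable (\<lambda>n. (1/3)^n * b n)"
    by (rule summable_comparison_test'[OF geo(1) bound_ab(1)], rule summable_comparison_test'[OF geo(1) bound_ab(2)])
  have "s 0 = 0"
    using suminf_diff[OF sa] eq by (simp add: s_def d_def right_diff_distrib)
  have step: "d n = 0 \<and> s (Suc n) = 0" if "s n = 0" for n
    using s_Suc[of n] s_le[of "Suc n"] d[of n] that by auto
  have "s n = 0" by (induction n) (use \<open>s 0 = 0\<close> step in auto)
  with step have "d n = 0" by blast
  then show ?thesis by (simp add: d_def)
qed

text \<open>The pattern of memberships in a separating sequence is read as a base-3 expansion with
  digits 0 and 1. An injective parameter is enough for the homotopy; its distribution need not be
  uniform.\<close>

lemma standard_borel_inj_real: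
  fixes M :: "'x measure"
  assumes M: "standard_borel M" "space M \<noteq> {}"
  obtains u :: "'x \<Rightarrow> real" where "u \<in> borel_measurable M" "inj_on u (space M)" "\<And>x. 0 \<le> u x" "\<And>x. u x < 1"
proof -
  obtain B :: "nat \<Rightarrow> 'x set" where B: "\<And>n. B n \<in> sets M"
    and sep: "\<And>x y. x \<in> space M \<Longrightarrow> y \<in> space M \<Longrightarrow> x \<noteq> y \<Longrightarrow> \<exists>n. x \<in> B n \<and> y \<notin> B n"
    using separating_sets[OF M] by blast
  define v where "v x = (\<Sum>n. (1/3)^n * (indicator (B n) x :: real))" for x
  have geo: "summable (\<lambda>k. (1/3 :: real)^k)" "(\<Sum>k. (1/3 :: real)^k) = 3/2"
    using summable_geometric[of "1/3 :: real"] suminf_geometric[of "1/3 :: real"] by simp_all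
  have sum: "summable (\<lambda>n. (1/3)^n * (indicator (B n) x :: real))" for x
    by (rule summable_comparison_test'[OF geo(1)]) (simp add: indicator_def)
  have v0: "0 \<le> v x" for x unfolding v_def by (intro suminf_nonneg sum) simp
  have v1: "v x \<le> 3/2" for x
    unfolding v_def geo(2)[symmetric] by (intro suminf_le sum geo(1)) (simp add: indicator_def)
  have vm: "v \<in> borel_measurable M" unfolding v_def[abs_def]
    by (intro borel_measurable_suminf borel_measurable_times borel_measurable_const borel_measurable_indicator B)
  show thesis
  proof
    \<comment> \<open>The geometric series bounds \<open>v\<close> by 3/2, so division by 3 puts the
      values strictly below 1. Strictness makes the sublevel set at time 0 the whole space.\<close>
    show "(\<lambda>x. v x / 3) \<in> borel_measurable M" using vm by (intro borel_measurable_divide borel_measurable_const)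
    show "0 \<le> v x / 3" "v x / 3 < 1" for x using v0[of x] v1[of x] by simp_all
    show "inj_on (\<lambda>x. v x / 3) (space M)"
    proof (rule inj_onI, rule ccontr)
      fix x y assume xy: "x \<in> space M" "y \<in> space M" "v x / 3 = v y / 3" "x \<noteq> y"
      from sep[OF xy(1,2,4)] obtain n where n: "x \<in> B n" "y \<notin> B n" by blast
      have "(indicator (B n) x :: real) = indicator (B n) y"
        by (rule ternary_expansion_inj[of "\<lambda>n. indicator (B n) x" "\<lambda>n. indicator (B n) y"])
          (use xy(3) in \<open>auto simp: v_def indicator_def\<close>)
      with n show False by simp
    qed
  qed
qed

lemma nonatomic_null_sets:
  assumes "nonatomic M" "A \<in> sets M" "\<And>x y. x \<in> A \<Longrightarrow> y \<in> A \<Longrightarrow> x = y"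
  shows "A \<in> null_sets M"
proof (rule ccontr)
  assume "A \<notin> null_sets M"
  with assms(2) have "emeasure M A > 0" by (auto simp: null_sets_def zero_less_iff_neq_zero)
  then obtain B where B: "B \<subseteq> A" "0 < emeasure M B" "emeasure M B < emeasure M A"
    using assms(1,2) unfolding nonatomic_def by blast
  then obtain x where "x \<in> B" by (cases "B = {}") auto
  with B(1) assms(3) have "A \<subseteq> B" by blast
  with B show False by auto
qed

text \<open>The level set of \<open>c'\<close> has at most one point by injectivity and is therefore
  null by nonatomicity; off it, membership in the sublevel sets is eventually constant.\<close>

lemma conv_meas_sublevel:
  fixes u :: "'x \<Rightarrow> real"
  assumes M: "prob_space M" "nonatomic M" and u: "u \<in> borel_measurable M" "inj_on u (space M)"
    and c: "c \<longlonglongrightarrow> c'"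
  shows "conv_meas M (\<lambda>k x. indicator {x \<in> space M. u x < c k} x :: real) (\<lambda>x. indicator {x \<in> space M. u x < c'} x)"
proof -
  interpret prob_space M by fact
  note [measurable] = u(1)
  have "{x \<in> space M. u x = c'} \<in> null_sets M"
    by (rule nonatomic_null_sets[OF M(2)]) (use u(2) in \<open>auto dest: inj_onD\<close>)
  from AE_not_in[OF this] have ae: "AE x in M. u x \<noteq> c'"
    by (rule AE_mp) (auto intro!: AE_I2)
  show ?thesis
  proof (rule conv_measI_AE)
    fix s :: "nat \<Rightarrow> nat" assume s: "strict_mono s"
    have cs: "(\<lambda>k. c (s k)) \<longlonglongrightarrow> c'" using LIMSEQ_subseq_LIMSEQ[OF c s] by (simp add: o_def)
    have "AE x in M. (\<lambda>k. indicator {x \<in> space M. u x < c (s (id k))} x :: real) \<longlonglongrightarrow> indicator {x \<in> space M. u x < c'} x"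
      using ae
    proof eventually_elim
      fix x assume "u x \<noteq> c'"
      then consider "u x < c'" | "c' < u x" by linarith
      then have "\<forall>\<^sub>F k in sequentially. u x < c (s k) \<longleftrightarrow> u x < c'"
      proof cases
        case 1
        from order_tendstoD(1)[OF cs 1] show ?thesis by eventually_elim (use 1 in simp)
      next
        case 2
        from order_tendstoD(2)[OF cs 2] show ?thesis by eventually_elim (use 2 in simp)
      qed
      then show "(\<lambda>k. indicator {x \<in> space M. u x < c (s (id k))} x :: real) \<longlonglongrightarrow> indicator {x \<in> space M. u x < c'} x"
        unfolding tendsto_indicator_iff by eventually_elim simp
    qed
    then show "\<exists>r. strict_mono r \<and> (AE x in M. (\<lambda>k. indicator {x \<in> space M. u x < c (s (r k))} x :: real)
        \<longlonglongrightarrow> indicator {x \<in> space M. u x < c'} x)"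
      by (intro exI[of _ id]) (simp add: strict_mono_def)
  qed measurable
qed

section \<open>Classes of group-valued functions and the lift of the full group\<close>

lemma ae_class_refl: "f \<in> measurable M N \<Longrightarrow> f \<in> ae_class M N f"
  by (simp add: ae_class_def)

lemma L0_rep:
  assumes "C \<in> L0 M N"
  shows "(SOME f. f \<in> C) \<in> C" "(SOME f. f \<in> C) \<in> measurable M N" "ae_class M N (SOME f. f \<in> C) = C"
proof -
  obtain f where f: "f \<in> measurable M N" "C = ae_class M N f" using assms unfolding L0_def by blast
  have "f \<in> C" using f by (simp add: ae_class_refl)
  then show *: "(SOME f. f \<in> C) \<in> C" by (rule someI[of "\<lambda>f. f \<in> C"])
  then show "(SOME f. f \<in> C) \<in> measurable M N" using f by (simp add: ae_class_def)
  then have "ae_class M N (SOME f. f \<in> C) = ae_class M N f"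
    using * f(1) unfolding f(2) by (simp add: ae_class_eq_iff) (simp add: ae_class_def)
  then show "ae_class M N (SOME f. f \<in> C) = C" by (simp only: f(2)[symmetric])
qed

lemma orbit_map_ae_class:
  fixes act :: "'g::{polish_space,topological_group_add} \<Rightarrow> 'x \<Rightarrow> 'x"
  assumes f: "f \<in> borel_measurable M"
  shows "orbit_map M act (ae_class M borel f) = ae_class M M (\<lambda>x. act (f x) x)"
proof (intro set_eqI iffI)
  fix h assume "h \<in> orbit_map M act (ae_class M borel f)"
  then obtain g where g: "h \<in> measurable M M" "AE x in M. g x = f x" "AE x in M. h x = act (g x) x"
    by (auto simp: orbit_map_def ae_class_def)
  from g(2,3) have "AE x in M. h x = act (f x) x" by eventually_elim simp
  with g(1) show "h \<in> ae_class M M (\<lambda>x. act (f x) x)" by (simp add: ae_class_def)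
next
  fix h assume "h \<in> ae_class M M (\<lambda>x. act (f x) x)"
  with ae_class_refl[OF f] show "h \<in> orbit_map M act (ae_class M borel f)"
    by (auto simp: orbit_map_def ae_class_def)
qed

lemma ae_class_in_full_group_lift_iff:
  fixes act :: "'g::{polish_space,topological_group_add} \<Rightarrow> 'x \<Rightarrow> 'x"
  assumes act: "borel_action M act" and f: "f \<in> borel_measurable M"
  shows "ae_class M borel f \<in> full_group_lift M act \<longleftrightarrow>
    (\<exists>T\<in>mp_bijections M. AE x in M. act (f x) x = T x)"
proof -
  have "ae_class M borel f \<in> full_group_lift M act \<longleftrightarrow>
      (\<exists>T\<in>mp_bijections M. ae_class M M (\<lambda>x. act (f x) x) = ae_class M M T)"
    using f by (auto simp: full_group_lift_def orbit_map_ae_class Aut_def L0_def)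
  also have "\<dots> \<longleftrightarrow> (\<exists>T\<in>mp_bijections M. AE x in M. act (f x) x = T x)"
    using ae_class_eq_iff[OF borel_action_measurable[OF act f]] by (auto simp: mp_bijections_def)
  finally show ?thesis .
qed

text \<open>Both factors are first countable, so continuity on the product may be tested on
  sequences. Boxes of side \<open>inverse (real (Suc k))\<close> supply the sequence contradicting a
  failure of continuity.\<close>

lemma (in Metric_space) continuous_map_prod_sequentially:
  fixes I :: "real set"
  assumes S: "S \<subseteq> M" and h: "\<And>t a. t \<in> I \<Longrightarrow> a \<in> S \<Longrightarrow> h (t, a) \<in> S"
    and seq: "\<And>t a s x. t \<in> I \<Longrightarrow> a \<in> S \<Longrightarrow> (\<And>k :: nat. s k \<in> I) \<Longrightarrow> (\<And>k. x k \<in> S) \<Longrightarrow> s \<longlonglongrightarrow> t \<Longrightarrow>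
      (\<lambda>k. d (x k) a) \<longlonglongrightarrow> 0 \<Longrightarrow> (\<lambda>k. d (h (s k, x k)) (h (t, a))) \<longlonglongrightarrow> 0"
  shows "continuous_map (prod_topology (top_of_set I) (subtopology mtopology S)) (subtopology mtopology S) h"
    (is "continuous_map ?X ?Y h")
  unfolding continuous_map_def
proof (intro conjI allI impI)
  have tX: "topspace ?X = I \<times> S" and tY: "topspace ?Y = S" using S by auto
  show "h \<in> topspace ?X \<rightarrow> topspace ?Y" unfolding tX tY using h by auto
  fix U assume "openin ?Y U"
  then obtain V where V: "openin mtopology V" "U = V \<inter> S" by (auto simp: openin_subtopology)
  show "openin ?X {p \<in> topspace ?X. h p \<in> U}"
    unfolding openin_prod_topology_alt tX
  proof (intro allI impI)
    fix t a assume "(t, a) \<in> {p \<in> I \<times> S. h p \<in> U}"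
    then have ta: "t \<in> I" "a \<in> S" "h (t, a) \<in> V" using V(2) by auto
    from V(1) ta(3) obtain r where r: "r > 0" "mball (h (t, a)) r \<subseteq> V" by (auto simp: openin_mtopology)
    define A where "A k = I \<inter> ball t (inverse (real (Suc k)))" for k
    define B where "B k = S \<inter> mball a (inverse (real (Suc k)))" for k
    have oA: "openin (top_of_set I) (A k)" for k unfolding A_def by (simp add: openin_open_Int)
    have oB: "openin (subtopology mtopology S) (B k)" for k unfolding B_def
      by (auto simp: openin_subtopology)
    have tA: "t \<in> A k" and aB: "a \<in> B k" for k using ta S by (auto simp: A_def B_def)
    have "\<exists>k. A k \<times> B k \<subseteq> {p \<in> I \<times> S. h p \<in> U}"
    proof (rule ccontr)
      assume "\<nexists>k. A k \<times> B k \<subseteq> {p \<in> I \<times> S. h p \<in> U}"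
      then have "\<forall>k. \<exists>p. p \<in> A k \<times> B k \<and> p \<notin> {p \<in> I \<times> S. h p \<in> U}" by blast
      then obtain p where p: "\<And>k. p k \<in> A k \<times> B k" "\<And>k. p k \<notin> {p \<in> I \<times> S. h p \<in> U}" by metis
      define s where "s k = fst (p k)" for k
      define x where "x k = snd (p k)" for k
      have pk: "p k = (s k, x k)" for k by (simp add: s_def x_def)
      have sI: "s k \<in> I" "dist t (s k) < inverse (real (Suc k))" for k
        using p(1)[of k] by (auto simp: pk A_def)
      have xS: "x k \<in> S" "d a (x k) < inverse (real (Suc k))" for k
        using p(1)[of k] by (auto simp: pk B_def)
      have "(\<lambda>k. dist (s k) t) \<longlonglongrightarrow> 0"
        by (rule tendsto_sandwich[OF _ _ tendsto_const LIMSEQ_inverse_real_of_nat])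
          (use sI(2) in \<open>auto intro!: always_eventually less_imp_le simp: dist_commute\<close>)
      then have st: "s \<longlonglongrightarrow> t" by (rule iffD2[OF tendsto_dist_iff])
      have xa: "(\<lambda>k. d (x k) a) \<longlonglongrightarrow> 0"
        by (rule tendsto_sandwich[OF _ _ tendsto_const LIMSEQ_inverse_real_of_nat])
          (use xS(2) in \<open>auto intro!: always_eventually less_imp_le simp: commute[of _ a]\<close>)
      have "(\<lambda>k. d (h (s k, x k)) (h (t, a))) \<longlonglongrightarrow> 0"
        by (rule seq[OF ta(1,2) sI(1) xS(1) st xa])
      from order_tendstoD(2)[OF this r(1)] obtain k where k: "d (h (s k, x k)) (h (t, a)) < r"
        unfolding eventually_sequentially by blast
      have "h (s k, x k) \<in> S" "h (t, a) \<in> S" using h ta sI xS by blast+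
      then have "h (s k, x k) \<in> mball (h (t, a)) r" using k S by (auto simp: commute)
      then have "h (p k) \<in> U" using r(2) V(2) \<open>h (s k, x k) \<in> S\<close> by (auto simp: pk)
      then show False using p(2)[of k] sI(1)[of k] xS(1)[of k] by (simp add: pk)
    qed
    then obtain k where k: "A k \<times> B k \<subseteq> {p \<in> I \<times> S. h p \<in> U}" by blast
    show "\<exists>U' V'. openin (top_of_set I) U' \<and> openin (subtopology mtopology S) V' \<and> t \<in> U' \<and> a \<in> V' \<and>
        U' \<times> V' \<subseteq> {p \<in> I \<times> S. h p \<in> U}"
      by (intro exI[of _ "A k"] exI[of _ "B k"] conjI oA oB tA aB k)
  qed
qed

lemma full_group_lift_rep:
  fixes act :: "'g::{polish_space,topological_group_add} \<Rightarrow> 'x \<Rightarrow> 'x"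
  assumes act: "borel_action M act" and C: "C \<in> full_group_lift M act"
  shows "(SOME f. f \<in> C) \<in> borel_measurable M" "ae_class M borel (SOME f. f \<in> C) = C"
    "mpres M (\<lambda>x. act ((SOME f. f \<in> C) x) x)"
proof -
  have "C \<in> L0 M borel" using C by (simp add: full_group_lift_def)
  note rep = L0_rep[OF this]
  show f: "(SOME f. f \<in> C) \<in> borel_measurable M" and eq: "ae_class M borel (SOME f. f \<in> C) = C" by (fact rep)+
  obtain T where "T \<in> mp_bijections M" "AE x in M. act ((SOME f. f \<in> C) x) x = T x"
    using ae_class_in_full_group_lift_iff[OF act f] C eq by auto
  then show "mpres M (\<lambda>x. act ((SOME f. f \<in> C) x) x)"
    using mpres_cong_AE[OF mp_bijections_mpres borel_action_measurable[OF act f]] by blast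
qed

text \<open>Keeps the homotopy inside the lift. The induced map is treated through the genuine
  bijection \<open>T\<close>, since \<open>\<lambda>x. act (f x) x\<close> is known to agree with it
  only almost everywhere.\<close>

lemma induced_cocycle_in_full_group_lift:
  fixes act :: "'g::{polish_space,topological_group_add} \<Rightarrow> 'x \<Rightarrow> 'x"
  assumes M: "standard_borel M" "prob_space M" and act: "borel_action M act"
    and f: "f \<in> borel_measurable M" and lift: "ae_class M borel f \<in> full_group_lift M act" and A: "A \<in> sets M"
  shows "ae_class M borel (induced_cocycle A f (\<lambda>x. act (f x) x)) \<in> full_group_lift M act"
proof -
  interpret prob_space M by fact
  let ?\<tau> = "\<lambda>x. act (f x) x"
  obtain T where T: "T \<in> mp_bijections M" "AE x in M. ?\<tau> x = T x"
    using lift ae_class_in_full_group_lift_iff[OF act f] by blast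
  have \<tau>: "?\<tau> \<in> measurable M M" by (rule borel_action_measurable[OF act f])
  have Tmp: "mpres M T" by (rule mp_bijections_mpres[OF T(1)])
  have \<tau>mp: "mpres M ?\<tau>" by (rule mpres_cong_AE[OF Tmp \<tau> T(2)])
  obtain R where R: "R \<in> mp_bijections M" "AE x in M. induced_map A T x = R x"
    using induced_map_AE_mp_bijection[OF M T(1) A] by blast
  have "AE x in M. act (induced_cocycle A f ?\<tau> x) x = R x"
    using induced_map_cong_AE[OF Tmp \<tau>mp T(2), of A] R(2) AE_space
  proof eventually_elim
    fix x assume x: "induced_map A ?\<tau> x = induced_map A T x" "induced_map A T x = R x" "x \<in> space M"
    from act_induced_cocycle[OF act f x(3), of A] x(1,2) show "act (induced_cocycle A f ?\<tau> x) x = R x" by simp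
  qed
  with R(1) show ?thesis
    by (subst ae_class_in_full_group_lift_iff[OF act induced_cocycle_measurable[OF \<tau> f A]]) blast
qed

text \<open>The topology is defined by the preimage condition, so surjectivity is the only point
  with content.\<close>

lemma quotient_map_orbit_map:
  fixes M :: "'x measure"
    and act :: "'g::{polish_space,topological_group_add} \<Rightarrow> 'x \<Rightarrow> 'x"
  assumes M: "standard_borel M" "prob_space M" and act: "borel_action M act"
  shows "quotient_map (subtopology (L0_topology M) (full_group_lift M act)) (full_group_topology M act)
    (orbit_map M act)"
proof -
  interpret L: Metric_space "L0 M (borel :: 'g measure)" "L0_dist M" by (rule Metric_space_L0[OF M(2)])
  let ?X = "subtopology (L0_topology M) (full_group_lift M act)"
  have tX: "topspace ?X = full_group_lift M act"
    by (auto simp: L0_topology_def full_group_lift_def)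
  have "orbit_map M act ` full_group_lift M act = orbit_full_group M act"
  proof (intro set_eqI iffI)
    fix D assume "D \<in> orbit_map M act ` full_group_lift M act"
    then obtain C where C: "C \<in> full_group_lift M act" "D = orbit_map M act C" by blast
    define f where "f = (SOME f. f \<in> C)"
    have f: "f \<in> borel_measurable M" "ae_class M borel f = C"
      unfolding f_def by (fact full_group_lift_rep[OF act C(1)])+
    from C(1) obtain T where T: "T \<in> mp_bijections M" "AE x in M. act (f x) x = T x"
      using ae_class_in_full_group_lift_iff[OF act f(1)] f(2) by auto
    have "D = ae_class M M T"
      unfolding C(2) f(2)[symmetric] orbit_map_ae_class[OF f(1)]
      using T borel_action_measurable[OF act f(1)] by (subst ae_class_eq_iff) (auto simp: mp_bijections_def)
    moreover have "AE x in M. T x \<in> range (\<lambda>g. act g x)"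
      using T(2) by eventually_elim (metis rangeI)
    ultimately show "D \<in> orbit_full_group M act" using T(1) by (auto simp: orbit_full_group_def)
  next
    fix D assume "D \<in> orbit_full_group M act"
    then obtain T where T: "T \<in> mp_bijections M" "AE x in M. T x \<in> range (\<lambda>g. act g x)" "D = ae_class M M T"
      by (auto simp: orbit_full_group_def)
    have Tm: "T \<in> measurable M M" using T(1) by (simp add: mp_bijections_def)
    obtain f where f: "f \<in> borel_measurable M" "AE x in M. T x = act (f x) x"
      using orbit_selection_AE[OF M act Tm T(2)] by blast
    from f(2) have fT: "AE x in M. act (f x) x = T x" by eventually_elim simp
    have "ae_class M borel f \<in> full_group_lift M act"
      using ae_class_in_full_group_lift_iff[OF act f(1)] T(1) fT by blast
    moreover have "D = orbit_map M act (ae_class M borel f)"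
      unfolding T(3) orbit_map_ae_class[OF f(1)]
      using ae_class_eq_iff[OF Tm borel_action_measurable[OF act f(1)]] f(2) by blast
    ultimately show "D \<in> orbit_map M act ` full_group_lift M act" by blast
  qed
  then show ?thesis
    unfolding quotient_map_def tX topspace_full_group_topology
    unfolding full_group_topology_def openin_quotient_topology tX by blast
qed

theorem corollary4p3:
  fixes M :: "'x measure"
    and act :: "'g::{polish_space,topological_group_add} \<Rightarrow> 'x \<Rightarrow> 'x"
  assumes "standard_probability_space M"
    and "borel_action M act"
  shows "contractible_space (full_group_topology M act)"
proof -
  have M: "standard_borel M" "prob_space M" and na: "nonatomic M"
    using assms(1) by (auto simp: standard_probability_space_def)
  note act = assms(2)
  interpret prob_space M by (rule M(2))
  interpret L: Metric_space "L0 M (borel :: 'g measure)" "L0_dist M" by (rule Metric_space_L0[OF M(2)])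
  obtain u :: "'x \<Rightarrow> real" where u: "u \<in> borel_measurable M" "inj_on u (space M)"
    and u01: "\<And>x. 0 \<le> u x" "\<And>x. u x < 1"
    using standard_borel_inj_real[OF M(1) not_empty] by blast
  \<comment> \<open>The sets shrink from the whole space, where every return time is 1, at
    \<open>t = 0\<close> to the empty set at \<open>t = 1\<close>, because \<open>u\<close> takes
    values in [0,1).\<close>
  define A where "A t = {x \<in> space M. u x < 1 - t}" for t
  have A: "A t \<in> sets M" for t unfolding A_def using u(1) by measurable
  let ?lift = "full_group_lift M act"
  let ?X = "subtopology (L0_topology M) ?lift"
  let ?I = "top_of_set {0..1 :: real}"
  have lift_sub: "?lift \<subseteq> L0 M borel" by (auto simp: full_group_lift_def)
  define rep where "rep C = (SOME f. f \<in> C)" for C :: "('x \<Rightarrow> 'g) set"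
  have rep: "rep C \<in> borel_measurable M" "ae_class M borel (rep C) = C" "mpres M (\<lambda>x. act (rep C x) x)"
    if "C \<in> ?lift" for C
    unfolding rep_def by (fact full_group_lift_rep[OF act that])+
  define ic where "ic t C = induced_cocycle (A t) (rep C) (\<lambda>x. act (rep C x) x)" for t C
  have ic: "ic t C \<in> borel_measurable M" if "C \<in> ?lift" for t C
    unfolding ic_def by (rule induced_cocycle_measurable[OF mpresD[OF rep(3)[OF that]] rep(1)[OF that] A])
  \<comment> \<open>The homotopy upstairs, written with chosen representatives; the choice is
    harmless for continuity because \<open>L0_dist\<close> can be computed on any
    representatives.\<close>
  define Hl where "Hl = (\<lambda>(t, C). ae_class M borel (ic t C))"
  have Hl: "Hl (t, C) \<in> ?lift" if "C \<in> ?lift" for t C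
    unfolding Hl_def ic_def prod.case
    by (rule induced_cocycle_in_full_group_lift[OF M act rep(1)[OF that] _ A]) (simp only: rep(2)[OF that] that)
  have "continuous_map (prod_topology ?I ?X) ?X Hl"
    unfolding L0_topology_def
  proof (rule L.continuous_map_prod_sequentially[where I = "{0..1}" and S = ?lift and h = Hl])
    show "?lift \<subseteq> L0 M borel" by (rule lift_sub)
    show "Hl (t, C) \<in> ?lift" if "C \<in> ?lift" for t C by (rule Hl[OF that])
  next
    fix t :: real and C s and X :: "nat \<Rightarrow> ('x \<Rightarrow> 'g) set"
    assume C: "C \<in> ?lift" and X: "\<And>k. X k \<in> ?lift" and s: "s \<longlonglongrightarrow> t"
      and XC: "(\<lambda>k. L0_dist M (X k) C) \<longlonglongrightarrow> 0"
    have "L0_dist M (X k) C = (LINT x|M. min 1 (dist (rep (X k) x) (rep C x)))" for k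
      using L0_dist_eq[OF rep(1)[OF X[of k]] rep(1)[OF C]] by (simp only: rep(2)[OF X] rep(2)[OF C])
    with XC have cr: "conv_meas M (\<lambda>k. rep (X k)) (rep C)" by (simp add: conv_meas_def)
    have "(\<lambda>k. 1 - s k) \<longlonglongrightarrow> 1 - t" by (intro tendsto_intros s)
    from conv_meas_sublevel[OF M(2) na u this]
    have cA: "conv_meas M (\<lambda>k x. indicator (A (s k)) x :: real) (\<lambda>x. indicator (A t) x)" by (simp only: A_def)
    have "conv_meas M (\<lambda>k. ic (s k) (X k)) (ic t C)"
      unfolding ic_def
      by (rule conv_meas_induced_cocycle[OF M act rep(1)[OF X] rep(1)[OF C] cr rep(3)[OF X] rep(3)[OF C] A A cA])
    moreover have "L0_dist M (Hl (s k, X k)) (Hl (t, C)) = (LINT x|M. min 1 (dist (ic (s k) (X k) x) (ic t C x)))" for k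
      using L0_dist_eq[OF ic[OF X] ic[OF C]] by (simp add: Hl_def)
    ultimately show "(\<lambda>k. L0_dist M (Hl (s k, X k)) (Hl (t, C))) \<longlonglongrightarrow> 0" by (simp add: conv_meas_def)
  qed
  from continuous_map_compose[OF this quotient_imp_continuous_map[OF quotient_map_orbit_map[OF M act]]]
  have cont: "continuous_map (prod_topology ?I ?X) (full_group_topology M act) (orbit_map M act \<circ> Hl)" .
  \<comment> \<open>Downstairs the homotopy is defined from \<open>T\<close> alone. The induced map
    depends on \<open>T\<close> only up to null sets, so \<open>H\<close> is well defined on classes
    and is the map that \<open>Hl\<close> induces on the quotient.\<close>
  define H where "H = (\<lambda>(t, D). ae_class M M (induced_map (A t) (SOME T. T \<in> D)))"
  have H_rep: "H (t, D) = ae_class M M (induced_map (A t) T)"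
    if T: "mpres M T" "D = ae_class M M T" for t D T
  proof -
    have "D \<in> L0 M M" using T mpresD by (auto simp: L0_def)
    note r = L0_rep[OF this]
    have ae: "AE x in M. (SOME T. T \<in> D) x = T x"
      using r(1) unfolding T(2) by (simp add: ae_class_def)
    have mp: "mpres M (SOME T. T \<in> D)" by (rule mpres_cong_AE[OF T(1) r(2) ae])
    have "ae_class M M (induced_map (A t) (SOME T. T \<in> D)) = ae_class M M (induced_map (A t) T)"
      using induced_map_cong_AE[OF T(1) mp ae, of "A t"]
      by (subst ae_class_eq_iff) (intro induced_map_measurable mpresD[OF mp] mpresD[OF T(1)] A | assumption)+
    then show ?thesis by (simp add: H_def)
  qed
  have tP: "topspace (prod_topology ?I ?X) = {0..1} \<times> ?lift"
    using lift_sub by (auto simp: L0_topology_def)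
  have "(orbit_map M act \<circ> Hl) p = (H \<circ> (\<lambda>(t, C). (t, orbit_map M act C))) p"
    if p: "p \<in> topspace (prod_topology ?I ?X)" for p
  proof -
    obtain t C where tC: "p = (t, C)" "C \<in> ?lift" using p unfolding tP by auto
    let ?\<tau> = "\<lambda>x. act (rep C x) x"
    have "orbit_map M act (Hl (t, C)) = ae_class M M (\<lambda>x. act (ic t C x) x)"
      using orbit_map_ae_class[OF ic[OF tC(2)]] by (simp add: Hl_def)
    also have "\<dots> = ae_class M M (induced_map (A t) ?\<tau>)"
      by (rule iffD2[OF ae_class_eq_iff[OF borel_action_measurable[OF act ic[OF tC(2)]]
              induced_map_measurable[OF mpresD[OF rep(3)[OF tC(2)]] A]]])
        (rule AE_I2, simp only: ic_def act_induced_cocycle[OF act rep(1)[OF tC(2)]])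
    also have "\<dots> = H (t, orbit_map M act C)"
      using orbit_map_ae_class[OF rep(1)[OF tC(2)], of act] rep(2)[OF tC(2)]
      by (intro H_rep[symmetric] rep(3)[OF tC(2)]) simp
    finally show ?thesis by (simp add: tC(1))
  qed
  from continuous_map_eq[OF cont this]
  have "continuous_map (prod_topology ?I ?X) (full_group_topology M act) (H \<circ> (\<lambda>(t, C). (t, orbit_map M act C)))" .
  moreover have "quotient_map (prod_topology ?I ?X) (prod_topology ?I (full_group_topology M act))
      (\<lambda>(t, C). (t, orbit_map M act C))"
  proof (rule quotient_map_prod_right[OF _ _ quotient_map_orbit_map[OF M act]])
    show "locally_compact_space ?I"
      by (intro compact_imp_locally_compact_space) (simp add: compact_space_subtopology)
    show "Hausdorff_space ?I \<or> regular_space ?I" by (simp add: Hausdorff_space_subtopology)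
  qed
  ultimately have contH: "continuous_map (prod_topology ?I (full_group_topology M act)) (full_group_topology M act) H"
    by (rule continuous_compose_quotient_map[rotated])
  have "homotopic_with (\<lambda>_. True) (full_group_topology M act) (full_group_topology M act) id
      (\<lambda>_. ae_class M M (\<lambda>x. x))"
    unfolding homotopic_with[of "full_group_topology M act" "\<lambda>_. True", OF refl]
  proof (intro exI[of _ H] conjI ballI contH)
    fix D assume "D \<in> topspace (full_group_topology M act)"
    then obtain T where T: "T \<in> mp_bijections M" "D = ae_class M M T"
      by (auto simp: topspace_full_group_topology orbit_full_group_def)
    have Tmp: "mpres M T" by (rule mp_bijections_mpres[OF T(1)])
    have "A 0 = space M" "A 1 = {}" using u01 by (auto simp: A_def not_less)
    have "return_time (A 0) T x = 1" if "x \<in> space M" for x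
      using that measurable_space[OF mpresD[OF Tmp] that] \<open>A 0 = space M\<close> by (intro return_time_eqI) auto
    then have "induced_map (A 0) T x = T x" if "x \<in> space M" for x using that by (simp add: induced_map_def)
    then have "ae_class M M (induced_map (A 0) T) = ae_class M M T"
      by (subst ae_class_eq_iff) (auto intro!: AE_I2 induced_map_measurable A mpresD[OF Tmp])
    then show "H (0, D) = id D" using H_rep[OF Tmp T(2)] T(2) by simp
    have "induced_map (A 1) T = (\<lambda>x. x)"
      using \<open>A 1 = {}\<close> by (simp add: induced_map_def return_time_outside fun_eq_iff)
    then show "H (1, D) = ae_class M M (\<lambda>x. x)" using H_rep[OF Tmp T(2)] by simp
  qed simp_all
  then show ?thesis unfolding contractible_space_def by blast
qed

end
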